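(* Let $K$ be a non-archimedean local field with ring of integers $\mathfrak o$ whose residue field has cardinality $q$. Then for all complex $s$ with sufficiently large real part, \[ \int_{\mathrm{GSp}^+_{2n}(K)}|\det A|_{\mathfrak p}^{s}\,\mathrm d\mu(A)=\frac{1}{1-q^{-ns}}\,\mathsf{HLS}_n\Bigl(q^{-1},\bigl(q^{\mathrm{maj}(C)-ns}\bigr)_{\varnothing\ne C\subseteq[n]}\Bigr), \] where $\mathrm{maj}(C)=\sum_{i\in C}i$.
   Context: Hall–Littlewood–Schubert series: Let $[n]=\{1,\dots,n\}$. $\mathrm{SSYT}_n$ is the set of semistandard Young tableaux with entries in $[n]$ (including the empty one); a tableau is identified with its sequence of columns $(C_1,\dots,C_\ell)$, $C_j\subseteq[n]$ the set of entries of column $j$, and $T_{ij}$ is the entry in row $i$, column $j$. $T$ is reduced if its columns are pairwise distinct; $\mathrm{rSSYT}_n$ is the finite set of reduced tableaux. For cells $(i,j),(i,j+1)$ both in $T$, $\mathrm{Leg}^+_T(i,j)=C_j\cap\{T_{ij},\dots,T_{i,j+1}\}$ if $T_{i,j+1}\notin C_j$, else $\varnothing$ ($\varnothing$ if a cell is missing). $\Phi_T(Y)=\prod_{\mathrm{Leg}^+_T(i,j)\neq\varnothing}(1-Y^{\#\mathrm{Leg}^+_T(i,j)})$. For variables $\mathbf X=(X_C)_{\varnothing\ne C\subseteq[n]}$, $\mathsf{HLS}_n(Y,\mathbf X)=\sum_{T\in\mathrm{rSSYT}_n}\Phi_T(Y)\prod_{C\in T}\frac{X_C}{1-X_C}$;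 $\mathsf{HLS}_n(Y,(f_C)_C)$ denotes the substitution $X_C\mapsto f_C$. $\mathrm{GSp}_{2n}(K)$ is the group of symplectic similitudes of a nondegenerate alternating form on $K^{2n}$ (defined over $\mathfrak o$ with unimodular Gram matrix), $\mathrm{GSp}^+_{2n}(K)=\mathrm{GSp}_{2n}(K)\cap\mathrm{Mat}_{2n}(\mathfrak o)$, and $\mu$ is the Haar measure on $\mathrm{GSp}_{2n}(K)$ normalized so that $\mu(\mathrm{GSp}_{2n}(\mathfrak o))=1$; $|\cdot|_{\mathfrak p}$ is the normalized absolute value on $K$. *)

theory Defs
  imports "HOL-Analysis.Analysis" "Jordan_Normal_Form.Determinant"
begin

text \<open>The valuation v is only meaningful on nonzero elements.\<close>

definition ring_of_integers :: "('k::field \<Rightarrow> int) \<Rightarrow> 'k set" where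
  "ring_of_integers v = {x. x = 0 \<or> 0 \<le> v x}"

definition max_ideal :: "('k::field \<Rightarrow> int) \<Rightarrow> 'k set" where
  "max_ideal v = {x. x = 0 \<or> 1 \<le> v x}"

definition residue_classes :: "('k::field \<Rightarrow> int) \<Rightarrow> 'k set set" where
  "residue_classes v =
     (\<lambda>x. {y \<in> ring_of_integers v. x - y \<in> max_ideal v}) ` ring_of_integers v"

definition kabs :: "('k::field \<Rightarrow> int) \<Rightarrow> nat \<Rightarrow> 'k \<Rightarrow> real" where
  "kabs v q x = (if x = 0 then 0 else real q powr (- real_of_int (v x)))"

definition nonarch_local_field :: "('k::field \<Rightarrow> int) \<Rightarrow> nat \<Rightarrow> bool" where
  "nonarch_local_field v q \<longleftrightarrow>
     (\<forall>x y. x \<noteq> 0 \<longrightarrow> y \<noteq> 0 \<longrightarrow> v (x * y) = v x + v y) \<and>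
     (\<forall>x y. x \<noteq> 0 \<longrightarrow> y \<noteq> 0 \<longrightarrow> x + y \<noteq> 0 \<longrightarrow> min (v x) (v y) \<le> v (x + y)) \<and>
     (\<forall>k. \<exists>x. x \<noteq> 0 \<and> v x = k) \<and>
     finite (residue_classes v) \<and> card (residue_classes v) = q \<and>
     (\<forall>X :: nat \<Rightarrow> 'k.
        (\<forall>e>0. \<exists>N. \<forall>m\<ge>N. \<forall>n\<ge>N. kabs v q (X m - X n) < e) \<longrightarrow>
        (\<exists>L. \<forall>e>0. \<exists>N. \<forall>n\<ge>N. kabs v q (X n - L) < e))"

definition alt_unimodular :: "('k::field \<Rightarrow> int) \<Rightarrow> nat \<Rightarrow> nat \<Rightarrow> 'k mat \<Rightarrow> bool" where
  "alt_unimodular v q n J \<longleftrightarrow>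
     J \<in> carrier_mat (2*n) (2*n) \<and> transpose_mat J = - J \<and>
     (\<forall>i<2*n. J $$ (i, i) = 0) \<and>
     (\<forall>i<2*n. \<forall>j<2*n. J $$ (i, j) \<in> ring_of_integers v) \<and>
     kabs v q (det J) = 1"

definition GSp :: "nat \<Rightarrow> 'k::field mat \<Rightarrow> 'k mat set" where
  "GSp n J = {A \<in> carrier_mat (2*n) (2*n).
      \<exists>c. c \<noteq> 0 \<and> transpose_mat A * J * A = c \<cdot>\<^sub>m J}"

definition integral_mat :: "('k::field \<Rightarrow> int) \<Rightarrow> nat \<Rightarrow> 'k mat \<Rightarrow> bool" where
  "integral_mat v n A \<longleftrightarrow> (\<forall>i<2*n. \<forall>j<2*n. A $$ (i, j) \<in> ring_of_integers v)"

definition GSp_plus :: "('k::field \<Rightarrow> int) \<Rightarrow> nat \<Rightarrow> 'k mat \<Rightarrow> 'k mat set" where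
  "GSp_plus v n J = {A \<in> GSp n J. integral_mat v n A}"

definition GSp_o :: "('k::field \<Rightarrow> int) \<Rightarrow> nat \<Rightarrow> nat \<Rightarrow> 'k mat \<Rightarrow> 'k mat set" where
  "GSp_o v q n J = {A \<in> GSp n J. integral_mat v n A \<and> kabs v q (det A) = 1}"

definition mat_dist :: "('k::field \<Rightarrow> int) \<Rightarrow> nat \<Rightarrow> nat \<Rightarrow> 'k mat \<Rightarrow> 'k mat \<Rightarrow> real" where
  "mat_dist v q n A B = Max {kabs v q (A $$ (i, j) - B $$ (i, j)) | i j. i < 2*n \<and> j < 2*n}"

definition GSp_opens :: "('k::field \<Rightarrow> int) \<Rightarrow> nat \<Rightarrow> nat \<Rightarrow> 'k mat \<Rightarrow> 'k mat set set" where
  "GSp_opens v q n J = {U. U \<subseteq> GSp n J \<and>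
     (\<forall>A\<in>U. \<exists>e>0. \<forall>B\<in>GSp n J. mat_dist v q n A B < e \<longrightarrow> B \<in> U)}"

text \<open>Normalized (left) Haar measure on the Borel sets of GSp_{2n}(K).
  Any left-invariant Borel measure with mu(GSp_{2n}(o)) = 1 is the normalized
  Haar measure (GSp_{2n}(K) is second countable, locally compact, and GSp_{2n}(o)
  is a compact open subgroup, so such a measure is finite on compacts, hence Radon).\<close>
definition normalized_haar :: "('k::field \<Rightarrow> int) \<Rightarrow> nat \<Rightarrow> nat \<Rightarrow> 'k mat \<Rightarrow> 'k mat measure \<Rightarrow> bool" where
  "normalized_haar v q n J M \<longleftrightarrow>
     space M = GSp n J \<and>
     sets M = sigma_sets (GSp n J) (GSp_opens v q n J) \<and>
     (\<forall>g\<in>GSp n J. \<forall>S\<in>sets M. emeasure M ((\<lambda>A. g * A) ` S) = emeasure M S) \<and>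
     emeasure M (GSp_o v q n J) = 1"

text \<open>A tableau is the list of its columns (C_1, ..., C_l); the entry in row i+1
  of a column C is the (i+1)-th smallest element of C (rows are 0-indexed here).\<close>
definition entry :: "nat set \<Rightarrow> nat \<Rightarrow> nat" where
  "entry C i = sorted_list_of_set C ! i"

definition SSYT :: "nat \<Rightarrow> nat set list \<Rightarrow> bool" where
  "SSYT n T \<longleftrightarrow> (\<forall>C\<in>set T. C \<noteq> {} \<and> C \<subseteq> {1..n}) \<and>
     (\<forall>j. Suc j < length T \<longrightarrow> card (T ! Suc j) \<le> card (T ! j) \<and>
        (\<forall>i < card (T ! Suc j). entry (T ! j) i \<le> entry (T ! Suc j) i))"

definition rSSYT :: "nat \<Rightarrow> nat set list set" where
  "rSSYT n = {T. SSYT n T \<and> distinct T}"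

text \<open>Leg^+_T(i,j) for row i, columns j, j+1 (both cells present)\<close>
definition leg_plus :: "nat set list \<Rightarrow> nat \<Rightarrow> nat \<Rightarrow> nat set" where
  "leg_plus T i j =
     (if entry (T ! Suc j) i \<notin> T ! j
      then T ! j \<inter> {entry (T ! j) i .. entry (T ! Suc j) i} else {})"

definition Phi :: "nat set list \<Rightarrow> 'a::comm_ring_1 \<Rightarrow> 'a" where
  "Phi T Y = (\<Prod>(i, j) \<in> {(i, j). Suc j < length T \<and> i < card (T ! Suc j) \<and> leg_plus T i j \<noteq> {}}.
               (1 - Y ^ card (leg_plus T i j)))"

definition HLS :: "nat \<Rightarrow> 'a::field \<Rightarrow> (nat set \<Rightarrow> 'a) \<Rightarrow> 'a" where
  "HLS n Y X = (\<Sum>T\<in>rSSYT n. Phi T Y * prod_list (map (\<lambda>C. X C / (1 - X C)) T))"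

definition maj :: "nat set \<Rightarrow> nat" where
  "maj C = \<Sum>C"

end

theory Submission
  imports Defs
begin

text \<open>On the set where the similitude factor has valuation \<open>m\<close> the integrand is constant, equal to \<open>t ^ m\<close>
  with \<open>t = q\<^bsup>-ns\<^esup>\<close>, so the integral is the generating function of the measures of these sets.
  In a symplectic basis, write a matrix as rows \<open>r\<^sub>i, s\<^sub>i\<close>. If \<open>r\<^sub>i\<close> (\<open>i < a\<close>) are independent modulo the
  maximal ideal, a further row is either independent of them or can be made divisible by the uniformizer by
  exactly one of \<open>q ^ a\<close> row operations. Once the remaining \<open>r\<^sub>i\<close> are divisible and \<open>m > 0\<close>, the relation
  \<open>\<Sum>i<a. r\<^sub>i \<and> s\<^sub>i = 0\<close> holds modulo the maximal ideal, and Cartan's lemma shows that exactly one of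
  \<open>q\<^bsup>a(a+1)/2\<^esup>\<close> symmetric row operations makes the \<open>s\<^sub>i\<close> (\<open>i < a\<close>) divisible too; dividing lowers
  \<open>m\<close> by one. Left invariance of the measure turns these disjoint decompositions into a linear recursion.

  On the tableau side, the weighted sum over the columns \<open>D\<close> of height \<open>k\<close> that may follow a column \<open>C\<close>
  depends only on the height of \<open>C\<close>, so the sum over reduced tableaux collapses to a sum over chains of heights.
  Its transfer matrix is, up to conjugation, the transpose of the one obtained for the measures.\<close>


section \<open>Valuations and symplectic bases over the ring of integers\<close>

text \<open>Left invariance of the measure acts on rows, so the elimination is by rows; stability
  under right multiplication by \<open>GSp_o\<close> is what makes the sets open, hence measurable.
  The residue field enters only through congruences modulo \<open>\<P>\<close>, and independence
  over it through an integral right inverse. Only the rows \<open>r\<^sub>i\<close> are eliminated,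
  which keeps all row operations block lower triangular; the partners \<open>s\<^sub>i\<close> are
  corrected only when a uniformizer is divided out, and the symmetric matrix of that correction
  accounts for the factor \<open>q ^ tri a\<close>. The correction needs a similitude factor in
  \<open>\<P>\<close>; with a unit factor all rows are independent, which is the base case. Along
  the measure recursion ranks grow, along a tableau heights shrink: this is why one matrix is the
  transpose of the other. Only the value at rank 0 and the value at height \<open>n\<close> have to
  agree, so pairing the two solutions settles it. Height 0 can only be followed by height 0, which
  produces the factor \<open>1 / (1 - t)\<close>. The measures grow at most exponentially in
  \<open>m\<close>, so all series converge for small \<open>t\<close>, that is, for large
  \<open>Re s\<close>.\<close>

lemma sum_lessThan_double:
  fixes f :: "nat \<Rightarrow> 'a::comm_monoid_add"
  shows "(\<Sum>l<2*n. f l) = (\<Sum>i<n. f i) + (\<Sum>i<n. f (n + i))"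
proof -
  have "(\<Sum>l<2*n. f l) = (\<Sum>l\<in>{..<n} \<union> {n..<2*n}. f l)"
    by (rule sum.cong) auto
  also have "\<dots> = (\<Sum>i<n. f i) + (\<Sum>l\<in>{n..<2*n}. f l)"
    by (rule sum.union_disjoint) auto
  also have "(\<Sum>l\<in>{n..<2*n}. f l) = (\<Sum>i<n. f (n + i))"
    by (rule sum.reindex_bij_witness[of _ "\<lambda>i. n + i" "\<lambda>l. l - n"]) auto
  finally show ?thesis .
qed

lemma mult_mat_entry:
  assumes "A \<in> carrier_mat a b" "B \<in> carrier_mat b c" "i < a" "j < c"
  shows "(A * B) $$ (i, j) = (\<Sum>l<b. A $$ (i, l) * B $$ (l, j))"
  using assms by (auto simp: scalar_prod_def atLeast0LessThan intro!: sum.cong)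

lemma det_zero_row:
  fixes A :: "'a::comm_ring_1 mat"
  assumes A: "A \<in> carrier_mat m m" and k: "k < m" and 0: "\<And>j. j < m \<Longrightarrow> A $$ (k, j) = 0"
  shows "det A = 0"
  unfolding det_def'[OF A]
proof (intro sum.neutral ballI)
  fix p assume "p \<in> {p. p permutes {0..<m}}"
  hence "p k < m" using k permutes_in_image[of p "{0..<m}" k] by auto
  hence "(\<Prod>i = 0..<m. A $$ (i, p i)) = 0" using k 0 by (intro prod_zero bexI[of _ k]) auto
  thus "signof p * (\<Prod>i = 0..<m. A $$ (i, p i)) = 0" by simp
qed

definition std_symp :: "nat \<Rightarrow> 'a::comm_ring_1 mat" where
  "std_symp n = mat (2*n) (2*n) (\<lambda>(i, j). if j = n + i then 1 else if i = n + j then -1 else 0)"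

lemma std_symp_carrier [simp]: "std_symp n \<in> carrier_mat (2*n) (2*n)"
  by (simp add: std_symp_def)

text \<open>Expresses the Gram matrix of the columns as the sum of the wedge products of rows
  \<open>i\<close> and \<open>n + i\<close>. This view by rows serves both to build a symplectic
  basis and to obtain the relation to which Cartan's lemma applies.\<close>

lemma symp_gram_entry:
  fixes B :: "'a::comm_ring_1 mat"
  assumes B: "B \<in> carrier_mat (2*n) (2*n)" and x: "x < 2*n" and y: "y < 2*n"
  shows "(transpose_mat B * std_symp n * B) $$ (x, y) =
    (\<Sum>i<n. B $$ (i, x) * B $$ (n + i, y) - B $$ (n + i, x) * B $$ (i, y))"
proof -
  have JB: "(std_symp n * B) $$ (i, y) = (if i < n then B $$ (n + i, y) else - B $$ (i - n, y))"
    if "i < 2*n" for i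
  proof -
    have "(std_symp n * B) $$ (i, y) = (\<Sum>l<2*n. std_symp n $$ (i, l) * B $$ (l, y))"
      using mult_mat_entry[OF std_symp_carrier B that y] .
    also have "\<dots> = (\<Sum>l<2*n. if l = (if i < n then n + i else i - n) then
        (if i < n then B $$ (n + i, y) else - B $$ (i - n, y)) else 0)"
      using that by (intro sum.cong refl) (auto simp: std_symp_def)
    also have "\<dots> = (if i < n then B $$ (n + i, y) else - B $$ (i - n, y))"
      using that by (subst sum.delta) auto
    finally show ?thesis .
  qed
  have "transpose_mat B * std_symp n * B = transpose_mat B * (std_symp n * B)"
    using B by (intro assoc_mult_mat[of _ "2*n" "2*n" _ "2*n" _ "2*n"]) auto
  hence "(transpose_mat B * std_symp n * B) $$ (x, y) =
      (\<Sum>l<2*n. transpose_mat B $$ (x, l) * (std_symp n * B) $$ (l, y))"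
    using mult_mat_entry[of "transpose_mat B" "2*n" "2*n" "std_symp n * B" "2*n" x y] B x y
    by (metis mult_carrier_mat std_symp_carrier transpose_carrier_mat)
  also have "\<dots> = (\<Sum>l<2*n. B $$ (l, x) * (if l < n then B $$ (n + l, y) else - B $$ (l - n, y)))"
    using B x by (intro sum.cong refl) (auto simp: JB)
  also have "\<dots> = (\<Sum>i<n. B $$ (i, x) * B $$ (n + i, y)) + (\<Sum>i<n. - B $$ (n + i, x) * B $$ (i, y))"
    by (subst sum_lessThan_double) auto
  finally show ?thesis by (simp add: sum_subtractf sum_negf)
qed

section \<open>Arithmetic and determinants modulo the maximal ideal\<close>

locale valued_field =
  fixes v :: "'k::field \<Rightarrow> int" and q :: nat
  assumes nalf: "nonarch_local_field v q"
begin

abbreviation "\<O> \<equiv> ring_of_integers v"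
abbreviation "\<P> \<equiv> max_ideal v"

lemma v_mult: "x \<noteq> 0 \<Longrightarrow> y \<noteq> 0 \<Longrightarrow> v (x * y) = v x + v y"
  using nalf by (auto simp: nonarch_local_field_def)

lemma v_add: "x \<noteq> 0 \<Longrightarrow> y \<noteq> 0 \<Longrightarrow> x + y \<noteq> 0 \<Longrightarrow> min (v x) (v y) \<le> v (x + y)"
  using nalf by (auto simp: nonarch_local_field_def)

lemma v_one [simp]: "v 1 = 0"
  using v_mult[of 1 1] by simp

lemma v_uminus [simp]: "v (- x) = v x"
proof (cases "x = 0")
  case False
  have "v (-1) = 0" using v_mult[of "-1" "-1"] by simp
  thus ?thesis using v_mult[of "-1" x] False by simp
qed simp

lemma v_inverse: "x \<noteq> 0 \<Longrightarrow> v (inverse x) = - v x"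
  using v_mult[of x "inverse x"] by simp

lemma v_power: "x \<noteq> 0 \<Longrightarrow> v (x ^ m) = int m * v x"
  by (induction m) (auto simp: v_mult algebra_simps)

lemma O_0 [simp, intro]: "0 \<in> \<O>" and O_1 [simp, intro]: "1 \<in> \<O>"
  and P_0 [simp, intro]: "0 \<in> \<P>" and one_notin_P [simp]: "1 \<notin> \<P>"
  by (auto simp: ring_of_integers_def max_ideal_def)

lemma P_subset_O: "x \<in> \<P> \<Longrightarrow> x \<in> \<O>"
  by (auto simp: ring_of_integers_def max_ideal_def)

lemma O_add [intro]: "x \<in> \<O> \<Longrightarrow> y \<in> \<O> \<Longrightarrow> x + y \<in> \<O>"
  using v_add[of x y] unfolding ring_of_integers_def
  by (cases "x = 0"; cases "y = 0"; cases "x + y = 0") auto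

lemma P_add [intro]: "x \<in> \<P> \<Longrightarrow> y \<in> \<P> \<Longrightarrow> x + y \<in> \<P>"
  using v_add[of x y] unfolding max_ideal_def
  by (cases "x = 0"; cases "y = 0"; cases "x + y = 0") auto

lemma O_uminus [intro]: "x \<in> \<O> \<Longrightarrow> - x \<in> \<O>"
  and P_uminus [intro]: "x \<in> \<P> \<Longrightarrow> - x \<in> \<P>"
  by (auto simp: ring_of_integers_def max_ideal_def)

lemma O_diff [intro]: "x \<in> \<O> \<Longrightarrow> y \<in> \<O> \<Longrightarrow> x - y \<in> \<O>"
  using O_add[of x "- y"] by auto

lemma P_diff [intro]: "x \<in> \<P> \<Longrightarrow> y \<in> \<P> \<Longrightarrow> x - y \<in> \<P>"
  using P_add[of x "- y"] by auto

lemma O_mult [intro]: "x \<in> \<O> \<Longrightarrow> y \<in> \<O> \<Longrightarrow> x * y \<in> \<O>"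
  using v_mult[of x y] unfolding ring_of_integers_def
  by (cases "x = 0"; cases "y = 0") auto

lemma P_mult: "x \<in> \<O> \<Longrightarrow> y \<in> \<P> \<Longrightarrow> x * y \<in> \<P>"
  using v_mult[of x y] unfolding ring_of_integers_def max_ideal_def
  by (cases "x = 0"; cases "y = 0") auto

lemma P_mult': "x \<in> \<P> \<Longrightarrow> y \<in> \<O> \<Longrightarrow> x * y \<in> \<P>"
  using P_mult[of y x] by (simp add: mult.commute)

lemma O_sum [intro]: "(\<And>i. i \<in> I \<Longrightarrow> f i \<in> \<O>) \<Longrightarrow> sum f I \<in> \<O>"
  by (induction I rule: infinite_finite_induct) auto

lemma P_sum [intro]: "(\<And>i. i \<in> I \<Longrightarrow> f i \<in> \<P>) \<Longrightarrow> sum f I \<in> \<P>"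
  by (induction I rule: infinite_finite_induct) auto

lemma O_prod [intro]: "(\<And>i. i \<in> I \<Longrightarrow> f i \<in> \<O>) \<Longrightarrow> prod f I \<in> \<O>"
  by (induction I rule: infinite_finite_induct) auto

lemma O_inverse: "x \<in> \<O> \<Longrightarrow> x \<notin> \<P> \<Longrightarrow> inverse x \<in> \<O>"
  by (cases "x = 0") (auto simp: ring_of_integers_def max_ideal_def v_inverse)

lemma unit_iff: "x \<noteq> 0 \<and> v x = 0 \<longleftrightarrow> x \<in> \<O> \<and> x \<notin> \<P>"
  by (auto simp: ring_of_integers_def max_ideal_def)

lemma prod_cong_P:
  assumes "\<And>i. i \<in> I \<Longrightarrow> f i \<in> \<O>" "\<And>i. i \<in> I \<Longrightarrow> g i \<in> \<O>" "\<And>i. i \<in> I \<Longrightarrow> f i - g i \<in> \<P>"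
  shows "prod f I - prod g I \<in> \<P>"
  using assms
proof (induction I rule: infinite_finite_induct)
  case (insert i I)
  have "prod f (insert i I) - prod g (insert i I) =
      f i * (prod f I - prod g I) + (f i - g i) * prod g I"
    using insert.hyps by (simp add: algebra_simps)
  moreover have "f i * (prod f I - prod g I) \<in> \<P>" using insert by (intro P_mult) auto
  moreover have "(f i - g i) * prod g I \<in> \<P>" using insert by (intro P_mult') auto
  ultimately show ?case by auto
qed auto

definition intmat :: "nat \<Rightarrow> 'k mat \<Rightarrow> bool" where
  "intmat m A \<longleftrightarrow> (\<forall>i<m. \<forall>j<m. A $$ (i, j) \<in> \<O>)"

lemma intmat_mult:
  assumes "A \<in> carrier_mat m m" "B \<in> carrier_mat m m" "intmat m A" "intmat m B"
  shows "intmat m (A * B)"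
  using assms unfolding intmat_def
  by (auto simp: mult_mat_entry[OF assms(1,2)] intro!: O_sum O_mult simp del: index_mult_mat)

lemma det_integral:
  assumes "A \<in> carrier_mat m m" "intmat m A"
  shows "det A \<in> \<O>"
  unfolding det_def'[OF assms(1)]
  using assms by (intro O_sum O_mult O_prod)
   (auto simp: intmat_def sign_def atLeast0LessThan permutes_in_image)

text \<open>The determinant commutes with reduction to the residue field, phrased on entries through
  the Leibniz expansion.\<close>

lemma det_cong_P:
  assumes "A \<in> carrier_mat m m" "intmat m A" "B \<in> carrier_mat m m" "intmat m B"
    and "\<And>i j. i < m \<Longrightarrow> j < m \<Longrightarrow> A $$ (i, j) - B $$ (i, j) \<in> \<P>"
  shows "det A - det B \<in> \<P>"
proof -
  have "det A - det B = (\<Sum>p | p permutes {0..<m}.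
      signof p * ((\<Prod>i = 0..<m. A $$ (i, p i)) - (\<Prod>i = 0..<m. B $$ (i, p i))))"
    unfolding det_def'[OF assms(1)] det_def'[OF assms(3)]
    by (simp add: sum_subtractf right_diff_distrib)
  also have "\<dots> \<in> \<P>"
  proof (intro P_sum P_mult prod_cong_P)
    fix p i assume "p \<in> {p. p permutes {0..<m}}" "i \<in> {0..<m}"
    hence "i < m" "p i < m" using permutes_in_image[of p "{0..<m}" i] by auto
    thus "A $$ (i, p i) \<in> \<O>" "B $$ (i, p i) \<in> \<O>" "A $$ (i, p i) - B $$ (i, p i) \<in> \<P>"
      using assms by (auto simp: intmat_def)
  qed (auto simp: sign_def)
  finally show ?thesis .
qed

text \<open>Cofactors of an integral matrix are integral and the determinant is a unit, so Cramer's
  formula stays in the ring of integers.\<close>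

lemma intmat_inverse_ex:
  assumes A: "A \<in> carrier_mat m m" "intmat m A" and d: "det A \<noteq> 0" "v (det A) = 0"
  shows "\<exists>B \<in> carrier_mat m m. intmat m B \<and> A * B = 1\<^sub>m m \<and> B * A = 1\<^sub>m m"
proof -
  define B where "B = inverse (det A) \<cdot>\<^sub>m adj_mat A"
  note adj = adj_mat[OF A(1)]
  have B: "B \<in> carrier_mat m m" using adj by (auto simp: B_def)
  have *: "A * B = 1\<^sub>m m" "B * A = 1\<^sub>m m"
    using adj A(1) d(1) unfolding B_def
    by (auto simp: mult_smult_distrib[of _ m m] mult_smult_assoc_mat[of _ m m _ m] intro!: eq_matI)
  have inv: "inverse (det A) \<in> \<O>" using d unit_iff O_inverse by blast
  have "cofactor A j i \<in> \<O>" if "i < m" "j < m" for i j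
  proof -
    have "mat_delete A j i \<in> carrier_mat (m-1) (m-1)"
      using A(1) that by (auto simp: mat_delete_def)
    moreover have "intmat (m-1) (mat_delete A j i)"
      using A that unfolding intmat_def mat_delete_def by auto
    moreover have "(- 1 :: 'k) ^ (j + i) \<in> \<O>" by (induction "j+i") (cases "even (j+i)"; auto)+
    ultimately show ?thesis unfolding cofactor_def using det_integral by auto
  qed
  hence "intmat m B" using A(1) inv unfolding intmat_def B_def adj_mat_def by auto
  thus ?thesis using B * by blast
qed

lemma residues_ge_2: "q \<ge> 2"
proof -
  have fin: "finite (residue_classes v)" "card (residue_classes v) = q"
    using nalf by (auto simp: nonarch_local_field_def)
  let ?c = "\<lambda>x. {y \<in> \<O>. x - y \<in> \<P>}"
  have "?c 0 \<noteq> ?c 1"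
  proof
    assume "?c 0 = ?c 1"
    hence "1 \<in> ?c 0" by auto
    hence "-1 \<in> \<P>" by auto
    thus False using P_uminus[of "-1"] by simp
  qed
  hence "card {?c 0, ?c 1} = 2" by simp
  moreover have "{?c 0, ?c 1} \<subseteq> residue_classes v" unfolding residue_classes_def by blast
  ultimately show ?thesis using card_mono[OF fin(1)] fin(2) by metis
qed

lemma residue_reps_ex:
  "\<exists>R. R \<subseteq> \<O> \<and> finite R \<and> card R = q \<and> (\<forall>x\<in>\<O>. \<exists>r\<in>R. x - r \<in> \<P>)
     \<and> (\<forall>r\<in>R. \<forall>r'\<in>R. r - r' \<in> \<P> \<longrightarrow> r = r')"
proof -
  have fin: "finite (residue_classes v)" "card (residue_classes v) = q"
    using nalf by (auto simp: nonarch_local_field_def)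
  let ?c = "\<lambda>x. {y \<in> \<O>. x - y \<in> \<P>}"
  have "\<forall>C\<in>residue_classes v. \<exists>x\<in>\<O>. C = ?c x" unfolding residue_classes_def by blast
  then obtain f where f: "\<And>C. C \<in> residue_classes v \<Longrightarrow> f C \<in> \<O> \<and> C = ?c (f C)" by metis
  have inj: "inj_on f (residue_classes v)" by (rule inj_onI) (metis f)
  define R where "R = f ` residue_classes v"
  have A: "\<exists>r\<in>R. x - r \<in> \<P>" if x: "x \<in> \<O>" for x
  proof -
    have C: "?c x \<in> residue_classes v" using x unfolding residue_classes_def by blast
    have "f (?c x) - f (?c x) \<in> \<P>" by simp
    hence "f (?c x) \<in> ?c (f (?c x))" using f[OF C] by blast
    hence "f (?c x) \<in> ?c x" using f[OF C] by blast
    moreover have "f (?c x) \<in> R" using C unfolding R_def by blast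
    ultimately show ?thesis by blast
  qed
  have B: "r = r'" if rr: "r \<in> R" "r' \<in> R" "r - r' \<in> \<P>" for r r'
  proof -
    have "?c r = ?c r'"
    proof (intro Collect_cong conj_cong refl)
      fix y
      have "(r - y) - (r - r') = r' - y" "(r' - y) + (r - r') = r - y" by auto
      thus "(r - y \<in> \<P>) = (r' - y \<in> \<P>)" using rr(3) P_diff P_add by metis
    qed
    moreover obtain C C' where "C \<in> residue_classes v" "r = f C" "C' \<in> residue_classes v" "r' = f C'"
      using rr(1,2) unfolding R_def by blast
    ultimately show ?thesis using f by metis
  qed
  have "R \<subseteq> \<O>" using f unfolding R_def by blast
  moreover have "finite R" "card R = q" using fin inj by (simp_all add: R_def card_image)
  ultimately show ?thesis by (intro exI[of _ R] conjI ballI impI A B)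
qed

lemma reps_family_ex:
  assumes R: "R \<subseteq> \<O>" "\<forall>x\<in>\<O>. \<exists>r\<in>R. x - r \<in> \<P>" and f: "\<And>i. i \<in> I \<Longrightarrow> f i \<in> \<O>"
  shows "\<exists>c \<in> I \<rightarrow>\<^sub>E R. \<forall>i\<in>I. f i - c i \<in> \<P>"
proof -
  have "\<forall>i\<in>I. \<exists>r\<in>R. f i - r \<in> \<P>" using R f by auto
  then obtain g where "\<forall>i\<in>I. g i \<in> R \<and> f i - g i \<in> \<P>" by metis
  thus ?thesis by (intro bexI[of _ "restrict g I"]) auto
qed

lemma uniformizer_ex: "\<exists>p. p \<noteq> 0 \<and> v p = 1"
  using nalf by (auto simp: nonarch_local_field_def)

lemma kabs_eq_1_iff: "kabs v q x = 1 \<longleftrightarrow> x \<noteq> 0 \<and> v x = 0"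
  using residues_ge_2 by (auto simp: kabs_def)

text \<open>State of a symplectic Gram-Schmidt process after splitting off \<open>a\<close>
  hyperbolic planes: \<open>J'\<close> is the remaining form and \<open>S\<close> collects the
  \<open>2 * a\<close> pivot indices, at which it vanishes. At \<open>a = n\<close> the size of
  \<open>S\<close> forces \<open>J' = 0\<close>.\<close>

definition partial_symp_basis ::
    "nat \<Rightarrow> 'k mat \<Rightarrow> nat \<Rightarrow> (nat \<Rightarrow> nat \<Rightarrow> 'k) \<Rightarrow> (nat \<Rightarrow> nat \<Rightarrow> 'k) \<Rightarrow> nat set \<Rightarrow> (nat \<Rightarrow> nat \<Rightarrow> 'k) \<Rightarrow> bool" where
  "partial_symp_basis n J a r s S J' \<longleftrightarrow>
    (\<forall>i<n. \<forall>x<2*n. r i x \<in> \<O> \<and> s i x \<in> \<O>) \<and> S \<subseteq> {..<2*n} \<and> card S = 2 * a \<and>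
    (\<forall>x<2*n. \<forall>y<2*n. J' x y \<in> \<O> \<and> J' x y = - J' y x) \<and> (\<forall>x<2*n. J' x x = 0) \<and>
    (\<forall>x\<in>S. \<forall>y<2*n. J' x y = 0) \<and>
    (\<forall>x<2*n. \<forall>y<2*n. J $$ (x, y) = J' x y + (\<Sum>i<a. r i x * s i y - s i x * r i y))"

text \<open>Each step needs a unit entry of \<open>J'\<close> as pivot. While \<open>a < n\<close>
  there is one: otherwise \<open>J\<close> would be congruent to the Gram matrix of fewer than
  \<open>n\<close> pairs of rows, which is singular, whereas \<open>det J\<close> is a unit.\<close>

lemma partial_symp_basis_ex:
  assumes J: "alt_unimodular v q n J" and "a \<le> n"
  shows "\<exists>r s S J'. partial_symp_basis n J a r s S J'"
  using \<open>a \<le> n\<close>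
proof (induction a)
  case 0
  have skew: "J $$ (x, y) = - J $$ (y, x)" if "x < 2*n" "y < 2*n" for x y
  proof -
    have Jc: "J \<in> carrier_mat (2*n) (2*n)" and "transpose_mat J $$ (y, x) = (- J) $$ (y, x)"
      using J by (simp_all add: alt_unimodular_def)
    moreover have "transpose_mat J $$ (y, x) = J $$ (x, y)" "(- J) $$ (y, x) = - J $$ (y, x)"
      using Jc that by simp_all
    ultimately show ?thesis by metis
  qed
  have JO: "J $$ (x, y) \<in> \<O>" "J $$ (x, x) = 0" if "x < 2*n" "y < 2*n" for x y
    using J that by (simp_all add: alt_unimodular_def)
  show ?case unfolding partial_symp_basis_def
    by (rule exI[of _ "\<lambda>_ _. 0"], rule exI[of _ "\<lambda>_ _. 0"], rule exI[of _ "{}"],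
        rule exI[of _ "\<lambda>x y. J $$ (x, y)"], intro conjI allI impI)
       ((rule skew; assumption) | simp add: JO)+
next
  case (Suc a)
  then obtain r s S J' where st: "partial_symp_basis n J a r s S J'"
    using Suc.IH[OF Suc_leD] by blast
  have IH: "\<And>i x. i<n \<Longrightarrow> x<2*n \<Longrightarrow> r i x \<in> \<O> \<and> s i x \<in> \<O>"
    "S \<subseteq> {..<2*n}" "card S = 2 * a"
    "\<And>x y. x < 2*n \<Longrightarrow> y<2*n \<Longrightarrow> J' x y \<in> \<O> \<and> J' x y = - J' y x" "\<And>x. x<2*n \<Longrightarrow> J' x x = 0"
    "\<And>x y. x\<in>S \<Longrightarrow> y<2*n \<Longrightarrow> J' x y = 0"
    "\<And>x y. x<2*n \<Longrightarrow> y<2*n \<Longrightarrow> J $$ (x, y) = J' x y + (\<Sum>i<a. r i x * s i y - s i x * r i y)"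
    using st unfolding partial_symp_basis_def by blast+
  have JO: "J' x y \<in> \<O>" if "x < 2*n" "y < 2*n" for x y using IH(4)[OF that] ..
  have Jc: "J \<in> carrier_mat (2*n) (2*n)" "intmat (2*n) J" "det J \<notin> \<P>"
    using J kabs_eq_1_iff unit_iff by (auto simp: alt_unimodular_def intmat_def)
  have an: "a < n" using Suc by simp
  have "\<exists>x<2*n. \<exists>y<2*n. J' x y \<notin> \<P>"
  proof (rule ccontr)
    assume neg: "\<not> ?thesis"
    define B where "B = mat (2*n) (2*n) (\<lambda>(i, x). if i < a then r i x
        else if n \<le> i \<and> i < n + a then s (i - n) x else 0)"
    have B: "B \<in> carrier_mat (2*n) (2*n)" by (simp add: B_def)
    have "det B = 0"
      by (rule det_zero_row[OF B, of a]) (use an in \<open>auto simp: B_def\<close>)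
    moreover have iB: "intmat (2*n) B" using IH(1) an by (auto simp: B_def intmat_def)
    let ?G = "transpose_mat B * std_symp n * B"
    have G: "?G \<in> carrier_mat (2*n) (2*n)" using B by auto
    have e: "?G $$ (x, y) = (\<Sum>i<a. r i x * s i y - s i x * r i y)" if "x < 2*n" "y < 2*n" for x y
    proof -
      have "?G $$ (x, y) = (\<Sum>i<n. if i < a then r i x * s i y - s i x * r i y else 0)"
        unfolding symp_gram_entry[OF B that]
        by (intro sum.cong refl) (use that an in \<open>auto simp: B_def\<close>)
      also have "\<dots> = (\<Sum>i<a. r i x * s i y - s i x * r i y)"
        using an by (intro sum.mono_neutral_cong_right) auto
      finally show ?thesis .
    qed
    have iG: "intmat (2*n) ?G" unfolding intmat_def using e IH(1) an
      by (auto intro!: O_sum O_diff O_mult)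
    have "det J - det ?G \<in> \<P>"
      using IH(7) e neg by (intro det_cong_P[OF Jc(1,2) G iG]) auto
    moreover have "det ?G = det (transpose_mat B * std_symp n) * det B"
      using B by (intro det_mult[of _ "2*n"]) auto
    ultimately show False using Jc(3) by simp
  qed
  then obtain x y where xy: "x < 2*n" "y < 2*n" "J' x y \<notin> \<P>" by auto
  define d where "d = J' x y"
  have d: "d \<noteq> 0" "inverse d \<in> \<O>" using xy JO[of x y] O_inverse by (auto simp: d_def)
  have dy: "J' y x = - d" using IH(4)[OF xy(2,1)] by (simp add: d_def)
  have nS: "x \<notin> S" "y \<notin> S" "x \<noteq> y"
    using IH(6)[of x y] IH(6)[of y x] IH(5)[of x] xy d dy by (auto simp: d_def)
  \<comment> \<open>The new pair consists of the two pivot rows of \<open>J'\<close>, one of them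
    divided by the unit \<open>d\<close>, so that subtracting their wedge product clears rows
    \<open>x\<close> and \<open>y\<close>.\<close>
  define r' where "r' = r(a := \<lambda>z. inverse d * J' x z)"
  define s' where "s' = s(a := \<lambda>z. J' y z)"
  define J'' where "J'' = (\<lambda>z w. J' z w - (inverse d * J' x z * J' y w - J' y z * (inverse d * J' x w)))"
  show ?case unfolding partial_symp_basis_def
  proof (rule exI[of _ r'], rule exI[of _ s'], rule exI[of _ "insert x (insert y S)"], rule exI[of _ J''],
      intro conjI allI impI ballI)
    show "card (insert x (insert y S)) = 2 * Suc a"
      using nS IH(2,3) finite_subset[OF IH(2)] by simp
    show "J'' z w = 0" if zw: "z \<in> insert x (insert y S)" "w < 2*n" for z w
    proof -
      consider "z = x" | "z = y" | "z \<in> S" using zw(1) by auto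
      thus ?thesis
      proof cases
        case 3
        hence "z < 2*n" using IH(2) by auto
        hence "J' x z = - J' z x" "J' y z = - J' z y" using IH(4) xy by blast+
        hence "J' x z = 0" "J' y z = 0" using IH(6)[OF 3] xy by simp_all
        thus ?thesis using IH(6)[OF 3] zw by (simp add: J''_def)
      qed (use zw xy dy d IH(5) in \<open>auto simp: J''_def d_def[symmetric]\<close>)
    qed
    show "J $$ (z, w) = J'' z w + (\<Sum>i<Suc a. r' i z * s' i w - s' i z * r' i w)"
      if "z < 2*n" "w < 2*n" for z w
      using IH(7)[OF that] by (simp add: J''_def r'_def s'_def)
    show "J'' z w = - J'' w z" if "z < 2*n" "w < 2*n" for z w
      by (simp add: J''_def IH(4)[OF that] algebra_simps)
    show "J'' z z = 0" if "z < 2*n" for z using IH(5)[OF that] by (simp add: J''_def)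
    show "J'' z w \<in> \<O>" if "z < 2*n" "w < 2*n" for z w
      unfolding J''_def using JO that xy d by (intro O_diff O_mult) auto
    show "r' i z \<in> \<O>" "s' i z \<in> \<O>" if "i < n" "z < 2*n" for i z
      using IH(1)[OF that] JO xy that d by (auto simp: r'_def s'_def)
  qed (use IH(2) xy in auto)
qed

lemma symplectic_basis_ex:
  assumes J: "alt_unimodular v q n J"
  shows "\<exists>K \<in> carrier_mat (2*n) (2*n). intmat (2*n) K \<and>
     transpose_mat K * std_symp n * K = J \<and> det K \<noteq> 0 \<and> v (det K) = 0"
proof -
  obtain r s S J' where st: "partial_symp_basis n J n r s S J'"
    using partial_symp_basis_ex[OF J order_refl] by blast
  have IH: "\<And>i x. i<n \<Longrightarrow> x<2*n \<Longrightarrow> r i x \<in> \<O> \<and> s i x \<in> \<O>"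
    "S \<subseteq> {..<2*n}" "card S = 2 * n"
    "\<And>x y. x\<in>S \<Longrightarrow> y<2*n \<Longrightarrow> J' x y = 0"
    "\<And>x y. x<2*n \<Longrightarrow> y<2*n \<Longrightarrow> J $$ (x, y) = J' x y + (\<Sum>i<n. r i x * s i y - s i x * r i y)"
    using st unfolding partial_symp_basis_def by blast+
  have S: "S = {..<2*n}" using IH(2,3) by (intro card_subset_eq) auto
  define K where "K = mat (2*n) (2*n) (\<lambda>(i, x). if i < n then r i x else s (i - n) x)"
  have K: "K \<in> carrier_mat (2*n) (2*n)" by (simp add: K_def)
  have Jc: "J \<in> carrier_mat (2*n) (2*n)" using J by (auto simp: alt_unimodular_def)
  have iK: "intmat (2*n) K" using IH(1) by (auto simp: intmat_def K_def)
  have eq: "transpose_mat K * std_symp n * K = J"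
  proof (rule eq_matI)
    fix x y assume "x < dim_row J" "y < dim_col J"
    hence xy: "x < 2*n" "y < 2*n" using Jc by auto
    have "(transpose_mat K * std_symp n * K) $$ (x, y) = (\<Sum>i<n. r i x * s i y - s i x * r i y)"
      unfolding symp_gram_entry[OF K xy] by (intro sum.cong refl) (use xy in \<open>auto simp: K_def\<close>)
    thus "(transpose_mat K * std_symp n * K) $$ (x, y) = J $$ (x, y)"
      using IH(4)[of x y] IH(5)[OF xy] xy S by simp
  qed (use K Jc in auto)
  have "det J = det K * det (std_symp n) * det K"
    unfolding eq[symmetric] using K
    by (simp add: det_mult[of _ "2*n"] det_transpose[OF K])
  moreover have "det J \<noteq> 0" "v (det J) = 0" using J kabs_eq_1_iff by (auto simp: alt_unimodular_def)
  \<comment> \<open>Both summands of the last equation turn out to be nonnegative by integrality of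
    the determinants, so both are zero.\<close>
  ultimately have *: "det K \<noteq> 0" "det (std_symp n) \<noteq> (0::'k)"
      "2 * v (det K) + v (det (std_symp n)) = 0"
    by (auto simp: v_mult)
  have "det (std_symp n) \<in> \<O>"
    by (rule det_integral[OF std_symp_carrier]) (auto simp: intmat_def std_symp_def)
  hence "v (det K) = 0" using * det_integral[OF K iK] by (auto simp: ring_of_integers_def)
  thus ?thesis using K iK eq * by auto
qed

end

section \<open>Block matrices and rows modulo the maximal ideal\<close>

lemma sum_lessThan_delta_mult:
  fixes f :: "nat \<Rightarrow> 'a::semiring_1"
  shows "(\<Sum>i<n. (if i = j then 1 else 0) * f i) = (if j < n then f j else 0)"
    and "(\<Sum>i<n. (if j = i then 1 else 0) * f i) = (if j < n then f j else 0)"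
    and "(\<Sum>i<n. f i * (if i = j then 1 else 0)) = (if j < n then f j else 0)"
    and "(\<Sum>i<n. f i * (if j = i then 1 else 0)) = (if j < n then f j else 0)"
proof -
  have "(\<Sum>i<n. (if i = j then 1 else 0) * f i) = (\<Sum>i<n. if i = j then f i else 0)"
    by (intro sum.cong) auto
  thus 1: "(\<Sum>i<n. (if i = j then 1 else 0) * f i) = (if j < n then f j else 0)" by simp
  have "(\<Sum>i<n. f i * (if i = j then 1 else 0)) = (\<Sum>i<n. if i = j then f i else 0)"
    by (intro sum.cong) auto
  thus 2: "(\<Sum>i<n. f i * (if i = j then 1 else 0)) = (if j < n then f j else 0)" by simp
  show "(\<Sum>i<n. (if j = i then 1 else 0) * f i) = (if j < n then f j else 0)"
    and "(\<Sum>i<n. f i * (if j = i then 1 else 0)) = (if j < n then f j else 0)"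
    using 1 2 by (simp_all add: eq_commute[of j])
qed

text \<open>The upper right block is zero because the row operations used here preserve the span of
  the rows \<open>r\<^sub>i\<close>; the block \<open>\<gamma>\<close> adds combinations of these
  rows to the rows \<open>s\<^sub>i\<close>.\<close>

definition block_lower ::
    "nat \<Rightarrow> (nat \<Rightarrow> nat \<Rightarrow> 'a) \<Rightarrow> (nat \<Rightarrow> nat \<Rightarrow> 'a) \<Rightarrow> (nat \<Rightarrow> nat \<Rightarrow> 'a) \<Rightarrow> 'a::comm_ring_1 mat" where
  "block_lower n \<alpha> \<gamma> \<delta> = mat (2*n) (2*n) (\<lambda>(i, j).
     if i < n then (if j < n then \<alpha> i j else 0)
     else (if j < n then \<gamma> (i - n) j else \<delta> (i - n) (j - n)))"

lemma block_lower_carrier [simp]: "block_lower n \<alpha> \<gamma> \<delta> \<in> carrier_mat (2*n) (2*n)"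
  by (simp add: block_lower_def)

lemma block_lower_mult:
  assumes B: "B \<in> carrier_mat (2*n) (2*n)" and i: "i < n" and x: "x < 2*n"
  shows "(block_lower n \<alpha> \<gamma> \<delta> * B) $$ (i, x) = (\<Sum>j<n. \<alpha> i j * B $$ (j, x))"
    and "(block_lower n \<alpha> \<gamma> \<delta> * B) $$ (n + i, x) =
      (\<Sum>j<n. \<gamma> i j * B $$ (j, x)) + (\<Sum>j<n. \<delta> i j * B $$ (n + j, x))"
proof -
  let ?G = "block_lower n \<alpha> \<gamma> \<delta>"
  have "(?G * B) $$ (i, x) = (\<Sum>l<2*n. ?G $$ (i, l) * B $$ (l, x))"
    using i x by (intro mult_mat_entry[OF block_lower_carrier B]) auto
  also have "\<dots> = (\<Sum>j<n. \<alpha> i j * B $$ (j, x))"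
    unfolding sum_lessThan_double using i by (simp add: block_lower_def)
  finally show "(?G * B) $$ (i, x) = (\<Sum>j<n. \<alpha> i j * B $$ (j, x))" .
  have "(?G * B) $$ (n + i, x) = (\<Sum>l<2*n. ?G $$ (n + i, l) * B $$ (l, x))"
    using i x by (intro mult_mat_entry[OF block_lower_carrier B]) auto
  also have "\<dots> = (\<Sum>j<n. \<gamma> i j * B $$ (j, x)) + (\<Sum>j<n. \<delta> i j * B $$ (n + j, x))"
    unfolding sum_lessThan_double using i by (simp add: block_lower_def)
  finally show "(?G * B) $$ (n + i, x) =
    (\<Sum>j<n. \<gamma> i j * B $$ (j, x)) + (\<Sum>j<n. \<delta> i j * B $$ (n + j, x))" .
qed

text \<open>The assumption \<open>sym\<close> is the block of the Gram matrix with both indices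
  below \<open>n\<close>, and \<open>dual\<close> gives the two mixed blocks. The last block
  vanishes because of the zero block of \<open>G\<close>.\<close>

lemma block_lower_symp:
  fixes \<alpha> \<gamma> \<delta> :: "nat \<Rightarrow> nat \<Rightarrow> 'a::comm_ring_1"
  assumes sym: "\<And>x y. x < n \<Longrightarrow> y < n \<Longrightarrow> (\<Sum>i<n. \<alpha> i x * \<gamma> i y) = (\<Sum>i<n. \<alpha> i y * \<gamma> i x)"
    and dual: "\<And>x y. x < n \<Longrightarrow> y < n \<Longrightarrow> (\<Sum>i<n. \<alpha> i x * \<delta> i y) = (if x = y then c else 0)"
  defines "G \<equiv> block_lower n \<alpha> \<gamma> \<delta>"
  shows "transpose_mat G * std_symp n * G = c \<cdot>\<^sub>m std_symp n"
proof (rule eq_matI)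
  have G: "G \<in> carrier_mat (2*n) (2*n)" by (simp add: G_def)
  fix x y assume "x < dim_row (c \<cdot>\<^sub>m std_symp n)" "y < dim_col (c \<cdot>\<^sub>m std_symp n)"
  hence xy: "x < 2*n" "y < 2*n" by (auto simp: std_symp_def)
  have e: "(transpose_mat G * std_symp n * G) $$ (x, y) =
      (\<Sum>i<n. G $$ (i, x) * G $$ (n + i, y)) - (\<Sum>i<n. G $$ (n + i, x) * G $$ (i, y))"
    unfolding symp_gram_entry[OF G xy] by (rule sum_subtractf)
  have entries: "G $$ (i, j) = (if j < n then \<alpha> i j else 0)"
    "G $$ (n + i, j) = (if j < n then \<gamma> i j else \<delta> i (j - n))" if "i < n" "j < 2*n" for i j
    using that by (simp_all add: G_def block_lower_def)
  have 1: "(\<Sum>i<n. G $$ (i, x) * G $$ (n + i, y)) =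
      (\<Sum>i<n. (if x < n then \<alpha> i x else 0) * (if y < n then \<gamma> i y else \<delta> i (y - n)))"
    using xy by (intro sum.cong refl) (simp add: entries)
  have 2: "(\<Sum>i<n. G $$ (n + i, x) * G $$ (i, y)) =
      (\<Sum>i<n. (if y < n then \<alpha> i y else 0) * (if x < n then \<gamma> i x else \<delta> i (x - n)))"
    using xy by (intro sum.cong refl) (simp add: entries mult.commute)
  consider "x < n" "y < n" | "x < n" "\<not> y < n" | "\<not> x < n" "y < n" | "\<not> x < n" "\<not> y < n" by blast
  thus "(transpose_mat G * std_symp n * G) $$ (x, y) = (c \<cdot>\<^sub>m std_symp n) $$ (x, y)"
  proof cases
    case 1
    thus ?thesis unfolding e \<open>(\<Sum>i<n. G $$ (i, x) * G $$ (n + i, y)) = _\<close> 2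
      using sym[of x y] by (simp add: std_symp_def)
  next
    case 2
    have "y - n < n" using xy by simp
    thus ?thesis unfolding e 1 \<open>(\<Sum>i<n. G $$ (n + i, x) * G $$ (i, y)) = _\<close>
      using 2 xy dual[of x "y - n"] by (auto simp: std_symp_def)
  next
    case 3
    have "x - n < n" using xy by simp
    thus ?thesis unfolding e 1 2
      using 3 xy dual[of y "x - n"] by (auto simp: std_symp_def)
  next
    case 4
    thus ?thesis unfolding e 1 2 using xy by (auto simp: std_symp_def)
  qed
qed (auto simp: G_def block_lower_def std_symp_def)

text \<open>The three forms may differ, so that products of similitudes of \<open>J\<close> and base
  changes between \<open>J\<close> and \<open>std_symp\<close> are covered alike.\<close>

lemma similitude_compose:
  fixes A B J :: "'a::comm_ring_1 mat"
  assumes "A \<in> carrier_mat m m" "B \<in> carrier_mat m m" "J \<in> carrier_mat m m" "J' \<in> carrier_mat m m"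
    and "transpose_mat A * J * A = c \<cdot>\<^sub>m J'" "transpose_mat B * J' * B = d \<cdot>\<^sub>m J''"
  shows "transpose_mat (A * B) * J * (A * B) = (c * d) \<cdot>\<^sub>m J''"
proof -
  have "transpose_mat (A * B) * J * (A * B) = transpose_mat B * transpose_mat A * J * (A * B)"
    using assms by (simp add: transpose_mult)
  also have "\<dots> = transpose_mat B * (transpose_mat A * J * A) * B"
    using assms(1-3) by (simp add: assoc_mult_mat[of _ m m _ m _ m])
  also have "\<dots> = transpose_mat B * (c \<cdot>\<^sub>m J') * B" by (simp add: assms)
  also have "\<dots> = c \<cdot>\<^sub>m (transpose_mat B * J' * B)"
    using assms(1-4) by (simp add: mult_smult_distrib[of _ m m] mult_smult_assoc_mat[of _ m m _ m])
  also have "\<dots> = (c * d) \<cdot>\<^sub>m J''" unfolding assms by (intro eq_matI) (simp_all add: mult.assoc)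
  finally show ?thesis .
qed

context valued_field
begin

lemma mult_cong_P:
  assumes "A \<in> carrier_mat m m" "A' \<in> carrier_mat m m" "B \<in> carrier_mat m m" "B' \<in> carrier_mat m m"
    and "intmat m A'" "intmat m B"
    and "\<And>i j. i < m \<Longrightarrow> j < m \<Longrightarrow> A $$ (i, j) - A' $$ (i, j) \<in> \<P>"
    and "\<And>i j. i < m \<Longrightarrow> j < m \<Longrightarrow> B $$ (i, j) - B' $$ (i, j) \<in> \<P>"
    and "i < m" "j < m"
  shows "(A * B) $$ (i, j) - (A' * B') $$ (i, j) \<in> \<P>"
proof -
  have "(A * B) $$ (i, j) - (A' * B') $$ (i, j) =
      (\<Sum>l<m. (A $$ (i, l) - A' $$ (i, l)) * B $$ (l, j) + A' $$ (i, l) * (B $$ (l, j) - B' $$ (l, j)))"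
    unfolding mult_mat_entry[OF assms(1,3,9,10)] mult_mat_entry[OF assms(2,4,9,10)]
    unfolding sum_subtractf[symmetric] by (intro sum.cong refl) (simp add: algebra_simps)
  also have "\<dots> \<in> \<P>"
  proof (intro P_sum P_add)
    fix l assume "l \<in> {..<m}"
    thus "(A $$ (i, l) - A' $$ (i, l)) * B $$ (l, j) \<in> \<P>"
        "A' $$ (i, l) * (B $$ (l, j) - B' $$ (l, j)) \<in> \<P>"
      using assms(5-10) by (auto simp: intmat_def intro: P_mult P_mult')
  qed
  finally show ?thesis .
qed

text \<open>Linear independence of the first \<open>a\<close> rows modulo the maximal ideal, expressed by an integral
  right inverse.\<close>

definition right_invertible :: "nat \<Rightarrow> nat \<Rightarrow> (nat \<Rightarrow> nat \<Rightarrow> 'k) \<Rightarrow> bool" where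
  "right_invertible m a f \<longleftrightarrow> (\<exists>R. (\<forall>l<m. \<forall>j<a. R l j \<in> \<O>) \<and>
     (\<forall>i<a. \<forall>j<a. (\<Sum>l<m. f i l * R l j) = (if i = j then 1 else 0)))"

lemma right_invertible_cong:
  assumes "\<And>i x. i < a \<Longrightarrow> x < m \<Longrightarrow> f i x = g i x"
  shows "right_invertible m a f \<longleftrightarrow> right_invertible m a g"
proof -
  have "(\<Sum>l<m. f i l * R l j) = (\<Sum>l<m. g i l * R l j)" if "i < a" for i j and R :: "nat \<Rightarrow> nat \<Rightarrow> 'k"
    using assms that by (intro sum.cong) auto
  thus ?thesis unfolding right_invertible_def by simp
qed

lemma right_invertible_0 [simp]: "right_invertible m 0 f"
  by (simp add: right_invertible_def)

lemma right_invertible_mono: "right_invertible m (Suc a) f \<Longrightarrow> right_invertible m a f"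
  unfolding right_invertible_def by (elim ex_forward) simp

text \<open>Pairing the relation with column \<open>k\<close> of the right inverse isolates
  \<open>d k\<close>.\<close>

lemma right_invertible_independent:
  assumes "right_invertible m a f" and d: "\<And>j. j < a \<Longrightarrow> d j \<in> \<O>"
    and P: "\<And>x. x < m \<Longrightarrow> (\<Sum>j<a. d j * f j x) \<in> \<P>" and k: "k < a"
  shows "d k \<in> \<P>"
proof -
  obtain R where R: "\<And>l j. l < m \<Longrightarrow> j < a \<Longrightarrow> R l j \<in> \<O>"
    "\<And>i j. i < a \<Longrightarrow> j < a \<Longrightarrow> (\<Sum>l<m. f i l * R l j) = (if i = j then 1 else 0)"
    using assms(1) unfolding right_invertible_def by blast
  have "(\<Sum>l<m. (\<Sum>j<a. d j * f j l) * R l k) = (\<Sum>j<a. d j * (\<Sum>l<m. f j l * R l k))"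
    unfolding sum_distrib_left sum_distrib_right by (subst sum.swap) (simp add: mult.assoc)
  also have "\<dots> = (\<Sum>j<a. d j * (if j = k then 1 else 0))"
    using R(2) k by (intro sum.cong refl) auto
  also have "\<dots> = d k" using k by (simp add: sum_lessThan_delta_mult)
  finally have "d k = (\<Sum>l<m. (\<Sum>j<a. d j * f j l) * R l k)" ..
  also have "\<dots> \<in> \<P>" using P R(1) k by (intro P_sum) (rule P_mult', auto)
  finally show ?thesis .
qed

text \<open>The right inverse \<open>R\<close> leaves \<open>c = w R\<close> as the only candidate
  modulo \<open>\<P>\<close>. If the remainder \<open>d\<close> does not vanish modulo
  \<open>\<P>\<close>, one of its entries is a unit and is the pivot for one more column of the
  right inverse.\<close>

lemma dependent_or_right_invertible:
  assumes "right_invertible m a f" and f: "\<And>j x. j < a \<Longrightarrow> x < m \<Longrightarrow> f j x \<in> \<O>"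
    and w: "\<And>x. x < m \<Longrightarrow> w x \<in> \<O>"
  shows "(\<exists>c. (\<forall>j<a. c j \<in> \<O>) \<and> (\<forall>x<m. w x - (\<Sum>j<a. c j * f j x) \<in> \<P>))
     \<or> right_invertible m (Suc a) (f(a := w))"
proof -
  obtain R where R: "\<And>l j. l < m \<Longrightarrow> j < a \<Longrightarrow> R l j \<in> \<O>"
    "\<And>i j. i < a \<Longrightarrow> j < a \<Longrightarrow> (\<Sum>l<m. f i l * R l j) = (if i = j then 1 else 0)"
    using assms(1) unfolding right_invertible_def by blast
  define c where "c j = (\<Sum>l<m. w l * R l j)" for j
  define d where "d x = w x - (\<Sum>j<a. c j * f j x)" for x
  have c: "c j \<in> \<O>" if "j < a" for j unfolding c_def using w R(1) that by (intro O_sum O_mult) auto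
  have dO: "d x \<in> \<O>" if "x < m" for x
    unfolding d_def using w c f that by (intro O_diff O_sum O_mult) auto
  show ?thesis
  proof (cases "\<forall>x<m. d x \<in> \<P>")
    case True
    thus ?thesis using c unfolding d_def by blast
  next
    case False
    then obtain y where y: "y < m" "d y \<notin> \<P>" by blast
    have dy: "d y \<noteq> 0" "inverse (d y) \<in> \<O>" using y dO[of y] O_inverse by auto
    \<comment> \<open>The unit vector at \<open>y\<close> minus its image under \<open>R f\<close>,
      scaled by the pivot: every \<open>f i\<close> annihilates the result, and \<open>w\<close>
      sends it to 1.\<close>
    define e where "e l = ((if l = y then 1 else 0) - (\<Sum>j<a. R l j * f j y)) * inverse (d y)" for l
    have eO: "e l \<in> \<O>" if "l < m" for l
      unfolding e_def using R(1) f y dy that by (intro O_mult O_diff O_sum) auto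
    have sum_e: "(\<Sum>l<m. h l * e l) = (h y - (\<Sum>j<a. (\<Sum>l<m. h l * R l j) * f j y)) * inverse (d y)"
      for h :: "nat \<Rightarrow> 'k"
    proof -
      have "(\<Sum>l<m. h l * e l) = ((\<Sum>l<m. h l * (if l = y then 1 else 0)) -
          (\<Sum>l<m. \<Sum>j<a. h l * R l j * f j y)) * inverse (d y)"
        unfolding e_def by (simp add: sum_distrib_left sum_distrib_right sum_subtractf[symmetric] algebra_simps)
      also have "(\<Sum>l<m. \<Sum>j<a. h l * R l j * f j y) = (\<Sum>j<a. (\<Sum>l<m. h l * R l j) * f j y)"
        by (subst sum.swap) (simp add: sum_distrib_right)
      finally show ?thesis using y(1) by (simp add: sum_lessThan_delta_mult)
    qed
    have fe: "(\<Sum>l<m. f i l * e l) = 0" if "i < a" for i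
    proof -
      have "(\<Sum>j<a. (\<Sum>l<m. f i l * R l j) * f j y) = (\<Sum>j<a. (if i = j then 1 else 0) * f j y)"
        using R(2) that by (intro sum.cong refl) auto
      also have "\<dots> = f i y" using that by (simp add: sum_lessThan_delta_mult)
      finally show ?thesis unfolding sum_e by simp
    qed
    have we: "(\<Sum>l<m. w l * e l) = 1"
      unfolding sum_e using dy by (simp add: c_def[symmetric] d_def[symmetric])
    \<comment> \<open>Multiples of \<open>e\<close> are subtracted from the old columns until
      \<open>w\<close> annihilates them; the rows \<open>f\<close> do not notice, since they
      annihilate \<open>e\<close>.\<close>
    define R' where "R' l j = (if j = a then e l else R l j - e l * c j)" for l j
    have sum_R': "(\<Sum>l<m. h l * R' l j) = (if j = a then (\<Sum>l<m. h l * e l)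
        else (\<Sum>l<m. h l * R l j) - (\<Sum>l<m. h l * e l) * c j)" for h j
      by (simp add: R'_def sum_distrib_right sum_subtractf right_diff_distrib mult.assoc)
    have "right_invertible m (Suc a) (f(a := w))"
      unfolding right_invertible_def
    proof (intro exI[of _ R'] conjI allI impI)
      show "R' l j \<in> \<O>" if "l < m" "j < Suc a" for l j
        unfolding R'_def using eO[OF that(1)] R(1) c that by (auto simp: less_Suc_eq intro!: O_diff O_mult)
      fix i j assume ij: "i < Suc a" "j < Suc a"
      have "(\<Sum>l<m. w l * R l j) = c j" by (simp add: c_def)
      hence "(\<Sum>l<m. w l * R' l j) = (if a = j then 1 else 0)" unfolding sum_R' we by simp
      moreover have "(\<Sum>l<m. f i l * R' l j) = (if i = j then 1 else 0)" if "i < a"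
        unfolding sum_R' fe[OF that] using R(2)[of i j] ij that by (cases "j = a") auto
      ultimately show "(\<Sum>l<m. (f(a := w)) i l * R' l j) = (if i = j then 1 else 0)"
        using ij by (cases "i = a") simp_all
    qed
    thus ?thesis ..
  qed
qed

end

section \<open>Similitudes and translation-invariant sets\<close>

lemma mat_inverse_ex:
  fixes A :: "'a::field mat"
  assumes A: "A \<in> carrier_mat m m" and d: "det A \<noteq> 0"
  shows "\<exists>B \<in> carrier_mat m m. A * B = 1\<^sub>m m \<and> B * A = 1\<^sub>m m"
proof -
  note adj = adj_mat[OF A]
  have "A * (inverse (det A) \<cdot>\<^sub>m adj_mat A) = 1\<^sub>m m" "(inverse (det A) \<cdot>\<^sub>m adj_mat A) * A = 1\<^sub>m m"
    using adj A d by (auto simp: mult_smult_distrib[of _ m m] mult_smult_assoc_mat[of _ m m _ m] intro!: eq_matI)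
  thus ?thesis using adj(1) by (intro bexI[of _ "inverse (det A) \<cdot>\<^sub>m adj_mat A"]) auto
qed

lemma one_smult_mat: "(1 :: 'a::comm_ring_1) \<cdot>\<^sub>m A = A"
  by (intro eq_matI) auto

locale haar_gsp = valued_field v q for v :: "'k::field \<Rightarrow> int" and q :: nat +
  fixes n :: nat and J :: "'k mat" and M :: "'k mat measure" and K L :: "'k mat" and p :: 'k
  assumes n_pos: "n \<ge> 1"
    and J_alt: "alt_unimodular v q n J"
    and haar: "normalized_haar v q n J M"
    and K: "K \<in> carrier_mat (2*n) (2*n)" "intmat (2*n) K"
    and L: "L \<in> carrier_mat (2*n) (2*n)" "intmat (2*n) L"
    and KL: "K * L = 1\<^sub>m (2*n)" and LK: "L * K = 1\<^sub>m (2*n)"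
    and KJ: "transpose_mat K * std_symp n * K = J"
    and p: "p \<noteq> 0" "v p = 1"
begin

abbreviation "N \<equiv> 2 * n"

lemma J: "J \<in> carrier_mat N N" "det J \<noteq> 0" "v (det J) = 0" "x < N \<Longrightarrow> y < N \<Longrightarrow> J $$ (x, y) \<in> \<O>"
  using J_alt kabs_eq_1_iff by (auto simp: alt_unimodular_def)

text \<open>At such an entry the similitude equation can be solved for its factor; uniqueness,
  integrality and the residue of the factor are all read off there.\<close>

lemma J_unit_entry: "\<exists>x<N. \<exists>y<N. J $$ (x, y) \<notin> \<P>"
proof (rule ccontr)
  assume "\<not> ?thesis"
  hence "det J - det (0\<^sub>m N N) \<in> \<P>"
    by (intro det_cong_P[of _ N]) (use J in \<open>auto simp: intmat_def\<close>)
  moreover have "det (0\<^sub>m N N :: 'k mat) = 0" using n_pos by simp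
  ultimately show False using J unit_iff[of "det J"] by simp
qed

definition sim :: "'k mat \<Rightarrow> 'k \<Rightarrow> bool" where
  "sim A c \<longleftrightarrow> A \<in> carrier_mat N N \<and> c \<noteq> 0 \<and> transpose_mat A * J * A = c \<cdot>\<^sub>m J"

lemma GSp_iff: "A \<in> GSp n J \<longleftrightarrow> (\<exists>c. sim A c)"
  by (auto simp: GSp_def sim_def)

lemma sim_carrier: "sim A c \<Longrightarrow> A \<in> carrier_mat N N"
  by (simp add: sim_def)

lemma sim_mult: "sim A c \<Longrightarrow> sim B d \<Longrightarrow> sim (A * B) (c * d)"
  unfolding sim_def using similitude_compose[of A N B J J c d J] J by auto

text \<open>Determinants give \<open>det A * det A = c ^ N\<close>, which already fixes the
  valuation. This is the origin of \<open>n\<close> in the exponent of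
  \<open>q powr (- (n * s))\<close>.\<close>

lemma sim_det:
  assumes "sim A c"
  shows "det A \<noteq> 0" "v (det A) = int n * v c"
proof -
  have A: "A \<in> carrier_mat N N" "c \<noteq> 0" and e: "transpose_mat A * J * A = c \<cdot>\<^sub>m J"
    using assms by (auto simp: sim_def)
  have "det (transpose_mat A * J * A) = det A * det J * det A"
    using A J by (simp add: det_mult[of _ N] det_transpose[OF A(1)])
  moreover have "det (c \<cdot>\<^sub>m J) = c ^ N * det J" using J by simp
  ultimately have d: "det A * det A = c ^ N" using e J by (simp add: mult_ac)
  thus nz: "det A \<noteq> 0" using A by auto
  have "2 * v (det A) = v (det A * det A)" using nz by (simp add: v_mult)
  also have "\<dots> = int N * v c" using d A by (simp add: v_power)
  finally show "v (det A) = int n * v c" by simp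
qed

lemma sim_inverse_ex:
  assumes "sim A c"
  shows "\<exists>B. A * B = 1\<^sub>m N \<and> B * A = 1\<^sub>m N \<and> sim B (inverse c)"
proof -
  have A: "A \<in> carrier_mat N N" "c \<noteq> 0" and e: "transpose_mat A * J * A = c \<cdot>\<^sub>m J"
    using assms by (auto simp: sim_def)
  obtain B where B: "B \<in> carrier_mat N N" "A * B = 1\<^sub>m N" "B * A = 1\<^sub>m N"
    using mat_inverse_ex[OF A(1) sim_det(1)[OF assms]] by blast
  have BJ: "transpose_mat B * J * B \<in> carrier_mat N N" using B J by auto
  have "J = transpose_mat (A * B) * J * (A * B)" using B J by simp
  also have "\<dots> = (c * 1) \<cdot>\<^sub>m (transpose_mat B * J * B)"
    by (rule similitude_compose[OF A(1) B(1) J(1) J(1) e]) (use BJ in auto)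
  finally have JB: "J = c \<cdot>\<^sub>m (transpose_mat B * J * B)" by simp
  have "transpose_mat B * J * B = inverse c \<cdot>\<^sub>m J"
    by (subst (2) JB) (use BJ A in \<open>auto intro!: eq_matI\<close>)
  thus ?thesis using B A by (auto simp: sim_def)
qed

lemma sim_unique: "sim A c \<Longrightarrow> sim A d \<Longrightarrow> c = d"
proof -
  assume "sim A c" "sim A d"
  hence e: "c \<cdot>\<^sub>m J = d \<cdot>\<^sub>m J" by (simp add: sim_def)
  obtain x y where xy: "x < N" "y < N" "J $$ (x, y) \<notin> \<P>" using J_unit_entry by blast
  hence "J $$ (x, y) \<noteq> 0" by auto
  moreover have "c * J $$ (x, y) = d * J $$ (x, y)"
    using arg_cong[OF e, of "\<lambda>X. X $$ (x, y)"] J xy by simp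
  ultimately show "c = d" by simp
qed

lemma sim_integral:
  assumes "sim A c" "intmat N A"
  shows "c \<in> \<O>"
proof -
  have A: "A \<in> carrier_mat N N" and e: "transpose_mat A * J * A = c \<cdot>\<^sub>m J"
    using assms by (auto simp: sim_def)
  obtain x y where xy: "x < N" "y < N" "J $$ (x, y) \<notin> \<P>" using J_unit_entry by blast
  have "intmat N (transpose_mat A)" "intmat N J" using assms(2) A J by (auto simp: intmat_def)
  hence "intmat N (transpose_mat A * J * A)"
    using assms(2) A J by (intro intmat_mult) auto
  hence "c * J $$ (x, y) \<in> \<O>" using e xy J by (auto simp: intmat_def)
  hence "c * J $$ (x, y) * inverse (J $$ (x, y)) \<in> \<O>" using O_inverse xy J by (intro O_mult[of "_ * _"]) auto
  moreover have "J $$ (x, y) \<noteq> 0" using xy(3) P_0 by metis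
  ultimately show ?thesis by (simp add: mult.assoc)
qed

lemma GSp_o_iff: "A \<in> GSp_o v q n J \<longleftrightarrow> intmat N A \<and> (\<exists>c. sim A c \<and> v c = 0)"
  unfolding GSp_o_def mem_Collect_eq GSp_iff kabs_eq_1_iff integral_mat_def intmat_def
  using sim_det n_pos by fastforce

lemma GSp_o_inverse:
  assumes "g \<in> GSp_o v q n J"
  shows "\<exists>h\<in>carrier_mat N N. intmat N h \<and> g * h = 1\<^sub>m N \<and> h * g = 1\<^sub>m N"
proof -
  obtain c where c: "sim g c" "v c = 0" "intmat N g" using assms by (auto simp: GSp_o_iff)
  show ?thesis using intmat_inverse_ex[OF sim_carrier[OF c(1)] c(3)] sim_det[OF c(1)] c(2) by simp
qed

text \<open>Serves as a measurability criterion: such a set is a union of cosets of an open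
  subgroup, and left translates inherit the property.\<close>

definition right_invariant :: "'k mat set \<Rightarrow> bool" where
  "right_invariant U \<longleftrightarrow> U \<subseteq> GSp n J \<and> (\<forall>A\<in>U. \<forall>g\<in>GSp_o v q n J. A * g \<in> U)"

lemma right_invariant_sim: "right_invariant U \<Longrightarrow> A \<in> U \<Longrightarrow> \<exists>c. sim A c"
  by (auto simp: right_invariant_def GSp_iff[symmetric])

lemma kabs_less_imp:
  assumes "kabs v q x < real q powr (- real m)"
  shows "x = 0 \<or> v x > int m"
proof (cases "x = 0")
  case False
  hence "real q powr (- real_of_int (v x)) < real q powr (- real m)" using assms by (simp add: kabs_def)
  hence "- real_of_int (v x) < - real m" using residues_ge_2 by (subst (asm) powr_less_cancel_iff) auto
  thus ?thesis by simp
qed simp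

text \<open>Reducing the similitude equation at a unit entry of \<open>J\<close> shows that
  \<open>c\<close> is congruent to 1, hence a unit. So \<open>GSp_o\<close> contains a neighbourhood
  of the identity.\<close>

lemma congruent_one_in_GSp_o:
  assumes X: "sim X c" and one: "\<And>i j. i < N \<Longrightarrow> j < N \<Longrightarrow> X $$ (i, j) - 1\<^sub>m N $$ (i, j) \<in> \<P>"
  shows "X \<in> GSp_o v q n J"
proof -
  have Xc: "X \<in> carrier_mat N N" and e: "transpose_mat X * J * X = c \<cdot>\<^sub>m J"
    using X by (auto simp: sim_def)
  have iX: "intmat N X" unfolding intmat_def
  proof (intro allI impI)
    fix i j assume ij: "i < N" "j < N"
    have "(X $$ (i, j) - 1\<^sub>m N $$ (i, j)) + 1\<^sub>m N $$ (i, j) \<in> \<O>"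
      by (rule O_add[OF P_subset_O[OF one[OF ij]]]) (use ij in auto)
    thus "X $$ (i, j) \<in> \<O>" by simp
  qed
  have i1: "intmat N (1\<^sub>m N)" and iJ: "intmat N J" using J by (auto simp: intmat_def)
  have iXJ: "intmat N (transpose_mat X * J)"
    by (intro intmat_mult) (use iX Xc J in \<open>auto simp: intmat_def\<close>)
  have XJ: "(transpose_mat X * J) $$ (i, j) - (1\<^sub>m N * J) $$ (i, j) \<in> \<P>" if "i < N" "j < N" for i j
  proof (rule mult_cong_P[of _ N])
    fix i j assume ij: "i < N" "j < N"
    have "transpose_mat X $$ (i, j) = X $$ (j, i)" "1\<^sub>m N $$ (i, j) = (1\<^sub>m N $$ (j, i) :: 'k)"
      using ij Xc by auto
    thus "transpose_mat X $$ (i, j) - 1\<^sub>m N $$ (i, j) \<in> \<P>" using one[OF ij(2,1)] by (simp only:)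
  qed (use that Xc J iJ i1 in auto)
  have XJX: "(transpose_mat X * J * X) $$ (i, j) - (1\<^sub>m N * J * 1\<^sub>m N) $$ (i, j) \<in> \<P>" if "i < N" "j < N" for i j
    by (rule mult_cong_P[of _ N]) (use that Xc J iJ iX one XJ in auto)
  obtain x y where xy: "x < N" "y < N" "J $$ (x, y) \<notin> \<P>" using J_unit_entry by blast
  have "c * J $$ (x, y) - J $$ (x, y) \<in> \<P>" using XJX[OF xy(1,2)] xy J e by simp
  hence "(c * J $$ (x, y) - J $$ (x, y)) * inverse (J $$ (x, y)) \<in> \<P>"
    using O_inverse xy J by (intro P_mult') auto
  moreover have "(c * J $$ (x, y) - J $$ (x, y)) * inverse (J $$ (x, y)) = c - 1"
    using xy by (cases "J $$ (x, y) = 0") (auto simp: field_simps)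
  ultimately have c1: "c - 1 \<in> \<P>" by simp
  have "c \<notin> \<P>"
  proof
    assume "c \<in> \<P>"
    hence "c - (c - 1) \<in> \<P>" using c1 by (rule P_diff)
    thus False by simp
  qed
  hence "v c = 0" using sim_integral[OF X iX] unit_iff by blast
  thus ?thesis using X iX by (auto simp: GSp_o_iff)
qed

text \<open>If \<open>B\<close> is close to \<open>A\<close> and \<open>H\<close> is the inverse of
  \<open>A\<close>, then \<open>H * B\<close> is congruent to the identity, so it lies in
  \<open>GSp_o\<close> and \<open>B = A * (H * B)\<close> stays in \<open>U\<close>. Thus
  \<open>U\<close> is open.\<close>

lemma right_invariant_sets:
  assumes U: "right_invariant U"
  shows "U \<in> sets M"
proof -
  have "\<exists>e>0. \<forall>B\<in>GSp n J. mat_dist v q n A B < e \<longrightarrow> B \<in> U" if A: "A \<in> U" for A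
  proof -
    obtain c where c: "sim A c" using A U right_invariant_sim by blast
    obtain H where H: "A * H = 1\<^sub>m N" "H * A = 1\<^sub>m N" "sim H (inverse c)"
      using sim_inverse_ex[OF c] by blast
    note carr = sim_carrier[OF c] sim_carrier[OF H(3)]
    \<comment> \<open>Bounds the denominators of \<open>H\<close>, so that
      \<open>H * (A - B)\<close> has entries in \<open>\<P>\<close> once \<open>A\<close> and
      \<open>B\<close> are closer than \<open>q powr (- m)\<close>. The arbitrary value of
      \<open>v\<close> at zero entries can only enlarge \<open>m\<close>.\<close>
    define m where "m = Max ((\<lambda>(i, j). nat (- v (H $$ (i, j)))) ` ({..<N} \<times> {..<N}))"
    have m: "- v (H $$ (i, j)) \<le> int m" if "i < N" "j < N" for i j
    proof -
      have "nat (- v (H $$ (i, j))) \<le> m" unfolding m_def using that by (intro Max_ge) auto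
      thus ?thesis by simp
    qed
    define e where "e = real q powr (- real m)"
    have "B \<in> U" if B: "B \<in> GSp n J" and d: "mat_dist v q n A B < e" for B
    proof -
      obtain b where b: "sim B b" using B by (auto simp: GSp_iff)
      note Bc = sim_carrier[OF b]
      have close: "A $$ (i, j) - B $$ (i, j) = 0 \<or> v (A $$ (i, j) - B $$ (i, j)) > int m"
        if "i < N" "j < N" for i j
      proof (rule kabs_less_imp)
        have "finite {kabs v q (A $$ (i, j) - B $$ (i, j)) | i j. i < N \<and> j < N}"
          by (rule finite_subset[of _ "(\<lambda>(i, j). kabs v q (A $$ (i, j) - B $$ (i, j))) ` ({..<N} \<times> {..<N})"])
             auto
        hence "kabs v q (A $$ (i, j) - B $$ (i, j)) \<le> mat_dist v q n A B"
          unfolding mat_dist_def using that by (intro Max_ge) auto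
        thus "kabs v q (A $$ (i, j) - B $$ (i, j)) < real q powr (- real m)" using d e_def by simp
      qed
      have small: "H $$ (i, l) * (A $$ (l, j) - B $$ (l, j)) \<in> \<P>" if "i < N" "l < N" "j < N" for i l j
        using close[OF that(2,3)] m[OF that(1,2)] v_mult unfolding max_ideal_def by fastforce
      have HB: "sim (H * B) (inverse c * b)" using H b by (intro sim_mult)
      have "(H * B) $$ (i, j) - 1\<^sub>m N $$ (i, j) \<in> \<P>" if ij: "i < N" "j < N" for i j
      proof -
        have "(H * B) $$ (i, j) - (H * A) $$ (i, j) =
            - (\<Sum>l<N. H $$ (i, l) * (A $$ (l, j) - B $$ (l, j)))"
          unfolding mult_mat_entry[OF carr(2) Bc ij] mult_mat_entry[OF carr(2,1) ij]
          by (simp add: sum_subtractf right_diff_distrib)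
        also have "\<dots> \<in> \<P>" using small ij by (intro P_uminus P_sum) auto
        finally show ?thesis using H(2) by simp
      qed
      hence "H * B \<in> GSp_o v q n J" by (rule congruent_one_in_GSp_o[OF HB])
      hence "A * (H * B) \<in> U" using U A by (auto simp: right_invariant_def)
      moreover have "A * (H * B) = A * H * B" using carr Bc by simp
      ultimately show ?thesis using H(1) Bc by simp
    qed
    moreover have "e > 0" using residues_ge_2 by (simp add: e_def)
    ultimately show ?thesis by blast
  qed
  hence "U \<in> GSp_opens v q n J" using U by (auto simp: GSp_opens_def right_invariant_def)
  thus ?thesis using haar by (auto simp: normalized_haar_def)
qed

lemma right_invariant_translate:
  assumes U: "right_invariant U" and g: "sim g c"
  shows "right_invariant ((\<lambda>A. g * A) ` U)" "emeasure M ((\<lambda>A. g * A) ` U) = emeasure M U"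
proof -
  have carr: "A \<in> carrier_mat N N" if "A \<in> U" for A
    using right_invariant_sim[OF U that] sim_carrier by blast
  have *: "g * A * h = g * (A * h)" if "A \<in> U" "h \<in> GSp_o v q n J" for A h
    using carr[OF that(1)] that(2) sim_carrier[OF g] by (auto simp: GSp_o_iff dest!: sim_carrier)
  show "right_invariant ((\<lambda>A. g * A) ` U)"
    using U g sim_mult * unfolding right_invariant_def GSp_iff by (fastforce simp: GSp_iff)
  show "emeasure M ((\<lambda>A. g * A) ` U) = emeasure M U"
    using haar g right_invariant_sets[OF U] GSp_iff unfolding normalized_haar_def by blast
qed

text \<open>Turns left invariance into counting. The powers of \<open>q\<close> in the measure
  recursion all arise as \<open>card I\<close> here.\<close>

lemma emeasure_disjoint_translates:
  assumes U: "right_invariant U" and fin: "finite I" and g: "\<And>i. i \<in> I \<Longrightarrow> sim (g i) (c i)"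
    and disj: "\<And>i j A B. i \<in> I \<Longrightarrow> j \<in> I \<Longrightarrow> A \<in> U \<Longrightarrow> B \<in> U \<Longrightarrow> g i * A = g j * B \<Longrightarrow> i = j"
  shows "(\<Union>i\<in>I. (\<lambda>A. g i * A) ` U) \<in> sets M"
    and "emeasure M (\<Union>i\<in>I. (\<lambda>A. g i * A) ` U) = of_nat (card I) * emeasure M U"
proof -
  have s: "(\<lambda>A. g i * A) ` U \<in> sets M" if "i \<in> I" for i
    using right_invariant_sets right_invariant_translate(1)[OF U g[OF that]] by blast
  thus "(\<Union>i\<in>I. (\<lambda>A. g i * A) ` U) \<in> sets M" using fin by auto
  have "disjoint_family_on (\<lambda>i. (\<lambda>A. g i * A) ` U) I"
    using disj unfolding disjoint_family_on_def by blast
  hence "emeasure M (\<Union>i\<in>I. (\<lambda>A. g i * A) ` U) = (\<Sum>i\<in>I. emeasure M ((\<lambda>A. g i * A) ` U))"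
    using s fin by (intro sum_emeasure[symmetric]) auto
  also have "\<dots> = (\<Sum>i\<in>I. emeasure M U)"
    using right_invariant_translate(2)[OF U g] by (intro sum.cong) auto
  finally show "emeasure M (\<Union>i\<in>I. (\<lambda>A. g i * A) ` U) = of_nat (card I) * emeasure M U" by simp
qed

text \<open>The rows of \<open>K * A\<close> describe \<open>A\<close> in a symplectic basis, where the form is standard and
  similitudes can be written down as explicit row operations.\<close>

lemma row_operation:
  assumes G: "G \<in> carrier_mat N N" "transpose_mat G * std_symp n * G = c \<cdot>\<^sub>m std_symp n" "c \<noteq> 0"
  shows "sim (L * G * K) c" and "A \<in> carrier_mat N N \<Longrightarrow> K * (L * G * K * A) = G * (K * A)"
proof -
  note C = std_symp_carrier[of n]
  have KJ1: "transpose_mat K * std_symp n * K = 1 \<cdot>\<^sub>m J" using KJ J by (simp add: one_smult_mat)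
  have "transpose_mat (K * L) * std_symp n * (K * L) = (1 * 1) \<cdot>\<^sub>m (transpose_mat L * J * L)"
    by (rule similitude_compose[OF K(1) L(1) C J(1) KJ1]) (simp add: one_smult_mat)
  hence LJ: "transpose_mat L * J * L = 1 \<cdot>\<^sub>m std_symp n" by (simp add: one_smult_mat KL left_mult_one_mat[OF C] right_mult_one_mat[OF C])
  have LG: "transpose_mat (L * G) * J * (L * G) = (1 * c) \<cdot>\<^sub>m std_symp n"
    by (rule similitude_compose[OF L(1) G(1) J(1) C LJ G(2)])
  have "transpose_mat (L * G * K) * J * (L * G * K) = (1 * c * 1) \<cdot>\<^sub>m J"
    by (rule similitude_compose[OF _ K(1) J(1) C LG KJ1]) (use L G in auto)
  thus "sim (L * G * K) c" using K L G by (auto simp: sim_def)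
  assume A: "A \<in> carrier_mat N N"
  have "K * (L * G * K * A) = (K * L) * (G * (K * A))"
    using K(1) L(1) G(1) A by (simp add: assoc_mult_mat[of _ N N _ N _ N])
  thus "K * (L * G * K * A) = G * (K * A)" using KL K(1) G(1) A by simp
qed

end

lemma sum_lessThan_if_less:
  fixes h :: "nat \<Rightarrow> 'a::comm_monoid_add"
  shows "a \<le> n \<Longrightarrow> (\<Sum>j<n. if j < a then h j else 0) = (\<Sum>j<a. h j)"
  by (intro sum.mono_neutral_cong_right) auto

definition swap_index :: "nat \<Rightarrow> nat \<Rightarrow> nat \<Rightarrow> nat" where
  "swap_index a z i = (if i = a then z else if i = z then a else i)"

lemma swap_index_eq_iff: "i = swap_index a z j \<longleftrightarrow> j = swap_index a z i"
  by (auto simp: swap_index_def)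

text \<open>These pairs index the free entries of a symmetric matrix of size \<open>a\<close>, which
  gives the exponent in the division step.\<close>

lemma card_upper_pairs: "card {(i, j). i \<le> j \<and> j < (a::nat)} = a * (a + 1) div 2"
  and finite_upper_pairs: "finite {(i, j). i \<le> j \<and> j < (a::nat)}"
proof -
  have eq: "{(i, j). i \<le> j \<and> j < a} = (\<lambda>(j, i). (i, j)) ` Sigma {..<a} (\<lambda>j. {..j})" by force
  show "finite {(i, j). i \<le> j \<and> j < a}" unfolding eq by simp
  have "card {(i, j). i \<le> j \<and> j < a} = (\<Sum>j<a. Suc j)"
    unfolding eq by (subst card_image) (auto simp: inj_on_def)
  also have "\<dots> = a * (a + 1) div 2" by (induction a) auto
  finally show "card {(i, j). i \<le> j \<and> j < a} = a * (a + 1) div 2" .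
qed

section \<open>Stages of the row elimination and the elementary row operations\<close>

context haar_gsp
begin

text \<open>Indices \<open>i < n\<close> are the rows \<open>r\<^sub>i\<close> of the overview,
  indices \<open>n + i\<close> the rows \<open>s\<^sub>i\<close>.\<close>

definition adapted_row :: "'k mat \<Rightarrow> nat \<Rightarrow> nat \<Rightarrow> 'k" where
  "adapted_row A i x = (K * A) $$ (i, x)"

lemma adapted_row_gram:
  assumes "sim A c" "x < N" "y < N"
  shows "(\<Sum>i<n. adapted_row A i x * adapted_row A (n + i) y - adapted_row A (n + i) x * adapted_row A i y) = c * J $$ (x, y)"
proof -
  note A = sim_carrier[OF assms(1)]
  have KA: "K * A \<in> carrier_mat N N" using K A by simp
  have "transpose_mat (K * A) * std_symp n * (K * A) = (1 * c) \<cdot>\<^sub>m J"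
    by (rule similitude_compose[OF K(1) A std_symp_carrier J(1)])
       (use KJ assms(1) in \<open>auto simp: one_smult_mat sim_def\<close>)
  thus ?thesis using symp_gram_entry[OF KA assms(2,3)] assms(2,3) J(1) by (simp add: adapted_row_def)
qed

text \<open>A stage of the elimination: of the rows \<open>i < n\<close>, the first \<open>a\<close>
  are settled as independent, \<open>u\<close> are undecided, and the rest are settled as zero
  modulo \<open>\<P>\<close>. With \<open>u = n - a\<close> nothing is settled beyond independence;
  at \<open>u = 0\<close> a uniformizer can be divided out.\<close>

definition level :: "nat \<Rightarrow> nat \<Rightarrow> nat \<Rightarrow> 'k mat set" where
  "level m a u = {A. (\<exists>c. sim A c \<and> v c = int m) \<and> (\<forall>i<N. \<forall>x<N. adapted_row A i x \<in> \<O>) \<and>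
     right_invertible N a (adapted_row A) \<and> (\<forall>i. a + u \<le> i \<longrightarrow> i < n \<longrightarrow> (\<forall>x<N. adapted_row A i x \<in> \<P>))}"

text \<open>Right multiplication by \<open>g\<close> recombines columns with integral coefficients,
  which respects integrality and vanishing modulo \<open>\<P>\<close> of each row; the integral
  inverse of \<open>g\<close> carries the right inverse along.\<close>

lemma level_right_invariant:
  assumes "a \<le> n"
  shows "right_invariant (level m a u)"
  unfolding right_invariant_def
proof (intro conjI subsetI ballI)
  show "A \<in> GSp n J" if "A \<in> level m a u" for A using that by (auto simp: level_def GSp_iff)
  fix A g assume A: "A \<in> level m a u" and g: "g \<in> GSp_o v q n J"
  obtain c where c: "sim A c" "v c = int m" using A by (auto simp: level_def)
  obtain d where d: "sim g d" "v d = 0" "intmat N g" using g by (auto simp: GSp_o_iff)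
  obtain h where h: "h \<in> carrier_mat N N" "intmat N h" "g * h = 1\<^sub>m N" using GSp_o_inverse[OF g] by blast
  note carr = sim_carrier[OF c(1)] sim_carrier[OF d(1)]
  have KA: "K * A \<in> carrier_mat N N" using K carr by simp
  have K_assoc: "K * (A * g) = K * A * g" using K carr by simp
  have adapted_row_g: "adapted_row (A * g) i x = (\<Sum>l<N. adapted_row A i l * g $$ (l, x))" if "i < N" "x < N" for i x
    unfolding adapted_row_def K_assoc using mult_mat_entry[OF KA carr(2) that] .
  have "right_invertible N a (adapted_row (A * g))"
  proof -
    obtain R where R: "\<And>l j. l < N \<Longrightarrow> j < a \<Longrightarrow> R l j \<in> \<O>"
      "\<And>i j. i < a \<Longrightarrow> j < a \<Longrightarrow> (\<Sum>l<N. adapted_row A i l * R l j) = (if i = j then 1 else 0)"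
      using A unfolding level_def right_invertible_def by blast
    define S where "S = mat N a (\<lambda>(l, j). R l j)"
    have S: "S \<in> carrier_mat N a" by (simp add: S_def)
    have hS: "h * S \<in> carrier_mat N a" using h S by simp
    have KAg: "K * A * g \<in> carrier_mat N N" using KA carr by simp
    have "(K * A * g) * (h * S) = K * A * (g * (h * S))" by (rule assoc_mult_mat[OF KA carr(2) hS])
    also have "g * (h * S) = (g * h) * S" by (rule assoc_mult_mat[OF carr(2) h(1) S, symmetric])
    finally have eq: "(K * A * g) * (h * S) = K * A * S" using h S by simp
    show ?thesis unfolding right_invertible_def
    proof (intro exI[of _ "\<lambda>l j. (h * S) $$ (l, j)"] conjI allI impI)
      fix l j assume lj: "l < N" "j < a"
      show "(h * S) $$ (l, j) \<in> \<O>" unfolding mult_mat_entry[OF h(1) S lj]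
        using h(2) R(1) lj by (intro O_sum O_mult) (auto simp: intmat_def S_def)
    next
      fix i j assume ij: "i < a" "j < a"
      hence iN: "i < N" using assms by simp
      have "(\<Sum>l<N. adapted_row (A * g) i l * (h * S) $$ (l, j)) = (K * A * S) $$ (i, j)"
        unfolding adapted_row_def K_assoc eq[symmetric] using mult_mat_entry[OF KAg hS iN ij(2)] by simp
      also have "\<dots> = (\<Sum>l<N. adapted_row A i l * R l j)"
        unfolding mult_mat_entry[OF KA S iN ij(2)] adapted_row_def using ij(2) by (simp add: S_def)
      finally show "(\<Sum>l<N. adapted_row (A * g) i l * (h * S) $$ (l, j)) = (if i = j then 1 else 0)"
        using R(2)[OF ij] by simp
    qed
  qed
  moreover have "sim (A * g) (c * d)" "v (c * d) = int m"
    using c d sim_mult[OF c(1) d(1)] v_mult by (auto simp: sim_def)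
  moreover have "adapted_row (A * g) i x \<in> \<O>" if "i < N" "x < N" for i x
    unfolding adapted_row_g[OF that] using A d(3) that by (intro O_sum O_mult) (auto simp: level_def intmat_def)
  moreover have "adapted_row (A * g) i x \<in> \<P>" if i: "a + u \<le> i" "i < n" and x: "x < N" for i x
  proof -
    have "i < N" using i by simp
    have "adapted_row A i l * g $$ (l, x) \<in> \<P>" if "l < N" for l
      using A d(3) that i x by (intro P_mult') (auto simp: level_def intmat_def)
    thus ?thesis unfolding adapted_row_g[OF \<open>i < N\<close> x] by (intro P_sum) auto
  qed
  ultimately show "A * g \<in> level m a u" by (auto simp: level_def)
qed

lemma level_carrier: "A \<in> level m a u \<Longrightarrow> A \<in> carrier_mat N N"
  by (auto simp: level_def dest: sim_carrier)

definition row_op ::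
    "(nat \<Rightarrow> nat \<Rightarrow> 'k) \<Rightarrow> (nat \<Rightarrow> nat \<Rightarrow> 'k) \<Rightarrow> (nat \<Rightarrow> nat \<Rightarrow> 'k) \<Rightarrow> 'k mat" where
  "row_op \<alpha> \<gamma> \<delta> = L * block_lower n \<alpha> \<gamma> \<delta> * K"

lemma sim_row_op:
  assumes "\<And>x y. x < n \<Longrightarrow> y < n \<Longrightarrow> (\<Sum>i<n. \<alpha> i x * \<gamma> i y) = (\<Sum>i<n. \<alpha> i y * \<gamma> i x)"
    and "\<And>x y. x < n \<Longrightarrow> y < n \<Longrightarrow> (\<Sum>i<n. \<alpha> i x * \<delta> i y) = (if x = y then c else 0)"
    and "c \<noteq> 0"
  shows "sim (row_op \<alpha> \<gamma> \<delta>) c"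
  unfolding row_op_def
  by (rule row_operation(1)[OF block_lower_carrier block_lower_symp[OF assms(1,2)] assms(3)])

lemma adapted_row_op:
  assumes G: "sim (row_op \<alpha> \<gamma> \<delta>) c" and A: "A \<in> carrier_mat N N" and i: "i < n" and x: "x < N"
  shows "adapted_row (row_op \<alpha> \<gamma> \<delta> * A) i x = (\<Sum>j<n. \<alpha> i j * adapted_row A j x)"
    and "adapted_row (row_op \<alpha> \<gamma> \<delta> * A) (n + i) x =
      (\<Sum>j<n. \<gamma> i j * adapted_row A j x) + (\<Sum>j<n. \<delta> i j * adapted_row A (n + j) x)"
proof -
  have KA: "K * A \<in> carrier_mat N N" using K A by simp
  have assoc: "K * (L * G * K * A) = (K * L) * (G * (K * A))" if "G \<in> carrier_mat N N" for G
    using K(1) L(1) that A by (simp add: assoc_mult_mat[of _ N N _ N _ N])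
  have "block_lower n \<alpha> \<gamma> \<delta> * (K * A) \<in> carrier_mat N N"
    using KA by (rule mult_carrier_mat[OF block_lower_carrier])
  hence eq: "K * (row_op \<alpha> \<gamma> \<delta> * A) = block_lower n \<alpha> \<gamma> \<delta> * (K * A)"
    unfolding row_op_def assoc[OF block_lower_carrier] KL by (rule left_mult_one_mat)
  show "adapted_row (row_op \<alpha> \<gamma> \<delta> * A) i x = (\<Sum>j<n. \<alpha> i j * adapted_row A j x)"
    "adapted_row (row_op \<alpha> \<gamma> \<delta> * A) (n + i) x =
      (\<Sum>j<n. \<gamma> i j * adapted_row A j x) + (\<Sum>j<n. \<delta> i j * adapted_row A (n + j) x)"
    unfolding adapted_row_def eq using block_lower_mult[OF KA i x] by simp_all
qed

lemma sim_preimage: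
  assumes A: "sim A c" and g: "sim g d"
  shows "\<exists>B. sim B (inverse d * c) \<and> A = g * B"
proof -
  obtain h where h: "g * h = 1\<^sub>m N" "sim h (inverse d)" using sim_inverse_ex[OF g] by blast
  have "g * (h * A) = A" using h sim_carrier[OF A] sim_carrier[OF g] sim_carrier[OF h(2)]
    by (simp add: assoc_mult_mat[of _ N N _ N _ N, symmetric])
  thus ?thesis using sim_mult[OF h(2) A] by metis
qed

text \<open>Adding a combination of the rows \<open>r\<^sub>j\<close> (\<open>j < a\<close>) to
  \<open>r\<^sub>z\<close> forces the dual change of the partners,
  \<open>s\<^sub>i - c i * s\<^sub>z\<close> for \<open>i < a\<close>, which is the third
  block.\<close>

definition transvection :: "nat \<Rightarrow> nat \<Rightarrow> (nat \<Rightarrow> 'k) \<Rightarrow> 'k mat" where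
  "transvection a z c = row_op
     (\<lambda>i j. (if i = j then 1 else 0) + (if i = z \<and> j < a then c j else 0)) (\<lambda>_ _. 0)
     (\<lambda>i j. (if i = j then 1 else 0) - (if j = z \<and> i < a then c i else 0))"

lemma sim_transvection:
  assumes "a \<le> z" "z < n"
  shows "sim (transvection a z c) 1"
  unfolding transvection_def
proof (rule sim_row_op)
  fix x y assume xy: "x < n" "y < n"
  let ?d = "\<lambda>i j. if i = j then (1::'k) else 0"
  have "(\<Sum>i<n. (?d i x + (if i = z \<and> x < a then c x else 0)) * (?d i y - (if y = z \<and> i < a then c i else 0)))
      = (\<Sum>i<n. ?d i x * (?d i y - (if y = z \<and> i < a then c i else 0)))
      + (\<Sum>i<n. ?d i z * ((if x < a then c x else 0) * (?d i y - (if y = z \<and> i < a then c i else 0))))"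
    unfolding sum.distrib[symmetric] by (intro sum.cong refl) (simp add: algebra_simps)
  also have "\<dots> = ?d x y"
    unfolding sum_lessThan_delta_mult using xy assms by auto
  finally show "(\<Sum>i<n. (?d i x + (if i = z \<and> x < a then c x else 0)) *
      (?d i y - (if y = z \<and> i < a then c i else 0))) = (if x = y then 1 else 0)" .
qed auto

lemma adapted_row_transvection:
  assumes az: "a \<le> z" "z < n" and A: "A \<in> carrier_mat N N" and i: "i < n" and x: "x < N"
  shows "adapted_row (transvection a z c * A) i x = adapted_row A i x + (if i = z then \<Sum>j<a. c j * adapted_row A j x else 0)"
    and "adapted_row (transvection a z c * A) (n + i) x = adapted_row A (n + i) x - (if i < a then c i * adapted_row A (n + z) x else 0)"
proof -
  note e = adapted_row_op[OF sim_transvection[OF az, of c, unfolded transvection_def] A i x, folded transvection_def]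
  have "(\<Sum>j<n. ((if i = j then 1 else 0) + (if i = z \<and> j < a then c j else 0)) * adapted_row A j x) =
      (\<Sum>j<n. (if i = j then 1 else 0) * adapted_row A j x) +
      (\<Sum>j<n. if j < a then (if i = z then c j * adapted_row A j x else 0) else 0)"
    unfolding sum.distrib[symmetric] by (intro sum.cong refl) (simp add: algebra_simps)
  also have "\<dots> = adapted_row A i x + (if i = z then \<Sum>j<a. c j * adapted_row A j x else 0)"
    unfolding sum_lessThan_delta_mult using i az by (simp add: sum_lessThan_if_less)
  finally show "adapted_row (transvection a z c * A) i x = adapted_row A i x + (if i = z then \<Sum>j<a. c j * adapted_row A j x else 0)"
    unfolding e(1) .
  have "(\<Sum>j<n. ((if i = j then 1 else 0) - (if j = z \<and> i < a then c i else 0)) * adapted_row A (n + j) x) =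
      (\<Sum>j<n. (if i = j then 1 else 0) * adapted_row A (n + j) x) -
      (\<Sum>j<n. (if j = z then 1 else 0) * ((if i < a then c i else 0) * adapted_row A (n + j) x))"
    unfolding sum_subtractf[symmetric] by (intro sum.cong refl) (simp add: algebra_simps)
  also have "\<dots> = adapted_row A (n + i) x - (if i < a then c i * adapted_row A (n + z) x else 0)"
    unfolding sum_lessThan_delta_mult using i az by simp
  finally show "adapted_row (transvection a z c * A) (n + i) x =
      adapted_row A (n + i) x - (if i < a then c i * adapted_row A (n + z) x else 0)"
    unfolding e(2) by simp
qed

definition row_swap :: "nat \<Rightarrow> nat \<Rightarrow> 'k mat" where
  "row_swap a z = row_op (\<lambda>i j. if i = swap_index a z j then 1 else 0) (\<lambda>_ _. 0)
     (\<lambda>i j. if i = swap_index a z j then 1 else 0)"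

lemma sim_row_swap:
  assumes "a < n" "z < n"
  shows "sim (row_swap a z) 1"
  unfolding row_swap_def
proof (rule sim_row_op)
  fix x y assume xy: "x < n" "y < n"
  have "swap_index a z x < n" using assms xy by (simp add: swap_index_def)
  moreover have "swap_index a z x = swap_index a z y \<longleftrightarrow> x = y" by (auto simp: swap_index_def)
  ultimately show "(\<Sum>i<n. (if i = swap_index a z x then 1 else 0) * (if i = swap_index a z y then 1 else 0)) =
      (if x = y then 1 else (0::'k))"
    unfolding sum_lessThan_delta_mult by simp
qed auto

lemma adapted_row_swap:
  assumes az: "a < n" "z < n" and A: "A \<in> carrier_mat N N" and i: "i < n" and x: "x < N"
  shows "adapted_row (row_swap a z * A) i x = adapted_row A (swap_index a z i) x"
    and "adapted_row (row_swap a z * A) (n + i) x = adapted_row A (n + swap_index a z i) x"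
proof -
  note e = adapted_row_op[OF sim_row_swap[OF az, unfolded row_swap_def] A i x, folded row_swap_def]
  have "swap_index a z i < n" using az i by (simp add: swap_index_def)
  thus "adapted_row (row_swap a z * A) i x = adapted_row A (swap_index a z i) x"
    "adapted_row (row_swap a z * A) (n + i) x = adapted_row A (n + swap_index a z i) x"
    unfolding e swap_index_eq_iff[of i] by (simp_all add: sum_lessThan_delta_mult)
qed

text \<open>Reverses a division by \<open>p\<close>. Exactly one row of each pair is multiplied,
  \<open>s\<^sub>i\<close> for \<open>i < a\<close> and \<open>r\<^sub>i\<close> otherwise, so the
  similitude factor is \<open>p\<close>; the symmetric \<open>y\<close> restores the component of
  \<open>s\<^sub>i\<close> along the independent rows.\<close>

definition row_scale :: "nat \<Rightarrow> (nat \<Rightarrow> nat \<Rightarrow> 'k) \<Rightarrow> 'k mat" where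
  "row_scale a y = row_op (\<lambda>i j. (if i = j then 1 else 0) * (if i < a then 1 else p))
     (\<lambda>i j. if j < a then (if i < a then y i j else 0) else 0)
     (\<lambda>i j. (if i = j then 1 else 0) * (if i < a then p else 1))"

lemma sim_row_scale:
  assumes "\<And>i j. i < a \<Longrightarrow> j < a \<Longrightarrow> y i j = y j i"
  shows "sim (row_scale a y) p"
  unfolding row_scale_def
proof (rule sim_row_op)
  fix x w assume xw: "x < n" "w < n"
  show "(\<Sum>i<n. (if i = x then 1 else 0) * (if i < a then 1 else p) * ((if i = w then 1 else 0) * (if i < a then p else 1)))
      = (if x = w then p else 0)"
    unfolding mult.assoc sum_lessThan_delta_mult using xw by auto
  show "(\<Sum>i<n. (if i = x then 1 else 0) * (if i < a then 1 else p) * (if w < a then (if i < a then y i w else 0) else 0))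
      = (\<Sum>i<n. (if i = w then 1 else 0) * (if i < a then 1 else p) * (if x < a then (if i < a then y i x else 0) else 0))"
    unfolding mult.assoc sum_lessThan_delta_mult using xw assms by auto
qed (rule p)

lemma adapted_row_scale:
  assumes y: "\<And>i j. i < a \<Longrightarrow> j < a \<Longrightarrow> y i j = y j i" and a: "a \<le> n"
    and A: "A \<in> carrier_mat N N" and i: "i < n" and x: "x < N"
  shows "adapted_row (row_scale a y * A) i x = (if i < a then 1 else p) * adapted_row A i x"
    and "adapted_row (row_scale a y * A) (n + i) x =
      (if i < a then (\<Sum>j<a. y i j * adapted_row A j x) + p * adapted_row A (n + i) x else adapted_row A (n + i) x)"
proof -
  have "sim (row_scale a y) p" by (rule sim_row_scale) (rule y)
  note e = adapted_row_op[OF this[unfolded row_scale_def] A i x, folded row_scale_def]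
  have "(\<Sum>j<n. (if i = j then 1 else 0) * (if i < a then 1 else p) * adapted_row A j x) =
      (\<Sum>j<n. (if i = j then 1 else 0) * ((if i < a then 1 else p) * adapted_row A j x))"
    by (simp only: mult.assoc)
  also have "\<dots> = (if i < a then 1 else p) * adapted_row A i x"
    unfolding sum_lessThan_delta_mult(2) using i by simp
  finally show "adapted_row (row_scale a y * A) i x = (if i < a then 1 else p) * adapted_row A i x"
    using e(1) by simp
  have "(\<Sum>j<n. (if j < a then (if i < a then y i j else 0) else 0) * adapted_row A j x) =
      (\<Sum>j<n. if j < a then (if i < a then y i j * adapted_row A j x else 0) else 0)"
    by (intro sum.cong) auto
  also have "\<dots> = (if i < a then \<Sum>j<a. y i j * adapted_row A j x else 0)"
    using a by (simp add: sum_lessThan_if_less)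
  finally show "adapted_row (row_scale a y * A) (n + i) x =
      (if i < a then (\<Sum>j<a. y i j * adapted_row A j x) + p * adapted_row A (n + i) x else adapted_row A (n + i) x)"
    unfolding e(2) mult.assoc sum_lessThan_delta_mult using i by simp
qed

end

section \<open>The recursion for the measure\<close>

context valued_field
begin

definition residue_reps :: "'k set \<Rightarrow> bool" where
  "residue_reps R \<longleftrightarrow> R \<subseteq> \<O> \<and> finite R \<and> card R = q \<and> (\<forall>x\<in>\<O>. \<exists>r\<in>R. x - r \<in> \<P>)
     \<and> (\<forall>r\<in>R. \<forall>r'\<in>R. r - r' \<in> \<P> \<longrightarrow> r = r')"

lemma residue_repsD:
  assumes "residue_reps R"
  shows "R \<subseteq> \<O>" "finite R" "card R = q" "\<forall>x\<in>\<O>. \<exists>r\<in>R. x - r \<in> \<P>"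
    "r \<in> R \<Longrightarrow> r' \<in> R \<Longrightarrow> r - r' \<in> \<P> \<Longrightarrow> r = r'"
proof -
  note R = assms[unfolded residue_reps_def]
  note R2 = R[THEN conjunct2] and R3 = R[THEN conjunct2, THEN conjunct2, THEN conjunct2]
  show "R \<subseteq> \<O>" using R by (rule conjunct1)
  show "finite R" using R2 by (rule conjunct1)
  show "card R = q" using R2[THEN conjunct2] by (rule conjunct1)
  show "\<forall>x\<in>\<O>. \<exists>r\<in>R. x - r \<in> \<P>" using R3 by (rule conjunct1)
  show "r \<in> R \<Longrightarrow> r' \<in> R \<Longrightarrow> r - r' \<in> \<P> \<Longrightarrow> r = r'"
    by (rule R3[THEN conjunct2, rule_format])
qed

lemma residue_reps_exists: "\<exists>R. residue_reps R"
  unfolding residue_reps_def by (rule residue_reps_ex)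

end

context haar_gsp
begin

lemma levelI:
  assumes "sim A c" "v c = int m"
    and "\<And>i x. i < n \<Longrightarrow> x < N \<Longrightarrow> adapted_row A i x \<in> \<O>" "\<And>i x. i < n \<Longrightarrow> x < N \<Longrightarrow> adapted_row A (n + i) x \<in> \<O>"
    and "right_invertible N a (adapted_row A)"
    and "\<And>i x. a + u \<le> i \<Longrightarrow> i < n \<Longrightarrow> x < N \<Longrightarrow> adapted_row A i x \<in> \<P>"
  shows "A \<in> level m a u"
proof -
  have "adapted_row A i x \<in> \<O>" if "i < N" "x < N" for i x
  proof (cases "i < n")
    case False
    hence "adapted_row A (n + (i - n)) x \<in> \<O>" using that by (intro assms(4)) auto
    thus ?thesis using False by simp
  qed (use assms(3) that in auto)
  thus ?thesis unfolding level_def using assms(1,2,5,6) by simp blast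
qed

lemma levelD:
  assumes "A \<in> level m a u"
  shows "\<exists>c. sim A c \<and> v c = int m"
    and "i < n \<Longrightarrow> x < N \<Longrightarrow> adapted_row A i x \<in> \<O>" and "i < n \<Longrightarrow> x < N \<Longrightarrow> adapted_row A (n + i) x \<in> \<O>"
    and "right_invertible N a (adapted_row A)"
    and "a + u \<le> i \<Longrightarrow> i < n \<Longrightarrow> x < N \<Longrightarrow> adapted_row A i x \<in> \<P>"
  using assms unfolding level_def by auto

text \<open>The last row that is not yet known to vanish modulo the maximal ideal either depends on the
  first \<open>a\<close> rows modulo that ideal, with \<open>q ^ a\<close> possible relations, or it is independent of them.\<close>

lemma emeasure_level_Suc:
  assumes an: "a + Suc u \<le> n"
  shows "emeasure M (level m a (Suc u)) =
    emeasure M (level m (Suc a) u) + of_nat (q ^ a) * emeasure M (level m a u)"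
proof -
  obtain Rp where Rp: "residue_reps Rp" using residue_reps_exists by blast
  note Rp = residue_repsD[OF Rp]
  \<comment> \<open>The row to be decided, the last of the \<open>Suc u\<close> undecided
    ones.\<close>
  define z where "z = a + u"
  have az: "a \<le> z" "z < n" and a: "a < n" "a \<le> n" and zu: "a + u \<le> z" using an by (auto simp: z_def)
  define I where "I = {..<a} \<rightarrow>\<^sub>E Rp"
  have fin: "finite I" unfolding I_def using Rp(2) by (intro finite_PiE) auto
  have card: "card I = q ^ a" unfolding I_def using Rp(3) by (simp add: card_PiE)
  have IR: "c j \<in> Rp" "c j \<in> \<O>" if "c \<in> I" "j < a" for c j
    using that Rp(1) by (auto simp: I_def)
  define dep where "dep A c \<longleftrightarrow> (\<forall>x<N. adapted_row A z x - (\<Sum>j<a. c j * adapted_row A j x) \<in> \<P>)" for A c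
  define ind where "ind A \<longleftrightarrow> right_invertible N (Suc a) ((adapted_row A)(a := adapted_row A z))" for A
  have rows_O: "adapted_row A i x \<in> \<O>" "adapted_row A (n + i) x \<in> \<O>" if "A \<in> level m' a' u'" "i < n" "x < N" for A m' a' u' i x
    using levelD(2,3)[OF that(1)] that by auto

  have trans: "transvection a z c * A \<in> level m a (Suc u)" "dep (transvection a z c * A) c"
    if A: "A \<in> level m a u" and c: "c \<in> I" for A c
  proof -
    let ?B = "transvection a z c * A"
    note r = adapted_row_transvection[OF az level_carrier[OF A], of _ _ c]
    obtain d where d: "sim A d" "v d = int m" using levelD(1)[OF A] by blast
    have lt: "j < a \<Longrightarrow> j < n \<and> j \<noteq> z" for j using a az by simp
    show "?B \<in> level m a (Suc u)"
    proof (rule levelI)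
      show "sim ?B (1 * d)" by (rule sim_mult[OF sim_transvection[OF az] d(1)])
      show "v (1 * d) = int m" using d by simp
      show "adapted_row ?B i x \<in> \<O>" if "i < n" "x < N" for i x
        using r(1)[OF that] rows_O(1)[OF A _ that(2)] IR(2)[OF c] that lt by (auto intro!: O_add O_sum O_mult)
      show "adapted_row ?B (n + i) x \<in> \<O>" if "i < n" "x < N" for i x
        using r(2)[OF that] rows_O(2)[OF A _ that(2)] IR(2)[OF c] that az by (auto intro!: O_diff O_mult)
      show "right_invertible N a (adapted_row ?B)"
        using levelD(4)[OF A] r(1) lt by (subst right_invertible_cong[of a N _ "adapted_row A"]) auto
      show "adapted_row ?B i x \<in> \<P>" if "a + Suc u \<le> i" "i < n" "x < N" for i x
        using r(1)[OF that(2,3)] levelD(5)[OF A _ that(2,3)] that by (simp add: z_def)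
    qed
    show "dep ?B c" unfolding dep_def
    proof (intro allI impI)
      fix x assume x: "x < N"
      have "(\<Sum>j<a. c j * adapted_row ?B j x) = (\<Sum>j<a. c j * adapted_row A j x)"
        using r(1) x lt by (intro sum.cong) auto
      thus "adapted_row ?B z x - (\<Sum>j<a. c j * adapted_row ?B j x) \<in> \<P>"
        using r(1)[OF az(2) x] levelD(5)[OF A zu az(2) x] by simp
    qed
  qed

  \<comment> \<open>The independent row at position \<open>a\<close> is parked at position
    \<open>z\<close>, where \<open>ind\<close> remembers its independence; the row displaced from
    \<open>z\<close> remains undecided.\<close>
  have swap: "row_swap a z * A \<in> level m a (Suc u)" "ind (row_swap a z * A)"
    if A: "A \<in> level m (Suc a) u" for A
  proof -
    let ?B = "row_swap a z * A"
    note r = adapted_row_swap[OF a(1) az(2) level_carrier[OF A]]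
    obtain d where d: "sim A d" "v d = int m" using levelD(1)[OF A] by blast
    have sw: "swap_index a z i < n" if "i < n" for i using that a az by (simp add: swap_index_def)
    have lt: "swap_index a z j = j" if "j < a" for j using that az by (simp add: swap_index_def)
    show "?B \<in> level m a (Suc u)"
    proof (rule levelI)
      show "sim ?B (1 * d)" by (rule sim_mult[OF sim_row_swap[OF a(1) az(2)] d(1)])
      show "v (1 * d) = int m" using d by simp
      show "adapted_row ?B i x \<in> \<O>" "adapted_row ?B (n + i) x \<in> \<O>" if "i < n" "x < N" for i x
        using r[OF that] rows_O[OF A sw[OF that(1)] that(2)] by simp_all
      show "right_invertible N a (adapted_row ?B)"
        using right_invertible_mono[OF levelD(4)[OF A]] r(1) lt a
        by (subst right_invertible_cong[of a N _ "adapted_row A"]) auto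
      show "adapted_row ?B i x \<in> \<P>" if "a + Suc u \<le> i" "i < n" "x < N" for i x
      proof -
        have "swap_index a z i = i" using that by (simp add: swap_index_def z_def)
        thus ?thesis using r(1)[OF that(2,3)] levelD(5)[OF A _ that(2,3)] that by simp
      qed
    qed
    have "swap_index a z z = a" by (simp add: swap_index_def)
    hence "((adapted_row ?B)(a := adapted_row ?B z)) i x = adapted_row A i x" if "i < Suc a" "x < N" for i x
      using that r(1)[of i x] r(1)[of z x] lt[of i] a az by auto
    thus "ind ?B" unfolding ind_def
      using levelD(4)[OF A] by (subst right_invertible_cong[of "Suc a" N _ "adapted_row A"]) auto
  qed

  have cover: "(\<exists>c\<in>I. \<exists>B\<in>level m a u. A = transvection a z c * B) \<or>
      (\<exists>B\<in>level m (Suc a) u. A = row_swap a z * B)" if A: "A \<in> level m a (Suc u)" for A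
  proof -
    obtain d where d: "sim A d" "v d = int m" using levelD(1)[OF A] by blast
    have lt: "j < a \<Longrightarrow> j < n \<and> j \<noteq> z" for j using a az by simp
    have "(\<exists>c. (\<forall>j<a. c j \<in> \<O>) \<and> (\<forall>x<N. adapted_row A z x - (\<Sum>j<a. c j * adapted_row A j x) \<in> \<P>)) \<or> ind A"
      unfolding ind_def
      by (rule dependent_or_right_invertible[OF levelD(4)[OF A]]) (use rows_O[OF A] az a in auto)
    thus ?thesis
    proof (elim disjE exE conjE)
      fix c' assume c': "\<forall>j<a. c' j \<in> \<O>" "\<forall>x<N. adapted_row A z x - (\<Sum>j<a. c' j * adapted_row A j x) \<in> \<P>"
      \<comment> \<open>The relation matters only modulo \<open>\<P>\<close>, so its coefficients
        may be replaced by residue representatives; the error made is absorbed in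
        \<open>\<P>\<close>.\<close>
      obtain c where c: "c \<in> I" "\<forall>j\<in>{..<a}. c' j - c j \<in> \<P>"
        using reps_family_ex[OF Rp(1,4), of "{..<a}" c'] c'(1) unfolding I_def by auto
      obtain B where B: "sim B (inverse 1 * d)" "A = transvection a z c * B"
        using sim_preimage[OF d(1) sim_transvection[OF az]] by blast
      note r = adapted_row_transvection[OF az sim_carrier[OF B(1)], of _ _ c, folded B(2)]
      have rB: "adapted_row B i x = adapted_row A i x" if "i < n" "i \<noteq> z" "x < N" for i x
        using r(1)[OF that(1,3)] that by simp
      have rBz: "adapted_row B z x \<in> \<P>" if x: "x < N" for x
      proof -
        have "adapted_row B z x = adapted_row A z x - (\<Sum>j<a. c j * adapted_row B j x)" using r(1)[OF az(2) x] by simp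
        also have "(\<Sum>j<a. c j * adapted_row B j x) = (\<Sum>j<a. c j * adapted_row A j x)"
          using rB lt x by (intro sum.cong) auto
        also have "adapted_row A z x - (\<Sum>j<a. c j * adapted_row A j x) =
            (adapted_row A z x - (\<Sum>j<a. c' j * adapted_row A j x)) + (\<Sum>j<a. (c' j - c j) * adapted_row A j x)"
          by (simp add: left_diff_distrib sum_subtractf)
        also have "\<dots> \<in> \<P>"
          using c'(2) c(2) x rows_O(1)[OF A _ x] lt by (intro P_add P_sum P_mult') auto
        finally show ?thesis .
      qed
      have rBn: "adapted_row B (n + i) x = adapted_row A (n + i) x + (if i < a then c i * adapted_row A (n + z) x else 0)"
        if "i < n" "x < N" for i x
        using r(2)[OF that] r(2)[OF az(2) that(2)] az by simp
      have "B \<in> level m a u"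
      proof (rule levelI[OF B(1)])
        show "v (inverse 1 * d) = int m" using d by simp
        show "adapted_row B i x \<in> \<O>" if "i < n" "x < N" for i x
          using rB[of i x] rBz[THEN P_subset_O] rows_O(1)[OF A that] that by (cases "i = z") auto
        show "adapted_row B (n + i) x \<in> \<O>" if "i < n" "x < N" for i x
          unfolding rBn[OF that] using rows_O(2)[OF A] IR(2)[OF c(1)] that az by (auto intro!: O_add O_mult)
        show "right_invertible N a (adapted_row B)"
          using levelD(4)[OF A] rB lt by (subst right_invertible_cong[of a N _ "adapted_row A"]) auto
        show "adapted_row B i x \<in> \<P>" if "a + u \<le> i" "i < n" "x < N" for i x
          using rB[of i x] rBz levelD(5)[OF A _ that(2,3)] that by (cases "i = z") (auto simp: z_def)
      qed
      thus ?thesis using B(2) c(1) by blast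
    next
      assume ind: "ind A"
      obtain B where B: "sim B (inverse 1 * d)" "A = row_swap a z * B"
        using sim_preimage[OF d(1) sim_row_swap[OF a(1) az(2)]] by blast
      note r = adapted_row_swap[OF a(1) az(2) sim_carrier[OF B(1)], folded B(2)]
      have sw: "swap_index a z i < n" "swap_index a z (swap_index a z i) = i" if "i < n" for i
        using that a az by (auto simp: swap_index_def)
      have rB: "adapted_row B i x = adapted_row A (swap_index a z i) x" "adapted_row B (n + i) x = adapted_row A (n + swap_index a z i) x"
        if "i < n" "x < N" for i x
        using r[OF sw(1)[OF that(1)] that(2)] sw(2)[OF that(1)] by simp_all
      have "B \<in> level m (Suc a) u"
      proof (rule levelI[OF B(1)])
        show "v (inverse 1 * d) = int m" using d by simp
        show "adapted_row B i x \<in> \<O>" "adapted_row B (n + i) x \<in> \<O>" if "i < n" "x < N" for i x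
          using rB[OF that] rows_O[OF A sw(1)[OF that(1)] that(2)] by simp_all
        have "adapted_row B i x = ((adapted_row A)(a := adapted_row A z)) i x" if "i < Suc a" "x < N" for i x
          using that rB(1)[of i x] a az by (auto simp: swap_index_def)
        thus "right_invertible N (Suc a) (adapted_row B)"
          using ind unfolding ind_def by (subst right_invertible_cong) auto
        show "adapted_row B i x \<in> \<P>" if "Suc a + u \<le> i" "i < n" "x < N" for i x
          using rB(1)[OF that(2,3)] levelD(5)[OF A _ that(2,3)] that by (simp add: swap_index_def z_def)
      qed
      thus ?thesis using B(2) by blast
    qed
  qed

  have not_both: False if A: "A \<in> level m a (Suc u)" and "ind A" "dep A c" and c: "\<And>j. j < a \<Longrightarrow> c j \<in> \<O>" for A c
  proof -
    \<comment> \<open>Together the two alternatives yield a relation among independent rows whose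
      coefficient at the new row is 1, which is not in \<open>\<P>\<close>.\<close>
    define e where "e j = (if j = a then 1 else - c j)" for j
    have "e a \<in> \<P>"
    proof (rule right_invertible_independent[OF \<open>ind A\<close>[unfolded ind_def]])
      show "e j \<in> \<O>" if "j < Suc a" for j using c that by (auto simp: e_def less_Suc_eq)
      fix x assume x: "x < N"
      have "(\<Sum>j<Suc a. e j * ((adapted_row A)(a := adapted_row A z)) j x) = adapted_row A z x - (\<Sum>j<a. c j * adapted_row A j x)"
        by (simp add: e_def sum_negf)
      thus "(\<Sum>j<Suc a. e j * ((adapted_row A)(a := adapted_row A z)) j x) \<in> \<P>" using \<open>dep A c\<close> x by (simp add: dep_def)
    qed simp
    thus False by (simp add: e_def)
  qed

  have dep_unique: "c = c'" if A: "A \<in> level m a (Suc u)" and "dep A c" "dep A c'" and c: "c \<in> I" "c' \<in> I" for A c c'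
  proof (rule PiE_ext)
    show "c \<in> {..<a} \<rightarrow>\<^sub>E Rp" "c' \<in> {..<a} \<rightarrow>\<^sub>E Rp" using c by (auto simp: I_def)
    fix k assume k: "k \<in> {..<a}"
    have diff: "c k - c' k \<in> \<P>"
    proof (rule right_invertible_independent[OF levelD(4)[OF A], where d = "\<lambda>j. c j - c' j"])
      show "c j - c' j \<in> \<O>" if "j < a" for j using IR(2) c that by auto
      fix x assume x: "x < N"
      have "(\<Sum>j<a. (c j - c' j) * adapted_row A j x) =
          (adapted_row A z x - (\<Sum>j<a. c' j * adapted_row A j x)) - (adapted_row A z x - (\<Sum>j<a. c j * adapted_row A j x))"
        by (simp add: left_diff_distrib sum_subtractf)
      also have "\<dots> \<in> \<P>" using \<open>dep A c\<close> \<open>dep A c'\<close> x by (intro P_diff[of "_ - _" "_ - _"]) (auto simp: dep_def)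
      finally show "(\<Sum>j<a. (c j - c' j) * adapted_row A j x) \<in> \<P>" .
    qed (use k in simp)
    show "c k = c' k" by (rule Rp(5)[OF _ _ diff]; rule IR(1)) (use c k in simp_all)
  qed

  let ?D = "\<Union>c\<in>I. (\<lambda>A. transvection a z c * A) ` level m a u"
  let ?E = "(\<lambda>A. row_swap a z * A) ` level m (Suc a) u"
  have eq: "level m a (Suc u) = ?E \<union> ?D"
  proof (intro equalityI subsetI)
    fix A assume "A \<in> level m a (Suc u)"
    from cover[OF this] show "A \<in> ?E \<union> ?D" by (elim disjE bexE) auto
  next
    fix A assume "A \<in> ?E \<union> ?D"
    thus "A \<in> level m a (Suc u)"
      by (elim UnE UN_E imageE) (simp_all only: trans(1) swap(1))
  qed
  have disj: "?E \<inter> ?D = {}"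
  proof (rule equals0I)
    fix A assume "A \<in> ?E \<inter> ?D"
    then obtain B c B' where B: "B \<in> level m (Suc a) u" "A = row_swap a z * B"
      and c: "c \<in> I" "B' \<in> level m a u" "A = transvection a z c * B'" by (elim IntE UN_E imageE)
    have A: "A \<in> level m a (Suc u)" "ind A" "dep A c"
      using trans(2)[OF c(2,1)] c(3) swap[OF B(1)] B(2) by simp_all
    show False by (rule not_both[OF A IR(2)[OF c(1)]])
  qed
  have tv: "sim (transvection a z c) 1" for c by (rule sim_transvection[OF az])
  note RI = level_right_invariant[OF a(2), of m u]
  have RI': "right_invariant (level m (Suc a) u)" by (rule level_right_invariant) (use a in simp)
  have uniq: "c = c'" if "c \<in> I" "c' \<in> I" "A \<in> level m a u" "B \<in> level m a u"
    "transvection a z c * A = transvection a z c' * B" for c c' A B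
    using dep_unique[OF trans(1)[OF that(3,1)] trans(2)[OF that(3,1)] _ that(1,2)] trans(2)[OF that(4,2)] that(5)
    by simp
  note D = emeasure_disjoint_translates[OF RI fin tv uniq]
  note E = right_invariant_translate[OF RI' sim_row_swap[OF a(1) az(2)]]
  have "emeasure M (level m a (Suc u)) = emeasure M ?E + emeasure M ?D"
    unfolding eq by (rule plus_emeasure[symmetric, OF right_invariant_sets[OF E(1)] D(1) disj])
  thus ?thesis by (simp only: D(2) E(2) card)
qed

lemma P_iff_multiple: "x \<in> \<P> \<longleftrightarrow> inverse p * x \<in> \<O>"
  using p v_mult[of "inverse p" x] v_inverse[of p] by (cases "x = 0") (auto simp: max_ideal_def ring_of_integers_def)

lemma p_in_P: "p \<in> \<P>"
  using p by (simp add: max_ideal_def)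

text \<open>At \<open>u = 0\<close> the rows \<open>r\<^sub>i\<close> (\<open>i \<ge> a\<close>) are
  divisible by \<open>p\<close>, and a symmetric correction makes \<open>s\<^sub>i\<close>
  (\<open>i < a\<close>) divisible too. After the division the \<open>a\<close> independent rows are
  intact and the other rows are arbitrary, so the elimination restarts at
  \<open>u = n - a\<close>.\<close>

lemma emeasure_level_scale:
  assumes a: "a \<le> n"
  shows "emeasure M (level (Suc m) a 0) = of_nat (q ^ (a * (a + 1) div 2)) * emeasure M (level m a (n - a))"
proof -
  obtain Rp where Rp: "residue_reps Rp" using residue_reps_exists by blast
  note Rp = residue_repsD[OF Rp]
  define Pr where "Pr = {(i, j). i \<le> j \<and> j < a}"
  define I where "I = Pr \<rightarrow>\<^sub>E Rp"
  define y where "y c i j = c (min i j, max i j)" for c :: "nat \<times> nat \<Rightarrow> 'k" and i j :: nat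
  have fPr: "finite Pr" and cPr: "card Pr = a * (a + 1) div 2"
    unfolding Pr_def by (rule finite_upper_pairs, rule card_upper_pairs)
  have fin: "finite I" unfolding I_def using Rp(2) fPr by (intro finite_PiE) auto
  have card: "card I = q ^ (a * (a + 1) div 2)"
    unfolding I_def using Rp(3) fPr cPr by (simp add: card_PiE)
  have y_sym: "y c i j = y c j i" for c i j by (simp add: y_def min.commute max.commute)
  have y_R: "y c i j \<in> Rp" "y c i j \<in> \<O>" if "c \<in> I" "i < a" "j < a" for c i j
  proof -
    have "(min i j, max i j) \<in> Pr" using that by (auto simp: Pr_def)
    thus "y c i j \<in> Rp" using that(1) by (auto simp: I_def y_def)
    thus "y c i j \<in> \<O>" using Rp(1) by auto
  qed
  have scale: "sim (row_scale a (y c)) p" for c by (rule sim_row_scale) (rule y_sym)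
  define dep where "dep A c \<longleftrightarrow> (\<forall>i<a. \<forall>x<N. adapted_row A (n + i) x - (\<Sum>j<a. y c i j * adapted_row A j x) \<in> \<P>)" for A c
  let ?U = "level m a (n - a)"
  have rows_O: "adapted_row A i x \<in> \<O>" "adapted_row A (n + i) x \<in> \<O>" if "A \<in> level m' a' u'" "i < n" "x < N" for A m' a' u' i x
    using levelD(2,3)[OF that(1)] that by auto

  have sub: "row_scale a (y c) * A \<in> level (Suc m) a 0" "dep (row_scale a (y c) * A) c"
    if A: "A \<in> ?U" and c: "c \<in> I" for A c
  proof -
    let ?B = "row_scale a (y c) * A"
    have r: "adapted_row ?B i x = (if i < a then 1 else p) * adapted_row A i x"
      "adapted_row ?B (n + i) x = (if i < a then (\<Sum>j<a. y c i j * adapted_row A j x) + p * adapted_row A (n + i) x else adapted_row A (n + i) x)"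
      if "i < n" "x < N" for i x
      using adapted_row_scale[where y = "y c", OF y_sym a level_carrier[OF A] that] by simp_all
    obtain d where d: "sim A d" "v d = int m" using levelD(1)[OF A] by blast
    have pO: "p \<in> \<O>" using p_in_P by (rule P_subset_O)
    show "?B \<in> level (Suc m) a 0"
    proof (rule levelI)
      show "sim ?B (p * d)" by (rule sim_mult[OF scale d(1)])
      show "v (p * d) = int (Suc m)" using d p v_mult[of p d] by (auto simp: sim_def)
      show "adapted_row ?B i x \<in> \<O>" if "i < n" "x < N" for i x
        using r(1)[OF that] rows_O(1)[OF A that] pO by (auto intro!: O_mult)
      show "adapted_row ?B (n + i) x \<in> \<O>" if "i < n" "x < N" for i x
        using r(2)[OF that] rows_O[OF A _ that(2)] pO y_R(2)[OF c] that a
        by (auto intro!: O_add O_sum O_mult)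
      show "right_invertible N a (adapted_row ?B)"
        using levelD(4)[OF A] r(1) a by (subst right_invertible_cong[of a N _ "adapted_row A"]) auto
      show "adapted_row ?B i x \<in> \<P>" if "a + 0 \<le> i" "i < n" "x < N" for i x
        using r(1)[OF that(2,3)] that P_mult'[OF p_in_P rows_O(1)[OF A that(2,3)]] by simp
    qed
    show "dep ?B c" unfolding dep_def
    proof (intro allI impI)
      fix i x assume ix: "i < a" "x < N"
      have "(\<Sum>j<a. y c i j * adapted_row ?B j x) = (\<Sum>j<a. y c i j * adapted_row A j x)"
        using r(1) ix a by (intro sum.cong) auto
      moreover have "p * adapted_row A (n + i) x \<in> \<P>"
        by (rule P_mult'[OF p_in_P]) (use rows_O(2)[OF A] ix a in auto)
      ultimately show "adapted_row ?B (n + i) x - (\<Sum>j<a. y c i j * adapted_row ?B j x) \<in> \<P>"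
        using r(2)[of i x] ix a by simp
    qed
  qed

  text \<open>Modulo the maximal ideal the relation of rows and columns of a similitude reads
    \<open>\<Sum>i<a. r i \<and> s i = 0\<close>, so Cartan's lemma yields \<open>s i = (\<Sum>j<a. y i j * r j)\<close> with \<open>y\<close> symmetric.\<close>

  have cartan: "\<exists>c\<in>I. dep A c" if A: "A \<in> level (Suc m) a 0" for A
  proof -
    obtain d where d: "sim A d" "v d = int (Suc m)" using levelD(1)[OF A] by blast
    \<comment> \<open>Positive valuation of the factor makes the right side of the wedge relation
      vanish modulo \<open>\<P>\<close>.\<close>
    have dP: "d \<in> \<P>" using d by (simp add: max_ideal_def)
    obtain R where R: "\<And>l j. l < N \<Longrightarrow> j < a \<Longrightarrow> R l j \<in> \<O>"
      "\<And>i j. i < a \<Longrightarrow> j < a \<Longrightarrow> (\<Sum>l<N. adapted_row A i l * R l j) = (if i = j then 1 else 0)"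
      using levelD(4)[OF A] unfolding right_invertible_def by blast
    have lt: "i < a \<Longrightarrow> i < n" for i using a by simp
    define w where "w x z = (\<Sum>i<a. adapted_row A i x * adapted_row A (n + i) z - adapted_row A (n + i) x * adapted_row A i z)" for x z
    have w: "w x z \<in> \<P>" if xz: "x < N" "z < N" for x z
    proof -
      let ?f = "\<lambda>i. adapted_row A i x * adapted_row A (n + i) z - adapted_row A (n + i) x * adapted_row A i z"
      have "sum ?f {..<a} + sum ?f {a..<n} = sum ?f {..<n}"
        unfolding lessThan_atLeast0 by (rule sum.atLeastLessThan_concat) (use a in auto)
      hence eq: "w x z = d * J $$ (x, z) - sum ?f {a..<n}"
        unfolding adapted_row_gram[OF d(1) xz] w_def by (simp add: eq_diff_eq)
      have "sum ?f {a..<n} \<in> \<P>"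
      proof (intro P_sum P_diff)
        fix i assume i: "i \<in> {a..<n}"
        have "adapted_row A i x \<in> \<P>" "adapted_row A i z \<in> \<P>" by (rule levelD(5)[OF A]; use i xz in simp)+
        moreover have "adapted_row A (n + i) x \<in> \<O>" "adapted_row A (n + i) z \<in> \<O>"
          by (rule rows_O(2)[OF A]; use i xz in simp)+
        ultimately show "adapted_row A i x * adapted_row A (n + i) z \<in> \<P>" "adapted_row A (n + i) x * adapted_row A i z \<in> \<P>"
          by (simp_all add: P_mult P_mult')
      qed
      moreover have "d * J $$ (x, z) \<in> \<P>" by (rule P_mult'[OF dP J(4)[OF xz]])
      ultimately show ?thesis unfolding eq by (intro P_diff[of "_ * _"])
    qed
    \<comment> \<open>Contracting the relation \<open>w\<close> with column \<open>k\<close> of the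
      right inverse solves it for \<open>s\<^sub>k\<close>; these pairings are the resulting
      coefficients.\<close>
    define Y where "Y k i = (\<Sum>x<N. adapted_row A (n + i) x * R x k)" for k i
    have YO: "Y k i \<in> \<O>" if "k < a" "i < a" for k i
      unfolding Y_def using rows_O(2)[OF A] R(1) lt that by (intro O_sum O_mult) auto
    have Y: "adapted_row A (n + k) z - (\<Sum>i<a. Y k i * adapted_row A i z) \<in> \<P>" if k: "k < a" and z: "z < N" for k z
    proof -
      have "(\<Sum>x<N. R x k * w x z) = (\<Sum>i<a. \<Sum>x<N. R x k * (adapted_row A i x * adapted_row A (n + i) z - adapted_row A (n + i) x * adapted_row A i z))"
        unfolding w_def sum_distrib_left by (rule sum.swap)
      also have "\<dots> = (\<Sum>i<a. (\<Sum>x<N. adapted_row A i x * R x k) * adapted_row A (n + i) z - Y k i * adapted_row A i z)"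
        unfolding Y_def sum_distrib_right sum_subtractf[symmetric]
        by (intro sum.cong refl) (simp add: algebra_simps)
      also have "\<dots> = (\<Sum>i<a. (if i = k then 1 else 0) * adapted_row A (n + i) z - Y k i * adapted_row A i z)"
        using R(2) k by (intro sum.cong refl) auto
      also have "\<dots> = adapted_row A (n + k) z - (\<Sum>i<a. Y k i * adapted_row A i z)"
        unfolding sum_subtractf sum_lessThan_delta_mult using k by simp
      finally have "adapted_row A (n + k) z - (\<Sum>i<a. Y k i * adapted_row A i z) = (\<Sum>x<N. R x k * w x z)" ..
      also have "\<dots> \<in> \<P>" by (intro P_sum P_mult R(1) w) (use k z in simp_all)
      finally show ?thesis .
    qed
    \<comment> \<open>Pairing the formula for row \<open>n + k\<close> with column \<open>l\<close>
      of the right inverse compares \<open>Y l k\<close>, by definition, with \<open>Y k l\<close>,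
      by \<open>R\<close> being a right inverse.\<close>
    have Y_sym: "Y l k - Y k l \<in> \<P>" if kl: "k < a" "l < a" for k l
    proof -
      have "(\<Sum>z<N. (adapted_row A (n + k) z - (\<Sum>i<a. Y k i * adapted_row A i z)) * R z l) =
          Y l k - (\<Sum>z<N. \<Sum>i<a. Y k i * (adapted_row A i z * R z l))"
        unfolding Y_def by (simp only: left_diff_distrib sum_subtractf sum_distrib_right mult.assoc)
      also have "(\<Sum>z<N. \<Sum>i<a. Y k i * (adapted_row A i z * R z l)) = (\<Sum>i<a. Y k i * (\<Sum>z<N. adapted_row A i z * R z l))"
        unfolding sum_distrib_left by (rule sum.swap)
      also have "\<dots> = (\<Sum>i<a. Y k i * (if i = l then 1 else 0))"
        using R(2) kl by (intro sum.cong refl) auto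
      also have "\<dots> = Y k l" using kl by (simp add: sum_lessThan_delta_mult)
      finally have "Y l k - Y k l = (\<Sum>z<N. (adapted_row A (n + k) z - (\<Sum>i<a. Y k i * adapted_row A i z)) * R z l)" ..
      also have "\<dots> \<in> \<P>" by (intro P_sum P_mult'[of "_ - _"] R(1) Y) (use kl in simp_all)
      finally show ?thesis .
    qed
    have "\<exists>c\<in>Pr \<rightarrow>\<^sub>E Rp. \<forall>ij\<in>Pr. (case ij of (i, j) \<Rightarrow> Y i j) - c ij \<in> \<P>"
      by (rule reps_family_ex[OF Rp(1,4)]) (auto simp: Pr_def intro: YO)
    then obtain c where c: "c \<in> I" "\<And>i j. (i, j) \<in> Pr \<Longrightarrow> Y i j - c (i, j) \<in> \<P>"
      unfolding I_def by fast
    have Yc: "Y i j - y c i j \<in> \<P>" if ij: "i < a" "j < a" for i j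
    proof (cases "i \<le> j")
      case True
      thus ?thesis using c(2)[of i j] ij by (simp add: y_def Pr_def min_absorb1 max_absorb2)
    next
      case False
      hence "(Y i j - Y j i) + (Y j i - c (j, i)) \<in> \<P>"
        using c(2)[of j i] ij by (intro P_add Y_sym) (auto simp: Pr_def)
      thus ?thesis using False by (simp add: y_def)
    qed
    have "dep A c" unfolding dep_def
    proof (intro allI impI)
      fix i x assume ix: "i < a" "x < N"
      have "adapted_row A (n + i) x - (\<Sum>j<a. y c i j * adapted_row A j x) =
          (adapted_row A (n + i) x - (\<Sum>j<a. Y i j * adapted_row A j x)) + (\<Sum>j<a. (Y i j - y c i j) * adapted_row A j x)"
        by (simp add: left_diff_distrib sum_subtractf)
      also have "\<dots> \<in> \<P>"
        by (intro P_add Y[OF ix] P_sum P_mult') (use Yc rows_O(1)[OF A] ix lt in auto)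
      finally show "adapted_row A (n + i) x - (\<Sum>j<a. y c i j * adapted_row A j x) \<in> \<P>" .
    qed
    thus ?thesis using c(1) by blast
  qed

  have cover: "\<exists>c\<in>I. \<exists>B\<in>?U. A = row_scale a (y c) * B" if A: "A \<in> level (Suc m) a 0" for A
  proof -
    obtain c where c: "c \<in> I" "dep A c" using cartan[OF A] by blast
    obtain d where d: "sim A d" "v d = int (Suc m)" using levelD(1)[OF A] by blast
    obtain B where B: "sim B (inverse p * d)" "A = row_scale a (y c) * B"
      using sim_preimage[OF d(1) scale] by blast
    have r: "adapted_row A i x = (if i < a then 1 else p) * adapted_row B i x"
      "adapted_row A (n + i) x = (if i < a then (\<Sum>j<a. y c i j * adapted_row B j x) + p * adapted_row B (n + i) x else adapted_row B (n + i) x)"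
      if "i < n" "x < N" for i x
      using adapted_row_scale[where y = "y c", OF y_sym a sim_carrier[OF B(1)] that] B(2) by simp_all
    have rB: "adapted_row B i x = (if i < a then adapted_row A i x else inverse p * adapted_row A i x)" if "i < n" "x < N" for i x
      using r(1)[OF that] p(1) by simp
    have rBn: "adapted_row B (n + i) x = (if i < a then inverse p * (adapted_row A (n + i) x - (\<Sum>j<a. y c i j * adapted_row A j x))
        else adapted_row A (n + i) x)" if ix: "i < n" "x < N" for i x
    proof -
      have "(\<Sum>j<a. y c i j * adapted_row B j x) = (\<Sum>j<a. y c i j * adapted_row A j x)"
        using rB ix a by (intro sum.cong) auto
      thus ?thesis using r(2)[OF ix] p(1) by simp
    qed
    have "B \<in> ?U"
    proof (rule levelI[OF B(1)])
      show "v (inverse p * d) = int m" using d p v_mult[of "inverse p" d] v_inverse[of p] by (auto simp: sim_def)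
      show "adapted_row B i x \<in> \<O>" if "i < n" "x < N" for i x
        using rB[OF that] rows_O(1)[OF A that] levelD(5)[OF A _ that] P_iff_multiple by auto
      show "adapted_row B (n + i) x \<in> \<O>" if "i < n" "x < N" for i x
        using rBn[OF that] rows_O(2)[OF A that] c(2) that P_iff_multiple by (auto simp: dep_def)
      show "right_invertible N a (adapted_row B)"
        using levelD(4)[OF A] rB a by (subst right_invertible_cong[of a N _ "adapted_row A"]) auto
      show "adapted_row B i x \<in> \<P>" if "a + (n - a) \<le> i" "i < n" "x < N" for i x
        using that a by simp
    qed
    thus ?thesis using B(2) c(1) by blast
  qed

  have dep_unique: "c = c'" if A: "A \<in> level (Suc m) a 0" and "dep A c" "dep A c'" and c: "c \<in> I" "c' \<in> I" for A c c'
  proof (rule PiE_ext)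
    show "c \<in> Pr \<rightarrow>\<^sub>E Rp" "c' \<in> Pr \<rightarrow>\<^sub>E Rp" using c by (auto simp: I_def)
    fix ij assume "ij \<in> Pr"
    then obtain i k where ij: "ij = (i, k)" "i \<le> k" "k < a" by (auto simp: Pr_def)
    hence ia: "i < a" by simp
    have diff: "y c i k - y c' i k \<in> \<P>"
    proof (rule right_invertible_independent[OF levelD(4)[OF A], where d = "\<lambda>j. y c i j - y c' i j"])
      show "y c i j - y c' i j \<in> \<O>" if "j < a" for j using y_R(2) c ia that by auto
      fix x assume x: "x < N"
      have "(\<Sum>j<a. (y c i j - y c' i j) * adapted_row A j x) =
          (adapted_row A (n + i) x - (\<Sum>j<a. y c' i j * adapted_row A j x)) - (adapted_row A (n + i) x - (\<Sum>j<a. y c i j * adapted_row A j x))"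
        by (simp add: left_diff_distrib sum_subtractf)
      also have "\<dots> \<in> \<P>" using \<open>dep A c\<close> \<open>dep A c'\<close> x ia by (intro P_diff[of "_ - _" "_ - _"]) (auto simp: dep_def)
      finally show "(\<Sum>j<a. (y c i j - y c' i j) * adapted_row A j x) \<in> \<P>" .
    qed (rule ij(3))
    have "y c i k = y c' i k"
      by (rule Rp(5)[OF y_R(1)[OF c(1) ia ij(3)] y_R(1)[OF c(2) ia ij(3)] diff])
    thus "c ij = c' ij" using ij by (simp add: y_def)
  qed

  have eq: "level (Suc m) a 0 = (\<Union>c\<in>I. (\<lambda>A. row_scale a (y c) * A) ` ?U)"
  proof (intro equalityI subsetI)
    fix A assume "A \<in> level (Suc m) a 0"
    from cover[OF this] show "A \<in> (\<Union>c\<in>I. (\<lambda>A. row_scale a (y c) * A) ` ?U)" by (elim bexE) auto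
  next
    fix A assume "A \<in> (\<Union>c\<in>I. (\<lambda>A. row_scale a (y c) * A) ` ?U)"
    thus "A \<in> level (Suc m) a 0" by (elim UN_E imageE) (simp only: sub(1))
  qed
  have uniq: "c = c'" if "c \<in> I" "c' \<in> I" "A \<in> ?U" "B \<in> ?U"
    "row_scale a (y c) * A = row_scale a (y c') * B" for c c' A B
    using dep_unique[OF sub(1)[OF that(3,1)] sub(2)[OF that(3,1)] _ that(1,2)] sub(2)[OF that(4,2)] that(5)
    by simp
  show ?thesis unfolding eq
    using emeasure_disjoint_translates(2)[OF level_right_invariant[OF a] fin scale uniq] card by simp
qed

lemma intmat_iff_adapted_row:
  assumes A: "A \<in> carrier_mat N N"
  shows "intmat N A \<longleftrightarrow> (\<forall>i<N. \<forall>x<N. adapted_row A i x \<in> \<O>)"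
proof -
  have KA: "K * A \<in> carrier_mat N N" using K A by simp
  have "L * (K * A) = A" using K(1) L(1) A LK
    by (simp add: assoc_mult_mat[of _ N N _ N _ N, symmetric])
  hence "intmat N A \<longleftrightarrow> intmat N (K * A)"
    using intmat_mult[OF K(1) A K(2)] intmat_mult[OF L(1) KA L(2)] by auto
  thus ?thesis by (simp add: intmat_def adapted_row_def)
qed

lemma level_full: "level m 0 n = {A \<in> GSp_plus v n J. \<exists>c. sim A c \<and> v c = int m}"
  unfolding level_def GSp_plus_def
  using intmat_iff_adapted_row[OF sim_carrier] by (auto simp: GSp_iff integral_mat_def intmat_def)

text \<open>A unit similitude factor makes \<open>A\<close> invertible over the ring of integers, so
  none of its adapted rows vanishes modulo \<open>\<P>\<close>. At \<open>u = 0\<close> this leaves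
  only \<open>a = n\<close>.\<close>

lemma level_0:
  assumes a: "a \<le> n"
  shows "level 0 a 0 = (if a = n then GSp_o v q n J else {})"
proof -
  have o: "A \<in> GSp_o v q n J" if A: "A \<in> level 0 b w" for A b w
    using that intmat_iff_adapted_row[OF level_carrier[OF A]] by (auto simp: level_def GSp_o_iff)
  have inv: "\<exists>R. (\<forall>l<N. \<forall>j<N. R l j \<in> \<O>) \<and> (\<forall>i<N. \<forall>j<N. (\<Sum>l<N. adapted_row A i l * R l j) = (if i = j then 1 else 0))"
    if A: "A \<in> GSp_o v q n J" for A
  proof -
    obtain h where h: "h \<in> carrier_mat N N" "intmat N h" "A * h = 1\<^sub>m N" using GSp_o_inverse[OF A] by blast
    have Ac: "A \<in> carrier_mat N N" using A sim_carrier by (auto simp: GSp_o_iff)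
    have KA: "K * A \<in> carrier_mat N N" and hL: "h * L \<in> carrier_mat N N" using K L h Ac by auto
    have "(K * A) * (h * L) = K * ((A * h) * L)"
      using K(1) L(1) h(1) Ac by (simp add: assoc_mult_mat[of _ N N _ N _ N])
    hence "(K * A) * (h * L) = 1\<^sub>m N" using h(3) L(1) KL by simp
    moreover have "intmat N (h * L)" by (rule intmat_mult[OF h(1) L(1) h(2) L(2)])
    ultimately show ?thesis
      using mult_mat_entry[OF KA hL] unfolding adapted_row_def intmat_def
      by (intro exI[of _ "\<lambda>l j. (h * L) $$ (l, j)"]) (auto simp del: index_mult_mat)
  qed
  show ?thesis
  proof (cases "a = n")
    case True
    have "A \<in> level 0 n 0" if A: "A \<in> GSp_o v q n J" for A
    proof -
      obtain c where c: "sim A c" "v c = 0" "intmat N A" using A by (auto simp: GSp_o_iff)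
      have "right_invertible N n (adapted_row A)"
        using inv[OF A] unfolding right_invertible_def by (elim ex_forward) auto
      thus ?thesis using c intmat_iff_adapted_row[OF sim_carrier[OF c(1)]] by (auto simp: level_def)
    qed
    thus ?thesis using o True by auto
  next
    case False
    have "A \<notin> level 0 a 0" for A
    proof
      assume A: "A \<in> level 0 a 0"
      obtain R where R: "\<And>l j. l < N \<Longrightarrow> j < N \<Longrightarrow> R l j \<in> \<O>"
        "\<And>i j. i < N \<Longrightarrow> j < N \<Longrightarrow> (\<Sum>l<N. adapted_row A i l * R l j) = (if i = j then 1 else 0)"
        using inv[OF o[OF A]] by blast
      have an: "a < n" using a False by simp
      have "(\<Sum>l<N. adapted_row A a l * R l a) \<in> \<P>"
        using levelD(5)[OF A] R(1) an by (intro P_sum P_mult') auto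
      thus False using R(2)[of a a] an by simp
    qed
    thus ?thesis using False by auto
  qed
qed

end

section \<open>Weights of consecutive columns\<close>

text \<open>Differs from the usual q-factorial by the factor \<open>(q - 1) ^ n\<close>, which
  cancels in \<open>qbinom\<close>.\<close>

definition qfact :: "'a::field \<Rightarrow> nat \<Rightarrow> 'a" where
  "qfact q n = (\<Prod>i=1..n. q ^ i - 1)"

definition qbinom :: "'a::field \<Rightarrow> nat \<Rightarrow> nat \<Rightarrow> 'a" where
  "qbinom q n k = (if k \<le> n then qfact q n / (qfact q k * qfact q (n - k)) else 0)"

lemma qfact_0 [simp]: "qfact q 0 = 1" and qfact_Suc: "qfact q (Suc n) = (q ^ Suc n - 1) * qfact q n"
  by (simp_all add: qfact_def mult.commute)

definition tri :: "nat \<Rightarrow> nat" where "tri k = k * (k + 1) div 2"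

lemma tri_0 [simp]: "tri 0 = 0" and tri_Suc: "tri (Suc k) = tri k + Suc k"
proof -
  have "(Suc k) * (Suc k + 1) = k * (k + 1) + 2 * Suc k" by (simp add: algebra_simps)
  thus "tri (Suc k) = tri k + Suc k" by (simp add: tri_def)
qed (simp add: tri_def)

locale non_root_of_unity =
  fixes q :: "'a::field"
  assumes power_ne_1: "i > 0 \<Longrightarrow> q ^ i \<noteq> 1" and q_nz: "q \<noteq> 0"
begin

lemma qfact_nz: "qfact q n \<noteq> 0"
  using power_ne_1 by (auto simp: qfact_def)

lemma qbinom_0 [simp]: "qbinom q n 0 = 1" and qbinom_self [simp]: "qbinom q n n = 1"
  using qfact_nz by (simp_all add: qbinom_def)

lemma qbinom_eq_0: "n < k \<Longrightarrow> qbinom q n k = 0"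
  by (simp add: qbinom_def)

text \<open>With \<open>n = k + Suc d\<close> the three coefficients become fractions in
  \<open>x\<close>, \<open>y\<close> and shared factors, so that the q-Pascal and absorption rules
  are identities of rational functions.\<close>

lemma qbinom_expand:
  fixes k d :: nat
  defines "x \<equiv> q ^ Suc k" and "y \<equiv> q ^ Suc d" and "A \<equiv> qfact q k" and "B \<equiv> qfact q d"
    and "F \<equiv> qfact q (k + Suc d)"
  shows "x \<noteq> 1" "y \<noteq> 1" "A \<noteq> 0" "B \<noteq> 0"
    "qbinom q (Suc (k + Suc d)) (Suc k) = (x * y - 1) * F / (((x - 1) * A) * ((y - 1) * B))"
    "qbinom q (k + Suc d) (Suc k) = F / (((x - 1) * A) * B)"
    "qbinom q (k + Suc d) k = F / (A * ((y - 1) * B))"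
proof -
  show "x \<noteq> 1" "y \<noteq> 1" "A \<noteq> 0" "B \<noteq> 0"
    unfolding x_def y_def A_def B_def by (intro power_ne_1 qfact_nz zero_less_Suc)+
  have "x * y = q ^ Suc (k + Suc d)" by (simp add: x_def y_def power_add)
  hence S: "qfact q (Suc (k + Suc d)) = (x * y - 1) * F" by (simp only: qfact_Suc F_def)
  have k: "qfact q (Suc k) = (x - 1) * A" and d: "qfact q (Suc d) = (y - 1) * B"
    by (simp_all only: qfact_Suc x_def y_def A_def B_def)
  have "Suc (k + Suc d) - Suc k = Suc d" "k + Suc d - Suc k = d" "k + Suc d - k = Suc d" by simp_all
  thus "qbinom q (Suc (k + Suc d)) (Suc k) = (x * y - 1) * F / (((x - 1) * A) * ((y - 1) * B))"
    "qbinom q (k + Suc d) (Suc k) = F / (((x - 1) * A) * B)"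
    "qbinom q (k + Suc d) k = F / (A * ((y - 1) * B))"
    unfolding qbinom_def by (simp_all only: S k d B_def A_def F_def) simp_all
qed

lemma qbinom_Suc:
  assumes "k \<le> n"
  shows "qbinom q (Suc n) (Suc k) = qbinom q n (Suc k) + q ^ (n - k) * qbinom q n k"
proof (cases "k = n")
  case False
  then obtain d where n: "n = k + Suc d" using assms less_imp_Suc_add[of k n] by auto
  have d: "k + Suc d - k = Suc d" by simp
  show ?thesis unfolding n d qbinom_expand(5-7)
    using qbinom_expand(1)[of k] qbinom_expand(2)[of d] qfact_nz[of k] qfact_nz[of d] by (simp add: divide_simps del: power_Suc) (simp add: algebra_simps del: power_Suc)
qed (simp add: qbinom_eq_0)

lemma qbinom_absorb:
  assumes "k \<le> n"
  shows "(q ^ Suc k - 1) * qbinom q n (Suc k) = (q ^ (n - k) - 1) * qbinom q n k"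
proof (cases "k = n")
  case False
  then obtain d where n: "n = k + Suc d" using assms less_imp_Suc_add[of k n] by auto
  have d: "k + Suc d - k = Suc d" by simp
  show ?thesis unfolding n d qbinom_expand(6-7)
    using qbinom_expand(1)[of k] qbinom_expand(2)[of d] qfact_nz[of k] qfact_nz[of d] by (simp add: divide_simps del: power_Suc)
qed (simp add: qbinom_eq_0)

text \<open>The q-analogue of choosing a subset of a subset; it performs the conjugation by
  \<open>qbinom q n\<close> in the duality of the two recursions.\<close>

lemma qbinom_trinomial:
  assumes "a \<le> p" "p \<le> n"
  shows "qbinom q n a * qbinom q (n - a) (p - a) = qbinom q n p * qbinom q p a"
  using assms qfact_nz by (simp add: qbinom_def divide_simps)

end

section \<open>Order and weight of two adjacent columns\<close>

lemma entry_rank: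
  assumes "finite C" "i < card C"
  shows "entry C i \<in> C" "card {x \<in> C. x < entry C i} = i"
proof -
  let ?l = "sorted_list_of_set C"
  have len: "length ?l = card C" and mem: "set ?l = C" and sd: "sorted ?l" "distinct ?l"
    using assms by simp_all
  show "entry C i \<in> C" unfolding entry_def using assms len mem by (metis nth_mem)
  have sw: "sorted_wrt (<) ?l" by (rule strict_sorted_list_of_set)
  have "{x \<in> C. x < entry C i} = (\<lambda>j. ?l ! j) ` {..<i}"
  proof (intro equalityI subsetI)
    fix x assume "x \<in> {x \<in> C. x < entry C i}"
    then obtain j where j: "j < length ?l" "x = ?l ! j" "?l ! j < ?l ! i"
      using mem by (metis (no_types, lifting) entry_def in_set_conv_nth mem_Collect_eq)
    have "j < i"
    proof (rule ccontr)
      assume "\<not> j < i"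
      hence "?l ! i \<le> ?l ! j" using sd(1) j(1) by (intro sorted_nth_mono) auto
      thus False using j by simp
    qed
    thus "x \<in> (\<lambda>j. ?l ! j) ` {..<i}" using j by auto
  next
    fix x assume "x \<in> (\<lambda>j. ?l ! j) ` {..<i}"
    then obtain j where "j < i" "x = ?l ! j" by auto
    moreover have "?l ! j < ?l ! i" using sorted_wrt_nth_less[OF sw, of j i] calculation assms len by simp
    moreover have "?l ! j \<in> C" using nth_mem[of j ?l] calculation assms len mem by simp
    ultimately show "x \<in> {x \<in> C. x < entry C i}" by (simp add: entry_def)
  qed
  moreover have "inj_on (\<lambda>j. ?l ! j) {..<i}"
    using assms len sd(2) by (auto simp: inj_on_def nth_eq_iff_index_eq)
  ultimately show "card {x \<in> C. x < entry C i} = i" by (simp add: card_image)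
qed

text \<open>Inductions on the alphabet remove the largest letter, which always is the bottom entry
  of its column.\<close>

lemma entry_insert_max:
  assumes "finite C" "\<And>x. x \<in> C \<Longrightarrow> x < m"
  shows "i < card C \<Longrightarrow> entry (insert m C) i = entry C i" "entry (insert m C) (card C) = m"
proof -
  have "m \<notin> C" using assms by auto
  have "sorted_list_of_set C @ [m] = sorted_list_of_set (insert m C)"
  proof (rule sorted_distinct_set_unique)
    show "sorted (sorted_list_of_set C @ [m])" using assms by (auto simp: sorted_append less_imp_le)
    show "distinct (sorted_list_of_set C @ [m])" using assms(1) \<open>m \<notin> C\<close> by simp
    have "set (sorted_list_of_set (insert m C)) = insert m C"
      using assms(1) by (intro set_sorted_list_of_set) simp
    thus "set (sorted_list_of_set C @ [m]) = set (sorted_list_of_set (insert m C))"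
      using assms(1) by (simp only:) simp
  qed (rule sorted_sorted_list_of_set distinct_sorted_list_of_set)+
  note this[symmetric]
  thus "i < card C \<Longrightarrow> entry (insert m C) i = entry C i" "entry (insert m C) (card C) = m"
    using assms by (simp_all add: entry_def nth_append)
qed

definition col_le :: "nat set \<Rightarrow> nat set \<Rightarrow> bool" where
  "col_le C D \<longleftrightarrow> card D \<le> card C \<and> (\<forall>i<card D. entry C i \<le> entry D i)"

definition col_leg :: "nat set \<Rightarrow> nat set \<Rightarrow> nat \<Rightarrow> nat set" where
  "col_leg C D i = (if entry D i \<notin> C then C \<inter> {entry C i .. entry D i} else {})"

text \<open>An empty leg must contribute 1, as in the restricted product of \<open>Phi\<close>; the
  formula \<open>1 - Y ^ 0\<close> would give 0.\<close>

definition leg_factor :: "'a::comm_ring_1 \<Rightarrow> nat set \<Rightarrow> nat set \<Rightarrow> nat \<Rightarrow> 'a" where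
  "leg_factor Y C D i = (if col_leg C D i = {} then 1 else 1 - Y ^ card (col_leg C D i))"

definition col_weight :: "'a::comm_ring_1 \<Rightarrow> nat set \<Rightarrow> nat set \<Rightarrow> 'a" where
  "col_weight Y C D = (\<Prod>i<card D. leg_factor Y C D i)"

lemma col_weight_self: "finite C \<Longrightarrow> col_weight Y C C = 1"
  unfolding col_weight_def leg_factor_def col_leg_def
  by (intro prod.neutral) (auto simp: entry_rank(1))

lemma col_le_refl: "col_le C C" and col_le_trans: "col_le C D \<Longrightarrow> col_le D E \<Longrightarrow> col_le C E"
  by (auto simp: col_le_def) (meson le_trans less_le_trans)

lemma col_le_antisym:
  assumes "finite C" "finite D" "col_le C D" "col_le D C"
  shows "C = D"
proof -
  have "card C = card D" "\<And>i. i < card C \<Longrightarrow> entry C i = entry D i"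
    using assms by (auto simp: col_le_def intro: order_antisym)
  hence "sorted_list_of_set C = sorted_list_of_set D"
    by (intro nth_equalityI) (auto simp: entry_def)
  thus ?thesis using assms by (metis set_sorted_list_of_set)
qed

text \<open>The inequality in the new bottom row is automatic because \<open>m\<close> bounds
  \<open>C\<close>; only the heights have to be compared.\<close>

lemma col_le_insert_right:
  assumes "finite C" "finite D" "\<And>x. x \<in> C \<Longrightarrow> x \<le> m" "\<And>x. x \<in> D \<Longrightarrow> x < m"
  shows "col_le C (insert m D) \<longleftrightarrow> card D < card C \<and> col_le C D"
proof -
  have "m \<notin> D" using assms(4) by auto
  hence c: "card (insert m D) = Suc (card D)" using assms by simp
  have e: "entry (insert m D) i = (if i < card D then entry D i else m)" if "i < Suc (card D)" for i
    using entry_insert_max(1)[of D m i] entry_insert_max(2)[of D m] assms that by (auto simp: less_Suc_eq)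
  have "entry C i \<le> m" if "i < card C" for i
    using entry_rank(1)[OF assms(1) that] assms(3) by auto
  thus ?thesis unfolding col_le_def c by (auto simp: e less_Suc_eq)
qed

text \<open>Only the new bottom cell, in row \<open>card D\<close>, adds a factor. If
  \<open>m\<close> is not in \<open>C\<close>, its leg consists of all entries of \<open>C\<close>
  from that row down, of which there are \<open>card C - card D\<close>; if \<open>m\<close> is in
  \<open>C\<close>, the leg is empty.\<close>

lemma col_weight_insert_right:
  assumes C: "finite C" "\<And>x. x \<in> C \<Longrightarrow> x \<le> m" and D: "finite D" "\<And>x. x \<in> D \<Longrightarrow> x < m"
    and less: "card D < card C"
  shows "col_weight Y C (insert m D) =
    (if m \<in> C then 1 else 1 - Y ^ (card C - card D)) * col_weight Y C D"
proof -
  have "m \<notin> D" using D by auto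
  hence c: "card (insert m D) = Suc (card D)" using D by simp
  have e: "entry (insert m D) i = (if i < card D then entry D i else m)" if "i < Suc (card D)" for i
    using entry_insert_max(1)[of D m i] entry_insert_max(2)[of D m] D that by (auto simp: less_Suc_eq)
  have last: "leg_factor Y C (insert m D) (card D) = (if m \<in> C then 1 else 1 - Y ^ (card C - card D))"
  proof (cases "m \<in> C")
    case False
    let ?x = "entry C (card D)"
    have x: "?x \<in> C" "card {y \<in> C. y < ?x} = card D"
      using entry_rank[OF C(1) less] by auto
    have "C \<inter> {?x..m} = C - {y \<in> C. y < ?x}" using C(2) by auto
    hence "card (C \<inter> {?x..m}) = card C - card D"
      using C(1) x(2) by (subst card_Diff_subset[symmetric, of "{y \<in> C. y < ?x}" C, unfolded x(2)]) auto
    moreover have "C \<inter> {?x..m} \<noteq> {}" using x(1) C(2) by auto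
    ultimately show ?thesis using False e[of "card D"] by (simp add: leg_factor_def col_leg_def)
  qed (use e[of "card D"] in \<open>simp add: leg_factor_def col_leg_def\<close>)
  have "col_weight Y C (insert m D) =
      leg_factor Y C (insert m D) (card D) * (\<Prod>i<card D. leg_factor Y C (insert m D) i)"
    unfolding col_weight_def c by simp
  also have "(\<Prod>i<card D. leg_factor Y C (insert m D) i) = col_weight Y C D"
    unfolding col_weight_def by (intro prod.cong refl) (simp add: e leg_factor_def col_leg_def)
  finally show ?thesis using last by simp
qed

text \<open>The letter \<open>m\<close> becomes the bottom entry of the left column. Being larger
  than every letter of \<open>D\<close>, it has no right neighbour and lies outside all leg
  intervals.\<close>

lemma col_insert_left:
  assumes C: "finite C" "\<And>x. x \<in> C \<Longrightarrow> x < m" and D: "finite D" "\<And>x. x \<in> D \<Longrightarrow> x < m"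
  shows "col_le (insert m C) D \<longleftrightarrow> col_le C D"
    and "col_le C D \<Longrightarrow> col_weight Y (insert m C) D = col_weight Y C D"
proof -
  have "m \<notin> C" using C by auto
  hence c: "card (insert m C) = Suc (card C)" using C by simp
  have e: "entry (insert m C) i = (if i < card C then entry C i else m)" if "i < Suc (card C)" for i
    using entry_insert_max(1)[of C m i] entry_insert_max(2)[of C m] C that by (auto simp: less_Suc_eq)
  have d: "entry D i < m" if "i < card D" for i using entry_rank(1)[OF D(1) that] D(2) by auto
  show le: "col_le (insert m C) D \<longleftrightarrow> col_le C D"
  proof
    assume *: "col_le (insert m C) D"
    have "card D \<le> card C"
    proof (rule ccontr)
      assume "\<not> ?thesis"
      hence "card C < card D" by simp
      thus False using * e[of "card C"] d[of "card C"] by (auto simp: col_le_def c)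
    qed
    thus "col_le C D" using * e by (auto simp: col_le_def c)
  qed (auto simp: col_le_def c e)
  assume "col_le C D"
  hence "leg_factor Y (insert m C) D i = leg_factor Y C D i" if "i < card D" for i
    using that d[OF that] e[of i] unfolding leg_factor_def col_leg_def col_le_def by auto
  thus "col_weight Y (insert m C) D = col_weight Y C D" by (simp add: col_weight_def)
qed

context non_root_of_unity
begin

text \<open>The claimed total weight of the columns of height \<open>k\<close> that may follow a
  column of height \<open>h\<close>. At \<open>h = n\<close> it is the classical sum of
  \<open>q ^ maj D\<close> over the \<open>k\<close>-subsets \<open>D\<close> of
  \<open>{1..n}\<close>.\<close>

definition trans_coeff :: "nat \<Rightarrow> nat \<Rightarrow> nat \<Rightarrow> 'a" where
  "trans_coeff n h k = q ^ (k * (n - h) + tri k) * qbinom q h k"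

definition next_columns :: "nat \<Rightarrow> nat set \<Rightarrow> nat \<Rightarrow> nat set set" where
  "next_columns n C k = {D. D \<subseteq> {1..n} \<and> card D = k \<and> col_le C D}"

lemma finite_next_columns: "finite (next_columns n C k)"
  by (rule finite_subset[of _ "Pow {1..n}"]) (auto simp: next_columns_def)

lemma next_columns_Suc:
  assumes "C \<subseteq> {1..Suc n}"
  shows "next_columns (Suc n) C (Suc k) = next_columns n C (Suc k) \<union>
    (if k < card C then insert (Suc n) ` next_columns n C k else {})"
    (is "_ = ?R")
proof -
  have fin: "finite C" using assms finite_subset by blast
  have le: "x \<le> Suc n" if "x \<in> C" for x using assms that by auto
  have ins: "D \<in> next_columns n C k \<Longrightarrow> finite D \<and> (\<forall>x\<in>D. x < Suc n) \<and> card D = k \<and> col_le C D" for D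
    by (auto simp: next_columns_def less_Suc_eq_le intro: finite_subset)
  show ?thesis
  proof (intro equalityI subsetI)
    fix D assume D: "D \<in> next_columns (Suc n) C (Suc k)"
    show "D \<in> ?R"
    proof (cases "Suc n \<in> D")
      case False
      hence "D \<subseteq> {1..n}" using D by (fastforce simp: next_columns_def le_Suc_eq)
      thus ?thesis using D by (auto simp: next_columns_def)
    next
      case True
      define E where "E = D - {Suc n}"
      have DE: "D = insert (Suc n) E" "Suc n \<notin> E" using True by (auto simp: E_def)
      have E: "E \<subseteq> {1..n}" using D unfolding E_def by (fastforce simp: next_columns_def le_Suc_eq)
      hence fE: "finite E" "\<And>x. x \<in> E \<Longrightarrow> x < Suc n" by (auto intro: finite_subset)
      have "card E = k" using D DE fE by (simp add: next_columns_def)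
      moreover have "card E < card C \<and> col_le C E"
        using D col_le_insert_right[OF fin fE(1) le fE(2)] by (simp add: next_columns_def DE)
      ultimately show ?thesis using E DE by (auto simp: next_columns_def)
    qed
  next
    fix D assume "D \<in> ?R"
    then consider "D \<in> next_columns n C (Suc k)"
      | E where "k < card C" "E \<in> next_columns n C k" "D = insert (Suc n) E" by (auto split: if_splits)
    thus "D \<in> next_columns (Suc n) C (Suc k)"
    proof cases
      case 2
      have E: "finite E" "\<And>x. x \<in> E \<Longrightarrow> x < Suc n" "card E = k" "col_le C E" using ins[OF 2(2)] by auto
      have "Suc n \<notin> E" using E(2) by auto
      moreover have "E \<subseteq> {1..n}" using 2 by (auto simp: next_columns_def)
      ultimately show ?thesis
        using 2 E col_le_insert_right[OF fin E(1) le E(2)] by (auto simp: next_columns_def)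
    qed (auto simp: next_columns_def)
  qed
qed

text \<open>Splits by whether \<open>D\<close> contains the largest letter, which then fills the
  bottom cell and contributes the factor of that one cell.\<close>

lemma sum_next_columns_Suc:
  fixes Y :: 'a
  assumes C: "C \<subseteq> {1..Suc n}"
  shows "(\<Sum>D\<in>next_columns (Suc n) C (Suc k). col_weight Y C D * q ^ maj D) =
    (\<Sum>D\<in>next_columns n C (Suc k). col_weight Y C D * q ^ maj D) +
    (if k < card C then q ^ Suc n * (if Suc n \<in> C then 1 else 1 - Y ^ (card C - k)) *
       (\<Sum>D\<in>next_columns n C k. col_weight Y C D * q ^ maj D) else 0)"
proof -
  let ?f = "\<lambda>D. col_weight Y C D * q ^ maj D"
  have fin: "finite C" using assms finite_subset by blast
  have le: "x \<le> Suc n" if "x \<in> C" for x using assms that by auto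
  have nin: "Suc n \<notin> D" if "D \<in> next_columns n C j" for D j using that by (auto simp: next_columns_def)
  have fD: "finite D" "card D = k" "\<And>x. x \<in> D \<Longrightarrow> x < Suc n" if "D \<in> next_columns n C k" for D
    using that by (auto simp: next_columns_def less_Suc_eq_le intro: finite_subset)
  show ?thesis
  proof (cases "k < card C")
    case True
    have "sum ?f (next_columns (Suc n) C (Suc k)) = sum ?f (next_columns n C (Suc k)) + sum ?f (insert (Suc n) ` next_columns n C k)"
      using True nin unfolding next_columns_Suc[OF C]
      by (simp only: if_True) (intro sum.union_disjoint finite_imageI finite_next_columns, auto)
    also have "sum ?f (insert (Suc n) ` next_columns n C k) = (\<Sum>D\<in>next_columns n C k. ?f (insert (Suc n) D))"
    proof (intro sum.reindex_cong[of "insert (Suc n)"] refl inj_onI)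
      fix D E assume "D \<in> next_columns n C k" "E \<in> next_columns n C k" "insert (Suc n) D = insert (Suc n) E"
      thus "D = E" using nin by (metis insert_ident)
    qed
    also have "\<dots> = (\<Sum>D\<in>next_columns n C k. q ^ Suc n * (if Suc n \<in> C then 1 else 1 - Y ^ (card C - k)) * ?f D)"
    proof (intro sum.cong refl)
      fix D assume D: "D \<in> next_columns n C k"
      have "maj (insert (Suc n) D) = Suc n + maj D" using nin[OF D] fD[OF D] by (simp add: maj_def)
      moreover have "col_weight Y C (insert (Suc n) D) =
          (if Suc n \<in> C then 1 else 1 - Y ^ (card C - k)) * col_weight Y C D"
        using col_weight_insert_right[OF fin le fD(1)[OF D] fD(3)[OF D], of Y] fD(2)[OF D] True by simp
      ultimately show "?f (insert (Suc n) D) = q ^ Suc n * (if Suc n \<in> C then 1 else 1 - Y ^ (card C - k)) * ?f D"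
        by (simp add: power_add algebra_simps)
    qed
    finally show ?thesis using True by (simp add: sum_distrib_left)
  qed (simp add: next_columns_Suc[OF C])
qed

text \<open>The total weight of the columns of height \<open>k\<close> that may follow \<open>C\<close> depends on \<open>C\<close> only
  through its height; this is what makes the transfer sum over tableaux collapse.\<close>

lemma sum_next_columns:
  assumes "C \<subseteq> {1..n}"
  shows "(\<Sum>D\<in>next_columns n C k. col_weight (inverse q) C D * q ^ maj D) = trans_coeff n (card C) k"
  using assms
proof (induction n arbitrary: C k)
  case 0
  have "next_columns 0 {} k = (if k = 0 then {{}} else {})" by (auto simp: next_columns_def col_le_def)
  moreover have "trans_coeff 0 0 k = (if k = 0 then 1 else 0)"
    by (simp add: trans_coeff_def qbinom_eq_0)
  ultimately show ?case using 0 by (simp add: col_weight_def maj_def)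
next
  case (Suc n)
  let ?Y = "inverse q"
  have fin: "finite C" using Suc finite_subset by blast
  show ?case
  proof (cases k)
    case 0
    have "next_columns (Suc n) C 0 = {{}}"
      by (auto simp: next_columns_def col_le_def dest: finite_subset)
    thus ?thesis using 0 by (simp add: col_weight_def maj_def trans_coeff_def)
  next
    case k: (Suc j)
    show ?thesis
    proof (cases "Suc n \<in> C")
      case False
      hence C: "C \<subseteq> {1..n}" using Suc.prems by (fastforce simp: le_Suc_eq)
      define h where "h = card C"
      have hn: "h \<le> n" using card_mono[OF _ C] by (simp add: h_def)
      \<comment> \<open>Without the letter \<open>Suc n\<close> in \<open>C\<close> the height stays
        \<open>h\<close>. At \<open>Y = 1 / q\<close> the factor of the bottom cell becomes a power
        of \<open>q\<close> times \<open>q ^ (h - j) - 1\<close>, which is exactly what the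
        absorption rule needs.\<close>
      have "trans_coeff (Suc n) h (Suc j) = trans_coeff n h (Suc j) +
          (if j < h then q ^ Suc n * (1 - ?Y ^ (h - j)) * trans_coeff n h j else 0)"
      proof (cases "j < h")
        case True
        obtain d where h: "h = Suc (j + d)" using True less_imp_Suc_add by blast
        obtain e where n: "n = h + e" using hn le_Suc_ex by blast
        have Y: "q ^ Suc n * (1 - ?Y ^ (h - j)) = q ^ (e + j + 1) * (q ^ (h - j) - 1)"
        proof -
          have "Suc n = (e + j + 1) + (h - j)" using True n by simp
          hence "q ^ Suc n = q ^ (e + j + 1) * q ^ (h - j)" by (simp only: power_add)
          thus ?thesis using q_nz by (simp add: field_simps)
        qed
        have "(q ^ Suc j - 1) * qbinom q h (Suc j) = (q ^ (h - j) - 1) * qbinom q h j"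
          using True by (intro qbinom_absorb) simp
        hence "q ^ Suc n * (1 - ?Y ^ (h - j)) * trans_coeff n h j =
            q ^ (e + j + 1) * q ^ (j * e + tri j) * ((q ^ Suc j - 1) * qbinom q h (Suc j))"
          unfolding Y by (simp only: trans_coeff_def n add_diff_cancel_left' mult_ac)
        moreover have "trans_coeff (Suc n) h (Suc j) =
            q ^ (e + j + 1) * q ^ (j * e + tri j) * (q ^ Suc j * qbinom q h (Suc j))"
          unfolding trans_coeff_def n by (simp add: tri_Suc power_add algebra_simps)
        moreover have "trans_coeff n h (Suc j) = q ^ (e + j + 1) * q ^ (j * e + tri j) * qbinom q h (Suc j)"
          unfolding trans_coeff_def n by (simp add: tri_Suc power_add algebra_simps)
        ultimately show ?thesis using True by (simp add: algebra_simps)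
      qed (simp add: trans_coeff_def qbinom_eq_0)
      thus ?thesis using sum_next_columns_Suc[OF Suc.prems] False Suc.IH[OF C] by (simp add: k h_def)
    next
      case True
      define E where "E = C - {Suc n}"
      have CE: "C = insert (Suc n) E" "Suc n \<notin> E" using True by (auto simp: E_def)
      have E: "E \<subseteq> {1..n}" using Suc.prems unfolding E_def by (fastforce simp: le_Suc_eq)
      hence fE: "finite E" "\<And>x. x \<in> E \<Longrightarrow> x < Suc n" by (auto intro: finite_subset)
      define h where "h = card E"
      have hC: "card C = Suc h" using CE fE by (simp add: h_def)
      have hn: "h \<le> n" using card_mono[OF _ E] by (simp add: h_def)
      have D: "finite D" "\<And>x. x \<in> D \<Longrightarrow> x < Suc n" if "D \<subseteq> {1..n}" for D
        using that by (auto intro: finite_subset)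
      have cols: "next_columns n C i = next_columns n E i" for i
        unfolding next_columns_def CE(1) using col_insert_left(1)[OF fE D] by auto
      have "col_weight ?Y C D = col_weight ?Y E D" if "D \<in> next_columns n E i" for D i
        unfolding CE(1) using that by (intro col_insert_left(2) fE D) (auto simp: next_columns_def)
      hence sums: "(\<Sum>D\<in>next_columns n C i. col_weight ?Y C D * q ^ maj D) = trans_coeff n h i" for i
        unfolding cols using Suc.IH[OF E, of i] by (simp add: h_def)
      \<comment> \<open>Removing \<open>Suc n\<close> from \<open>C\<close> lowers alphabet and
        height together, so \<open>n - h\<close> is unchanged and the two terms are those of the
        q-Pascal rule.\<close>
      have "trans_coeff (Suc n) (Suc h) (Suc j) = trans_coeff n h (Suc j) +
          (if j < Suc h then q ^ Suc n * trans_coeff n h j else 0)"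
      proof (cases "j < Suc h")
        case True
        obtain d where h: "h = j + d" using True less_Suc_eq_le le_Suc_ex by blast
        obtain e where n: "n = h + e" using hn le_Suc_ex by blast
        show ?thesis using True qbinom_Suc[of j h] unfolding trans_coeff_def n h
          by (simp add: tri_Suc power_add algebra_simps)
      qed (simp add: trans_coeff_def qbinom_eq_0)
      thus ?thesis using sum_next_columns_Suc[OF Suc.prems] True sums by (simp add: k hC)
    qed
  qed
qed

end

section \<open>Sums over reduced tableaux\<close>

definition valid_cols :: "nat \<Rightarrow> nat set set" where
  "valid_cols n = {C. C \<noteq> {} \<and> C \<subseteq> {1..n}}"

lemma finite_valid_cols: "finite (valid_cols n)" and valid_cols_finite: "C \<in> valid_cols n \<Longrightarrow> finite C"
  by (auto simp: valid_cols_def intro: finite_subset finite_subset[of _ "Pow {1..n}"])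

lemma SSYT_Cons:
  "SSYT n (C # T) \<longleftrightarrow> C \<in> valid_cols n \<and> SSYT n T \<and> (T \<noteq> [] \<longrightarrow> col_le C (hd T))"
proof -
  have all_nat: "(\<forall>j. Q j) \<longleftrightarrow> Q 0 \<and> (\<forall>j. Q (Suc j))" for Q :: "nat \<Rightarrow> bool"
    by (metis nat.exhaust)
  have "(\<forall>j. Suc j < length (C # T) \<longrightarrow> col_le ((C # T) ! j) ((C # T) ! Suc j)) \<longleftrightarrow>
      (T \<noteq> [] \<longrightarrow> col_le C (hd T)) \<and> (\<forall>j. Suc j < length T \<longrightarrow> col_le (T ! j) (T ! Suc j))"
    by (subst all_nat) (auto simp: hd_conv_nth)
  thus ?thesis by (auto simp: SSYT_def col_le_def valid_cols_def)
qed

lemma SSYT_hd_le: "SSYT n T \<Longrightarrow> C \<in> set T \<Longrightarrow> col_le (hd T) C"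
proof (induction T)
  case (Cons D T)
  show ?case
  proof (cases "C = D")
    case False
    hence "C \<in> set T" using Cons.prems by simp
    moreover from this have "T \<noteq> []" by auto
    ultimately show ?thesis using Cons col_le_trans by (auto simp: SSYT_Cons)
  qed (simp add: col_le_refl)
qed simp

lemma rSSYT_Nil: "[] \<in> rSSYT n"
  by (simp add: rSSYT_def SSYT_def)

text \<open>Since \<open>col_le\<close> is a partial order on columns, distinctness of neighbours
  already gives distinctness of all columns, so tableaux can be built one column at a time.\<close>

lemma rSSYT_Cons:
  "C # T \<in> rSSYT n \<longleftrightarrow> C \<in> valid_cols n \<and> T \<in> rSSYT n \<and> (T \<noteq> [] \<longrightarrow> col_le C (hd T) \<and> C \<noteq> hd T)"
proof -
  have "C \<notin> set T" if "C \<in> valid_cols n" "SSYT n T" "T \<noteq> []" "col_le C (hd T)" "C \<noteq> hd T"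
  proof
    assume "C \<in> set T"
    hence "col_le (hd T) C" using that SSYT_hd_le by blast
    moreover have "hd T \<in> valid_cols n" using that by (cases T) (auto simp: SSYT_Cons)
    ultimately show False using col_le_antisym that valid_cols_finite by blast
  qed
  moreover have "T \<noteq> [] \<Longrightarrow> hd T \<in> set T" by simp
  ultimately show ?thesis unfolding rSSYT_def mem_Collect_eq SSYT_Cons distinct.simps
    by (cases "T = []") (simp, blast)
qed

lemma finite_rSSYT: "finite (rSSYT n)"
proof (rule finite_subset)
  show "rSSYT n \<subseteq> {T. set T \<subseteq> valid_cols n \<and> distinct T}"
    by (auto simp: rSSYT_def SSYT_def valid_cols_def)
  show "finite {T. set T \<subseteq> valid_cols n \<and> distinct T}"
    by (rule finite_subset_distinct[OF finite_valid_cols])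
qed

text \<open>A leg only sees two adjacent columns, so \<open>Phi\<close> is a product over
  neighbours; this locality permits a transfer recursion.\<close>

lemma Phi_eq_prod_col_weight:
  "Phi T Y = (\<Prod>j<length T - 1. col_weight Y (T ! j) (T ! Suc j))"
proof -
  let ?B = "\<lambda>j. {i. i < card (T ! Suc j) \<and> leg_plus T i j \<noteq> {}}"
  have "col_weight Y (T ! j) (T ! Suc j) = (\<Prod>i\<in>?B j. 1 - Y ^ card (leg_plus T i j))" for j
  proof -
    have "col_leg (T ! j) (T ! Suc j) i = leg_plus T i j" for i by (simp add: col_leg_def leg_plus_def)
    hence "col_weight Y (T ! j) (T ! Suc j) =
        (\<Prod>i<card (T ! Suc j). if leg_plus T i j \<noteq> {} then 1 - Y ^ card (leg_plus T i j) else 1)"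
      unfolding col_weight_def leg_factor_def by (intro prod.cong) auto
    also have "\<dots> = (\<Prod>i\<in>?B j. 1 - Y ^ card (leg_plus T i j))"
      by (subst prod.inter_filter[symmetric]) (auto intro!: prod.cong)
    finally show ?thesis .
  qed
  hence "(\<Prod>j<length T - 1. col_weight Y (T ! j) (T ! Suc j)) =
      (\<Prod>(j, i)\<in>Sigma {..<length T - 1} ?B. 1 - Y ^ card (leg_plus T i j))"
    by (simp add: prod.Sigma)
  also have "\<dots> = Phi T Y" unfolding Phi_def
    by (rule prod.reindex_bij_witness[of _ prod.swap prod.swap]) auto
  finally show ?thesis ..
qed

lemma Phi_Nil [simp]: "Phi [] Y = 1" and Phi_single [simp]: "Phi [C] Y = 1"
  by (simp_all add: Phi_eq_prod_col_weight)

lemma Phi_Cons: "Phi (C # D # T) Y = col_weight Y C D * Phi (D # T) Y"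
  by (simp add: Phi_eq_prod_col_weight prod.lessThan_Suc_shift del: prod.lessThan_Suc)

lemma entry_atLeastAtMost: "i < n \<Longrightarrow> entry {1..n} i = Suc i"
  by (simp add: entry_def atLeastLessThanSuc_atLeastAtMost[symmetric] del: upt_Suc)

text \<open>The full column may precede any column, and does so with weight 1: it acts as a virtual
  first column when all tableaux are summed.\<close>

lemma col_le_full: "D \<subseteq> {1..n} \<Longrightarrow> col_le {1..n} D"
proof -
  assume D: "D \<subseteq> {1..n}"
  have fin: "finite D" and c: "card D \<le> n" using D card_mono[of "{1..n}" D] by (auto intro: finite_subset)
  have "Suc i \<le> entry D i" if "i < card D" for i
  proof -
    have "{x \<in> D. x < entry D i} \<subseteq> {1..<entry D i}" using D by auto
    from card_mono[OF _ this] have "i \<le> entry D i - 1" using entry_rank(2)[OF fin that] by simp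
    moreover have "entry D i \<ge> 1" using entry_rank(1)[OF fin that] D by auto
    ultimately show ?thesis by simp
  qed
  thus ?thesis using c by (simp add: col_le_def entry_atLeastAtMost del: One_nat_def)
qed

lemma col_weight_full: "D \<subseteq> {1..n} \<Longrightarrow> col_weight Y {1..n} D = 1"
  unfolding col_weight_def
proof (intro prod.neutral ballI)
  fix i assume D: "D \<subseteq> {1..n}" and "i \<in> {..<card D}"
  hence "entry D i \<in> {1..n}" using entry_rank(1)[OF finite_subset[OF D finite_atLeastAtMost]] D by blast
  thus "leg_factor Y {1..n} D i = 1" by (simp add: leg_factor_def col_leg_def)
qed

section \<open>Collapse of the tableau sum to a recursion on heights\<close>

context non_root_of_unity
begin

text \<open>Here \<open>W h\<close> stands for the total weight of all tableaux, with repeated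
  columns allowed, that may follow a column of height \<open>h\<close>; the term
  \<open>k = h\<close> includes repetition of that column. The second assumption keeps the
  denominators \<open>1 - X C\<close> nonzero.\<close>

context
  fixes n :: nat and t :: 'a and W :: "nat \<Rightarrow> 'a"
  assumes W: "\<And>h. h \<le> n \<Longrightarrow> W h = 1 + (\<Sum>k=1..h. trans_coeff n h k * t * W k)"
    and X_ne_1: "\<And>C. C \<in> valid_cols n \<Longrightarrow> q ^ maj C * t \<noteq> 1"
begin

private abbreviation "X C \<equiv> q ^ maj C * t"
private abbreviation "wt T \<equiv> Phi T (inverse q) * prod_list (map (\<lambda>C. X C / (1 - X C)) T)"

private definition tails :: "nat set \<Rightarrow> nat set list set" where
  "tails C = {T. C # T \<in> rSSYT n}"

private definition headed :: "nat set \<Rightarrow> 'a" where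
  "headed C = (\<Sum>T\<in>tails C. wt (C # T))"

private lemma finite_tails: "finite (tails C)"
proof (rule finite_subset)
  show "tails C \<subseteq> tl ` rSSYT n" by (force simp: tails_def image_iff)
qed (simp add: finite_rSSYT)

private lemma sum_Cons_image: "(\<Sum>T\<in>(#) D ` A. f T) = (\<Sum>T\<in>A. f (D # T))"
  by (simp add: sum.reindex inj_on_def)

private lemma sum_transfer:
  assumes C: "C \<subseteq> {1..n}"
  shows "(\<Sum>D | D \<in> valid_cols n \<and> col_le C D. col_weight (inverse q) C D * (X D * W (card D))) = W (card C) - 1"
proof -
  let ?h = "card C"
  have h: "?h \<le> n" using card_mono[OF _ C] by simp
  have eq: "{D. D \<in> valid_cols n \<and> col_le C D} = (\<Union>k\<in>{1..?h}. next_columns n C k)"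
  proof -
    have "D \<in> valid_cols n \<longleftrightarrow> D \<subseteq> {1..n} \<and> 1 \<le> card D" for D
      unfolding valid_cols_def Suc_le_eq One_nat_def card_gt_0_iff
      using finite_subset[OF _ finite_atLeastAtMost] by blast
    thus ?thesis by (auto simp: next_columns_def col_le_def)
  qed
  have "(\<Sum>D | D \<in> valid_cols n \<and> col_le C D. col_weight (inverse q) C D * (X D * W (card D))) =
      (\<Sum>k=1..?h. \<Sum>D\<in>next_columns n C k. col_weight (inverse q) C D * (X D * W (card D)))"
    unfolding eq by (intro sum.UNION_disjoint) (auto simp: finite_next_columns, auto simp: next_columns_def)
  also have "\<dots> = (\<Sum>k=1..?h. \<Sum>D\<in>next_columns n C k. col_weight (inverse q) C D * q ^ maj D * (t * W k))"
    by (intro sum.cong refl) (simp add: next_columns_def)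
  also have "\<dots> = (\<Sum>k=1..?h. trans_coeff n ?h k * t * W k)"
    unfolding sum_distrib_right[symmetric] sum_next_columns[OF C] by (simp only: mult.assoc)
  finally show ?thesis using W[OF h] by simp
qed

private lemma headed_rec:
  assumes C: "C \<in> valid_cols n"
  shows "headed C = X C / (1 - X C) *
    (1 + (\<Sum>D | D \<in> valid_cols n \<and> col_le C D \<and> C \<noteq> D. col_weight (inverse q) C D * headed D))"
proof -
  let ?S = "{D. D \<in> valid_cols n \<and> col_le C D \<and> C \<noteq> D}"
  have eq: "tails C = insert [] (\<Union>D\<in>?S. (#) D ` tails D)"
  proof (intro equalityI subsetI)
    fix T assume T: "T \<in> tails C"
    show "T \<in> insert [] (\<Union>D\<in>?S. (#) D ` tails D)"
      using T C by (cases T) (auto simp: tails_def rSSYT_Cons)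
  qed (use C in \<open>auto simp: tails_def rSSYT_Cons rSSYT_Nil\<close>)
  have fS: "finite ?S" using finite_valid_cols by simp
  have "headed C = wt [C] + (\<Sum>T\<in>(\<Union>D\<in>?S. (#) D ` tails D). wt (C # T))"
    unfolding headed_def eq using fS finite_tails by (subst sum.insert) auto
  also have "(\<Sum>T\<in>(\<Union>D\<in>?S. (#) D ` tails D). wt (C # T)) = (\<Sum>D\<in>?S. \<Sum>T\<in>(#) D ` tails D. wt (C # T))"
    using fS finite_tails by (intro sum.UNION_disjoint) auto
  also have "\<dots> = (\<Sum>D\<in>?S. \<Sum>T\<in>tails D. X C / (1 - X C) * (col_weight (inverse q) C D * wt (D # T)))"
    unfolding sum_Cons_image by (intro sum.cong refl) (simp add: Phi_Cons algebra_simps)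
  finally show ?thesis by (simp add: headed_def sum_distrib_left algebra_simps)
qed

text \<open>The recursion for \<open>headed C\<close> omits \<open>D = C\<close>, while
  \<open>sum_transfer\<close> includes it with weight 1. Moving that term across yields a factor
  \<open>1 - X C\<close>, which cancels the denominator of the first column. The induction is on the
  number of columns strictly beyond \<open>C\<close>.\<close>

private lemma headed_eq: "C \<in> valid_cols n \<Longrightarrow> headed C = X C * W (card C)"
proof (induction "card {D \<in> valid_cols n. col_le C D \<and> C \<noteq> D}" arbitrary: C rule: less_induct)
  case less
  let ?S = "{D. D \<in> valid_cols n \<and> col_le C D \<and> C \<noteq> D}"
  have sub: "C \<subseteq> {1..n}" using less.prems by (simp add: valid_cols_def)
  have IH: "headed D = X D * W (card D)" if D: "D \<in> ?S" for D
  proof (rule less.hyps)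
    have "{E \<in> valid_cols n. col_le D E \<and> D \<noteq> E} \<subset> ?S"
    proof (intro psubsetI notI)
      show "{E \<in> valid_cols n. col_le D E \<and> D \<noteq> E} \<subseteq> ?S"
        using D less.prems col_le_trans col_le_antisym valid_cols_finite by blast
      assume "{E \<in> valid_cols n. col_le D E \<and> D \<noteq> E} = ?S"
      thus False using D by blast
    qed
    thus "card {E \<in> valid_cols n. col_le D E \<and> D \<noteq> E} < card {D \<in> valid_cols n. col_le C D \<and> C \<noteq> D}"
      using finite_valid_cols by (intro psubset_card_mono) auto
  qed (use D in simp)
  have "{D. D \<in> valid_cols n \<and> col_le C D} = insert C ?S"
    using less.prems by (auto simp: col_le_refl)
  hence "W (card C) - 1 = col_weight (inverse q) C C * (X C * W (card C)) +
      (\<Sum>D\<in>?S. col_weight (inverse q) C D * (X D * W (card D)))"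
    using sum_transfer[OF sub] finite_valid_cols by simp
  also have "(\<Sum>D\<in>?S. col_weight (inverse q) C D * (X D * W (card D))) =
      (\<Sum>D\<in>?S. col_weight (inverse q) C D * headed D)"
    by (intro sum.cong refl) (simp add: IH)
  also have "col_weight (inverse q) C C = 1"
    using valid_cols_finite[OF less.prems] by (rule col_weight_self)
  finally have "1 + (\<Sum>D\<in>?S. col_weight (inverse q) C D * headed D) = (1 - X C) * W (card C)"
    by (simp add: algebra_simps)
  thus ?case using headed_rec[OF less.prems] X_ne_1[OF less.prems] by simp
qed

lemma HLS_eq: "HLS n (inverse q) (\<lambda>C. q ^ maj C * t) = W n"
proof -
  have eq: "rSSYT n = insert [] (\<Union>C\<in>valid_cols n. (#) C ` tails C)"
  proof (intro equalityI subsetI)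
    fix T assume T: "T \<in> rSSYT n"
    thus "T \<in> insert [] (\<Union>C\<in>valid_cols n. (#) C ` tails C)"
      by (cases T) (auto simp: tails_def rSSYT_Cons)
  qed (auto simp: tails_def rSSYT_Nil)
  have "HLS n (inverse q) (\<lambda>C. X C) = 1 + (\<Sum>T\<in>(\<Union>C\<in>valid_cols n. (#) C ` tails C). wt T)"
    unfolding HLS_def eq using finite_valid_cols finite_tails by (subst sum.insert) auto
  also have "(\<Sum>T\<in>(\<Union>C\<in>valid_cols n. (#) C ` tails C). wt T) = (\<Sum>C\<in>valid_cols n. \<Sum>T\<in>(#) C ` tails C. wt T)"
    using finite_valid_cols finite_tails by (intro sum.UNION_disjoint) auto
  also have "\<dots> = (\<Sum>C\<in>valid_cols n. headed C)"
    by (simp only: headed_def sum_Cons_image)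
  \<comment> \<open>The virtual first column \<open>{1..n}\<close> turns the sum over all first
    columns into a transfer from height \<open>n\<close>.\<close>
  also have "\<dots> = (\<Sum>D | D \<in> valid_cols n \<and> col_le {1..n} D. col_weight (inverse q) {1..n} D * (X D * W (card D)))"
    by (intro sum.cong) (auto simp: headed_eq col_weight_full valid_cols_def col_le_full simp del: One_nat_def)
  also have "\<dots> = W n - 1" by (subst sum_transfer) auto
  finally show ?thesis by simp
qed

end

end

section \<open>Generating functions\<close>

context non_root_of_unity
begin

text \<open>The system is triangular in the height; the term \<open>k = h\<close> makes each
  equation implicit, and the assumption makes its diagonal coefficient invertible.\<close>

lemma transfer_solution_ex:
  assumes "\<And>h. 1 \<le> h \<Longrightarrow> h \<le> n \<Longrightarrow> trans_coeff n h h * t \<noteq> 1"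
  shows "\<exists>W. \<forall>h\<le>n. W h = 1 + (\<Sum>k=1..h. trans_coeff n h k * t * W k)"
proof -
  have "m \<le> n \<Longrightarrow> \<exists>W. \<forall>h\<le>m. W h = 1 + (\<Sum>k=1..h. trans_coeff n h k * t * W k)" for m
  proof (induction m)
    case 0
    show ?case by (intro exI[of _ "\<lambda>_. 1"]) simp
  next
    case (Suc m)
    then obtain W where W: "\<And>h. h \<le> m \<Longrightarrow> W h = 1 + (\<Sum>k=1..h. trans_coeff n h k * t * W k)" by auto
    define D where "D = trans_coeff n (Suc m) (Suc m) * t"
    define S where "S = 1 + (\<Sum>k=1..m. trans_coeff n (Suc m) k * t * W k)"
    define W' where "W' = W(Suc m := S / (1 - D))"
    have D: "D \<noteq> 1" unfolding D_def using assms[of "Suc m"] Suc.prems by simp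
    have "W' h = 1 + (\<Sum>k=1..h. trans_coeff n h k * t * W' k)" if h: "h \<le> Suc m" for h
    proof (cases "h = Suc m")
      case True
      have "1 + (\<Sum>k=1..Suc m. trans_coeff n (Suc m) k * t * W' k) = S + D * W' (Suc m)"
        by (simp add: S_def D_def W'_def)
      also have "\<dots> = W' (Suc m)" using D by (simp add: W'_def field_simps)
      finally show ?thesis using True by simp
    next
      case False
      hence hm: "h \<le> m" using h by simp
      have "(\<Sum>k=1..h. trans_coeff n h k * t * W' k) = (\<Sum>k=1..h. trans_coeff n h k * t * W k)"
        using hm by (intro sum.cong) (auto simp: W'_def)
      thus ?thesis using W[OF hm] False by (simp add: W'_def)
    qed
    thus ?case by blast
  qed
  thus ?thesis by blast
qed

text \<open>Reversing the chain of ranks. Up to conjugation by \<open>qbinom q n\<close>, the recursion for \<open>H\<close> is the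
  transpose of the one for \<open>V\<close>, so the row vector \<open>y\<close> built from \<open>H\<close> solves the transposed system.\<close>

lemma transfer_duality:
  assumes H: "\<And>a. a \<le> n \<Longrightarrow>
      H a = 1 + t * (\<Sum>h=a..n. q ^ (a * (n - h) + tri h) * qbinom q (n - a) (h - a) * H h)"
    and V: "\<And>h. h \<le> n \<Longrightarrow> V h = 1 + t * (\<Sum>k\<le>n. trans_coeff n h k * V k)"
  shows "H 0 = V n"
proof -
  \<comment> \<open>The factor in front of \<open>H a\<close> is \<open>trans_coeff n n a\<close>,
    the last row of the transfer matrix.\<close>
  define y where "y a = qbinom q n a * q ^ tri a * H a" for a
  have y: "y a = trans_coeff n n a + t * (\<Sum>h\<le>n. y h * trans_coeff n h a)" if a: "a \<le> n" for a
  proof -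
    have "y a = qbinom q n a * q ^ tri a +
        t * (\<Sum>h=a..n. q ^ tri a * q ^ (a * (n - h) + tri h) * (qbinom q n a * qbinom q (n - a) (h - a)) * H h)"
      unfolding y_def by (subst H[OF a]) (simp add: algebra_simps sum_distrib_left)
    also have "(\<Sum>h=a..n. q ^ tri a * q ^ (a * (n - h) + tri h) * (qbinom q n a * qbinom q (n - a) (h - a)) * H h)
        = (\<Sum>h=a..n. y h * trans_coeff n h a)"
      by (intro sum.cong refl)
         (simp add: qbinom_trinomial y_def trans_coeff_def power_add mult_ac)
    also have "\<dots> = (\<Sum>h\<le>n. y h * trans_coeff n h a)"
      by (intro sum.mono_neutral_left) (auto simp: trans_coeff_def qbinom_eq_0)
    finally show ?thesis by (simp add: trans_coeff_def mult.commute)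
  qed
  \<comment> \<open>The pairing of \<open>y\<close> with \<open>V\<close> is used in two ways: the
    equation for \<open>V\<close> produces the sum of \<open>y\<close>, the transposed equation for
    \<open>y\<close> produces the last component of the system for \<open>V\<close>.\<close>
  have "(\<Sum>a\<le>n. y a) = (\<Sum>a\<le>n. y a * V a) - t * (\<Sum>a\<le>n. \<Sum>k\<le>n. y a * (trans_coeff n a k * V k))"
    by (simp add: V sum_distrib_left sum_subtractf[symmetric] algebra_simps)
  also have "(\<Sum>a\<le>n. \<Sum>k\<le>n. y a * (trans_coeff n a k * V k)) =
      (\<Sum>k\<le>n. (\<Sum>a\<le>n. y a * trans_coeff n a k) * V k)"
    by (subst sum.swap) (simp add: sum_distrib_right mult.assoc)
  also have "(\<Sum>a\<le>n. y a * V a) - t * (\<Sum>k\<le>n. (\<Sum>a\<le>n. y a * trans_coeff n a k) * V k) =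
      (\<Sum>k\<le>n. (y k - t * (\<Sum>a\<le>n. y a * trans_coeff n a k)) * V k)"
    by (simp add: sum_distrib_left sum_subtractf[symmetric] algebra_simps)
  also have "\<dots> = (\<Sum>k\<le>n. trans_coeff n n k * V k)"
  proof (intro sum.cong refl)
    fix k assume "k \<in> {..n}"
    hence "y k - t * (\<Sum>a\<le>n. y a * trans_coeff n a k) = trans_coeff n n k" using y[of k] by simp
    thus "(y k - t * (\<Sum>a\<le>n. y a * trans_coeff n a k)) * V k = trans_coeff n n k * V k" by simp
  qed
  finally have "1 + t * (\<Sum>a\<le>n. y a) = V n" using V[of n] by simp
  moreover have "H 0 = 1 + t * (\<Sum>a\<le>n. y a)"
    unfolding y_def atLeast0AtMost[symmetric] by (subst H) (simp_all add: mult.commute)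
  ultimately show ?thesis by simp
qed

end

text \<open>\<open>level_count q n m a u\<close> is the measure of the matrices \<open>A\<close> with similitude factor of valuation
  \<open>m\<close> whose rows \<open>0, \<dots>, a - 1\<close> are independent and whose rows \<open>a + u, \<dots>, n - 1\<close> vanish
  modulo the maximal ideal.\<close>

fun level_count :: "nat \<Rightarrow> nat \<Rightarrow> nat \<Rightarrow> nat \<Rightarrow> nat \<Rightarrow> nat" where
  "level_count q n m a (Suc u) = level_count q n m (Suc a) u + q ^ a * level_count q n m a u"
| "level_count q n (Suc m) a 0 = q ^ tri a * level_count q n m a (n - a)"
| "level_count q n 0 a 0 = (if a = n then 1 else 0)"

lemma tri_mono: "a \<le> b \<Longrightarrow> tri a \<le> tri b"
  unfolding tri_def by (intro div_le_mono mult_le_mono) auto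

text \<open>Each decided row costs a factor of at most \<open>1 + q ^ n\<close>, each unit of
  valuation one factor \<open>q ^ tri n\<close> and at most \<open>n\<close> further decisions. The
  exponential growth in \<open>m\<close> gives a positive radius of convergence.\<close>

lemma level_count_bound:
  assumes "q \<ge> 1" "a + u \<le> n"
  shows "level_count q n m a u \<le> (1 + q ^ n) ^ u * ((1 + q ^ n) ^ n * q ^ tri n) ^ m"
  using assms
proof (induction q n m a u rule: level_count.induct)
  case (1 q n m a u)
  let ?X = "(1 + q ^ n) ^ u * ((1 + q ^ n) ^ n * q ^ tri n) ^ m"
  have qa: "q ^ a \<le> q ^ n" using 1 by (intro power_increasing) auto
  have "level_count q n m a (Suc u) \<le> ?X + q ^ a * ?X"
    unfolding level_count.simps(1) using 1 by (intro add_mono mult_left_mono) auto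
  also have "\<dots> \<le> ?X + q ^ n * ?X" using qa by (intro add_left_mono mult_right_mono) auto
  finally show ?case by (simp add: algebra_simps)
next
  case (2 q n m a)
  let ?L = "(1 + q ^ n) ^ n * q ^ tri n"
  have "level_count q n (Suc m) a 0 \<le> q ^ tri n * ((1 + q ^ n) ^ n * ?L ^ m)"
    unfolding level_count.simps(2)
  proof (rule mult_le_mono)
    show "q ^ tri a \<le> q ^ tri n" using 2 by (intro power_increasing tri_mono) auto
    have "level_count q n m a (n - a) \<le> (1 + q ^ n) ^ (n - a) * ?L ^ m" using 2 by auto
    also have "\<dots> \<le> (1 + q ^ n) ^ n * ?L ^ m"
      by (intro mult_right_mono power_increasing) auto
    finally show "level_count q n m a (n - a) \<le> (1 + q ^ n) ^ n * ?L ^ m" .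
  qed
  thus ?case by (simp add: mult_ac)
qed auto

context non_root_of_unity
begin

text \<open>Solves the recursion in \<open>u\<close>: \<open>j\<close> counts the undecided rows
  that turn out independent, and the powers of \<open>q\<close> from the other rows, summed over all
  orders of the decisions, form a Gaussian binomial.\<close>

lemma level_count_expand:
  fixes r :: nat
  assumes q: "q = of_nat r"
  shows "of_nat (level_count r n m a u) =
    (\<Sum>j\<le>u. q ^ (a * (u - j)) * qbinom q u j * of_nat (level_count r n m (a + j) 0))"
proof (induction u arbitrary: a)
  case 0
  show ?case by simp
next
  case (Suc u)
  let ?c = "\<lambda>j. of_nat (level_count r n m (a + j) 0)"
  have "(\<Sum>j\<le>Suc u. q ^ (a * (Suc u - j)) * qbinom q (Suc u) j * ?c j) =
      q ^ (a * Suc u) * ?c 0 + (\<Sum>j\<le>u. q ^ (a * (u - j)) * qbinom q (Suc u) (Suc j) * ?c (Suc j))"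
    by (subst sum.atMost_Suc_shift) simp
  also have "(\<Sum>j\<le>u. q ^ (a * (u - j)) * qbinom q (Suc u) (Suc j) * ?c (Suc j)) =
      (\<Sum>j\<le>u. q ^ (a * (u - j)) * qbinom q u (Suc j) * ?c (Suc j)) +
      (\<Sum>j\<le>u. q ^ (Suc a * (u - j)) * qbinom q u j * ?c (Suc j))"
    unfolding sum.distrib[symmetric]
  proof (intro sum.cong refl)
    fix j assume "j \<in> {..u}"
    hence *: "qbinom q (Suc u) (Suc j) = qbinom q u (Suc j) + q ^ (u - j) * qbinom q u j"
      by (intro qbinom_Suc) simp
    have **: "q ^ (Suc a * (u - j)) = q ^ (a * (u - j)) * q ^ (u - j)"
      by (simp add: power_add mult.commute)
    show "q ^ (a * (u - j)) * qbinom q (Suc u) (Suc j) * ?c (Suc j) =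
        q ^ (a * (u - j)) * qbinom q u (Suc j) * ?c (Suc j) + q ^ (Suc a * (u - j)) * qbinom q u j * ?c (Suc j)"
      unfolding * ** by (simp only: distrib_left distrib_right mult.assoc)
  qed
  also have "q ^ (a * Suc u) * ?c 0 + ((\<Sum>j\<le>u. q ^ (a * (u - j)) * qbinom q u (Suc j) * ?c (Suc j)) +
      (\<Sum>j\<le>u. q ^ (Suc a * (u - j)) * qbinom q u j * ?c (Suc j))) =
      (q ^ (a * Suc u) * ?c 0 + (\<Sum>j\<le>u. q ^ (a * (u - j)) * qbinom q u (Suc j) * ?c (Suc j))) +
      of_nat (level_count r n m (Suc a) u)"
    by (simp add: Suc.IH)
  also have "q ^ (a * Suc u) * ?c 0 + (\<Sum>j\<le>u. q ^ (a * (u - j)) * qbinom q u (Suc j) * ?c (Suc j)) =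
      (\<Sum>j\<le>Suc u. q ^ (a * (Suc u - j)) * qbinom q u j * ?c j)"
    by (subst sum.atMost_Suc_shift) simp
  also have "\<dots> = (\<Sum>j\<le>u. q ^ (a * (Suc u - j)) * qbinom q u j * ?c j)"
    by (simp add: qbinom_eq_0)
  also have "\<dots> = q ^ a * of_nat (level_count r n m a u)"
    unfolding Suc.IH[of a] sum_distrib_left
    by (intro sum.cong refl) (simp add: Suc_diff_le power_add mult.assoc)
  finally show ?case by (simp add: q)
qed

end

lemma non_root_of_unity_of_nat:
  assumes "q \<ge> 2"
  shows "non_root_of_unity (of_nat q :: complex)"
proof
  show "(of_nat q :: complex) ^ i \<noteq> 1" if "i > 0" for i
  proof -
    have "1 < q ^ i" using assms that by (intro one_less_power) auto
    hence "q ^ i \<noteq> 1" by (rule less_imp_neq[symmetric])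
    hence "(of_nat (q ^ i) :: complex) \<noteq> of_nat 1" by (simp only: of_nat_eq_iff not_False_eq_True)
    thus ?thesis by simp
  qed
  show "(of_nat q :: complex) \<noteq> 0" using assms by simp
qed

text \<open>Dominates both the growth rate of \<open>level_count\<close> and every
  \<open>q ^ e\<close> with \<open>e \<le> n * n + tri n\<close>. The latter covers the diagonal
  coefficients \<open>trans_coeff n h h\<close> and, since \<open>maj C \<le> tri n\<close>, the
  values substituted for the variables.\<close>

definition radius_bound :: "nat \<Rightarrow> nat \<Rightarrow> real" where
  "radius_bound q n = real ((1 + q ^ n) ^ n * q ^ (n * n + tri n))"

lemma level_count_generating_function:
  fixes t :: complex
  assumes q: "q \<ge> 2" and t: "norm t * radius_bound q n < 1"
  shows "summable (\<lambda>m. of_nat (level_count q n m 0 n) * norm t ^ m)"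
    and "(\<lambda>m. of_nat (level_count q n m 0 n) * t ^ m) sums
      (1 / (1 - t) * HLS n (1 / of_nat q) (\<lambda>C. of_nat q ^ maj C * t))"
proof -
  define Q where "Q = (of_nat q :: complex)"
  interpret non_root_of_unity Q unfolding Q_def by (rule non_root_of_unity_of_nat[OF q])
  define B where "B = radius_bound q n"
  define L where "L = (1 + q ^ n) ^ n * q ^ tri n"
  have qpow: "q ^ e \<le> q ^ (n * n + tri n)" if "e \<le> n * n + tri n" for e
    using q that by (intro power_increasing) auto
  have B_ge: "real (q ^ e) \<le> B" if "e \<le> n * n + tri n" for e
  proof -
    have "1 * q ^ e \<le> (1 + q ^ n) ^ n * q ^ (n * n + tri n)"
      using qpow[OF that] by (intro mult_le_mono) auto
    from of_nat_mono[OF this] show ?thesis unfolding B_def radius_bound_def by (simp only: mult_1)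
  qed
  have LB: "real L \<le> B" unfolding L_def B_def radius_bound_def of_nat_le_iff
    using qpow[of "tri n"] by (intro mult_left_mono) auto
  have small: "norm (Q ^ e * t) < 1" if "e \<le> n * n + tri n" for e
  proof -
    have "norm (Q ^ e * t) = real (q ^ e) * norm t" by (simp add: Q_def norm_mult norm_power)
    also have "\<dots> \<le> B * norm t" using B_ge[OF that] by (intro mult_right_mono) auto
    finally show ?thesis using t by (simp add: B_def mult.commute)
  qed
  have summable: "summable (\<lambda>m. of_nat (level_count q n m a u) * norm t ^ m)" if "a + u \<le> n" for a u
  proof (rule summable_comparison_test')
    have "real L * norm t < 1"
      using mult_right_mono[OF LB norm_ge_zero[of t]] t by (simp add: B_def mult.commute)
    thus "summable (\<lambda>m. real ((1 + q ^ n) ^ u) * (real L * norm t) ^ m)"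
      by (intro summable_mult summable_geometric) simp
    fix m :: nat
    have "level_count q n m a u \<le> (1 + q ^ n) ^ u * L ^ m"
      unfolding L_def by (rule level_count_bound) (use q that in auto)
    hence "real (level_count q n m a u) \<le> real ((1 + q ^ n) ^ u * L ^ m)" by (rule of_nat_mono)
    hence "real (level_count q n m a u) * norm t ^ m \<le> real ((1 + q ^ n) ^ u * L ^ m) * norm t ^ m"
      by (intro mult_right_mono) auto
    thus "norm (of_nat (level_count q n m a u) * norm t ^ m) \<le> real ((1 + q ^ n) ^ u) * (real L * norm t) ^ m"
      by (simp add: power_mult_distrib)
  qed
  show "summable (\<lambda>m. of_nat (level_count q n m 0 n) * norm t ^ m)" by (rule summable) simp
  define F where "F a u = (\<Sum>m. of_nat (level_count q n m a u) * t ^ m)" for a u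
  have F_sums: "(\<lambda>m. of_nat (level_count q n m a u) * t ^ m) sums F a u" if "a + u \<le> n" for a u
    unfolding F_def
    by (intro summable_sums summable_norm_cancel[OF summable_cong[THEN iffD1, OF _ summable[OF that]]])
       (simp add: norm_mult norm_power)
  define H where "H a = F a (n - a)" for a
  \<comment> \<open>The coefficient at \<open>m = 0\<close> is nonzero only for
    \<open>a = n\<close>; all later ones come from dividing out a uniformizer, which shifts the
    series by one factor \<open>t\<close>.\<close>
  have F0: "F a 0 = (if a = n then 1 else 0) + t * (Q ^ tri a * H a)" if a: "a \<le> n" for a
  proof -
    have "(\<lambda>m. t * (Q ^ tri a * (of_nat (level_count q n m a (n - a)) * t ^ m))) sums (t * (Q ^ tri a * H a))"
      unfolding H_def by (intro sums_mult F_sums) (use a in simp)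
    hence "(\<lambda>m. of_nat (level_count q n (Suc m) a 0) * t ^ Suc m) sums (t * (Q ^ tri a * H a))"
      by (simp add: Q_def mult_ac)
    from sums_Suc[where f = "\<lambda>m. of_nat (level_count q n m a 0) * t ^ m", OF this]
    have "(\<lambda>m. of_nat (level_count q n m a 0) * t ^ m) sums
        (t * (Q ^ tri a * H a) + of_nat (level_count q n 0 a 0) * t ^ 0)" .
    moreover have "(\<lambda>m. of_nat (level_count q n m a 0) * t ^ m) sums F a 0" by (rule F_sums) (use a in simp)
    ultimately have "F a 0 = t * (Q ^ tri a * H a) + of_nat (level_count q n 0 a 0) * t ^ 0"
      by (rule sums_unique2[symmetric])
    thus ?thesis by simp
  qed
  \<comment> \<open>Deciding all rows and then dividing out one uniformizer leads back to stages of
    the form \<open>u = n - a\<close>, so these stages satisfy a closed system.\<close>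
  have H: "H a = 1 + t * (\<Sum>h=a..n. Q ^ (a * (n - h) + tri h) * qbinom Q (n - a) (h - a) * H h)"
    if a: "a \<le> n" for a
  proof -
    have "(\<lambda>m. \<Sum>j\<le>n - a. Q ^ (a * (n - a - j)) * qbinom Q (n - a) j * (of_nat (level_count q n m (a + j) 0) * t ^ m))
        sums (\<Sum>j\<le>n - a. Q ^ (a * (n - a - j)) * qbinom Q (n - a) j * F (a + j) 0)"
      by (intro sums_sum sums_mult F_sums) (use a in auto)
    moreover have "of_nat (level_count q n m a (n - a)) * t ^ m = (\<Sum>j\<le>n - a.
        Q ^ (a * (n - a - j)) * qbinom Q (n - a) j * (of_nat (level_count q n m (a + j) 0) * t ^ m))" for m
      by (simp only: level_count_expand[OF Q_def, of n m a "n - a"] sum_distrib_right mult.assoc)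
    ultimately have "(\<lambda>m. of_nat (level_count q n m a (n - a)) * t ^ m) sums
        (\<Sum>j\<le>n - a. Q ^ (a * (n - a - j)) * qbinom Q (n - a) j * F (a + j) 0)" by (simp only:)
    moreover have "(\<lambda>m. of_nat (level_count q n m a (n - a)) * t ^ m) sums H a"
      unfolding H_def by (rule F_sums) (use a in simp)
    ultimately have "H a = (\<Sum>j\<le>n - a. Q ^ (a * (n - a - j)) * qbinom Q (n - a) j * F (a + j) 0)"
      by (rule sums_unique2[symmetric])
    also have "\<dots> = (\<Sum>h=a..n. Q ^ (a * (n - h)) * qbinom Q (n - a) (h - a) * F h 0)"
      by (rule sum.reindex_bij_witness[of _ "\<lambda>h. h - a" "\<lambda>j. a + j"]) (use a in auto)
    also have "\<dots> = (\<Sum>h=a..n. (if h = n then 1 else 0) +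
        t * (Q ^ (a * (n - h) + tri h) * qbinom Q (n - a) (h - a) * H h))"
      by (intro sum.cong refl) (auto simp: F0 power_add distrib_left mult_ac)
    also have "\<dots> = 1 + t * (\<Sum>h=a..n. Q ^ (a * (n - h) + tri h) * qbinom Q (n - a) (h - a) * H h)"
      using a by (simp add: sum.distrib sum_distrib_left)
    finally show ?thesis .
  qed
  have "trans_coeff n h h * t \<noteq> 1" if "1 \<le> h" "h \<le> n" for h
  proof -
    have "h * (n - h) + tri h \<le> n * n + tri n" using that by (intro add_mono mult_le_mono tri_mono) auto
    from small[OF this] show ?thesis by (auto simp: trans_coeff_def)
  qed
  then obtain W where W: "\<And>h. h \<le> n \<Longrightarrow> W h = 1 + (\<Sum>k=1..h. trans_coeff n h k * t * W k)"
    using transfer_solution_ex[of n t] by blast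
  have t1: "t \<noteq> 1" using small[of 0] by auto
  \<comment> \<open>The equations for \<open>W\<close> start at \<open>k = 1\<close>. Admitting
    \<open>k = 0\<close>, with coefficient 1, means solving \<open>V 0 = 1 + t * V 0\<close>, and
    this rescales every component by \<open>1 / (1 - t)\<close>: the factor in front of the
    series.\<close>
  define V where "V h = W h / (1 - t)" for h
  have V: "V h = 1 + t * (\<Sum>k\<le>n. trans_coeff n h k * V k)" if h: "h \<le> n" for h
  proof -
    have "(\<Sum>k\<le>n. trans_coeff n h k * W k) = (\<Sum>k\<le>h. trans_coeff n h k * W k)"
      using h by (intro sum.mono_neutral_right) (auto simp: trans_coeff_def qbinom_eq_0)
    also have "\<dots> = 1 + (\<Sum>k=1..h. trans_coeff n h k * W k)"
      using W[of 0] by (simp add: sum.atLeast_Suc_atMost atMost_atLeast0 trans_coeff_def)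
    finally have eq: "t * (\<Sum>k\<le>n. trans_coeff n h k * W k) = t + (W h - 1)"
      using W[OF h] by (simp add: algebra_simps sum_distrib_left)
    have "t * (\<Sum>k\<le>n. trans_coeff n h k * V k) = t * (\<Sum>k\<le>n. trans_coeff n h k * W k) / (1 - t)"
      by (simp add: V_def sum_divide_distrib[symmetric])
    also have "\<dots> = (t + (W h - 1)) / (1 - t)" by (simp only: eq)
    finally have *: "t * (\<Sum>k\<le>n. trans_coeff n h k * V k) = (t + (W h - 1)) / (1 - t)" .
    show ?thesis unfolding * V_def[of h] using t1 by (simp add: field_simps)
  qed
  have "Q ^ maj C * t \<noteq> 1" if C: "C \<in> valid_cols n" for C
  proof -
    have "maj C \<le> sum (\<lambda>i. i) {1..n}" unfolding maj_def
      using C by (intro sum_mono2) (auto simp: valid_cols_def)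
    also have "\<dots> = tri n" by (induction n) (simp_all add: tri_Suc)
    finally have "norm (Q ^ maj C * t) < 1" by (intro small) simp
    thus ?thesis by auto
  qed
  hence "HLS n (inverse Q) (\<lambda>C. Q ^ maj C * t) = W n" by (intro HLS_eq W)
  moreover have "H 0 = V n" by (rule transfer_duality[OF H V])
  ultimately have "F 0 n = 1 / (1 - t) * HLS n (1 / Q) (\<lambda>C. Q ^ maj C * t)"
    by (simp add: H_def V_def inverse_eq_divide)
  thus "(\<lambda>m. of_nat (level_count q n m 0 n) * t ^ m) sums
      (1 / (1 - t) * HLS n (1 / of_nat q) (\<lambda>C. of_nat q ^ maj C * t))"
    using F_sums[of 0 n] by (simp add: Q_def)
qed

section \<open>The integral\<close>

context haar_gsp
begin

lemma emeasure_level_of_base: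
  assumes "\<And>a. a \<le> n \<Longrightarrow> emeasure M (level m a 0) = of_nat (level_count q n m a 0)"
  shows "a + u \<le> n \<Longrightarrow> emeasure M (level m a u) = of_nat (level_count q n m a u)"
proof (induction u arbitrary: a)
  case (Suc u)
  thus ?case by (simp add: emeasure_level_Suc)
qed (simp add: assms)

lemma emeasure_level: "a + u \<le> n \<Longrightarrow> emeasure M (level m a u) = of_nat (level_count q n m a u)"
proof (induction m arbitrary: a u)
  case 0
  have "emeasure M (GSp_o v q n J) = 1" using haar by (simp add: normalized_haar_def)
  thus ?case by (intro emeasure_level_of_base[OF _ 0]) (simp add: level_0)
next
  case (Suc m)
  show ?case
    by (rule emeasure_level_of_base[OF _ Suc.prems])
       (simp add: emeasure_level_scale Suc.IH tri_def)
qed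

text \<open>The determinant has valuation \<open>n * m\<close> by \<open>sim_det\<close>. The base
  of the complex power is a positive real, so its logarithm is real and no branch question
  arises.\<close>

lemma integrand_on_level:
  fixes s :: complex
  assumes A: "sim A c" "v c = int m"
  shows "complex_of_real (kabs v q (det A)) powr s = (of_nat q powr (- (of_nat n * s))) ^ m"
proof -
  have q: "real q > 0" using residues_ge_2 by simp
  have "kabs v q (det A) = exp (- real (n * m) * ln (real q))"
    using sim_det[OF A(1)] A(2) q by (simp add: kabs_def powr_def)
  hence "complex_of_real (kabs v q (det A)) = exp (of_real (- real (n * m) * ln (real q)))"
    by (simp only: exp_of_real)
  moreover have "Ln (exp (of_real (- real (n * m) * ln (real q)))) = complex_of_real (- real (n * m) * ln (real q))"
    by (intro Ln_exp) auto
  ultimately have "complex_of_real (kabs v q (det A)) powr s =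
      exp (s * complex_of_real (- real (n * m) * ln (real q)))"
    by (simp add: powr_def)
  also have "\<dots> = exp (of_nat m * (- (of_nat n * s) * Ln (of_nat q)))"
    using q Ln_of_real[of "real q"] by (simp add: mult_ac)
  also have "\<dots> = (of_nat q powr (- (of_nat n * s))) ^ m"
    using residues_ge_2 by (simp only: powr_def exp_of_nat_mult) simp
  finally show ?thesis .
qed

text \<open>At each point at most one of the terms \<open>?f m\<close> is nonzero, so the integrand
  is a countable sum of constants on disjoint sets. Summability of the integrals of the norms
  justifies integrating term by term.\<close>

lemma integral_GSp_plus:
  fixes s :: complex
  defines "t \<equiv> of_nat q powr (- (of_nat n * s)) :: complex"
  assumes t: "norm t * radius_bound q n < 1"
  shows "set_integrable M (GSp_plus v n J) (\<lambda>A. complex_of_real (kabs v q (det A)) powr s)"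
    and "(LINT A:GSp_plus v n J|M. complex_of_real (kabs v q (det A)) powr s) =
      1 / (1 - t) * HLS n (1 / of_nat q) (\<lambda>C. of_nat q ^ maj C * t)"
proof -
  let ?E = "\<lambda>m. level m 0 n"
  let ?f = "\<lambda>m A. indicat_real (?E m) A *\<^sub>R t ^ m"
  let ?g = "\<lambda>A. indicat_real (GSp_plus v n J) A *\<^sub>R (complex_of_real (kabs v q (det A)) powr s)"
  note gf = level_count_generating_function[OF residues_ge_2 t]
  have sets: "?E m \<in> sets M" for m by (intro right_invariant_sets level_right_invariant) simp
  have em: "emeasure M (?E m) = ennreal (real (level_count q n m 0 n))" for m
    by (simp add: emeasure_level ennreal_of_nat_eq_real_of_nat)
  hence meas: "measure M (?E m) = real (level_count q n m 0 n)" for m by (simp add: measure_def)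
  have int_ind: "integrable M (indicat_real (?E m))" for m
    using sets em by (simp add: integrable_indicator_iff)
  have int: "integrable M (?f m)" for m by (intro integrable_scaleR_left int_ind)
  have single: "(\<lambda>m. ?f m A) sums ?g A" for A
  proof (cases "A \<in> GSp_plus v n J")
    case False
    hence "A \<notin> ?E m" for m by (simp add: level_full)
    thus ?thesis using False by simp
  next
    case True
    then obtain c where c: "sim A c" by (auto simp: GSp_plus_def GSp_iff)
    have "intmat N A" using True by (simp add: GSp_plus_def integral_mat_def intmat_def)
    hence "v c \<ge> 0" using sim_integral[OF c] c by (auto simp: sim_def ring_of_integers_def)
    then obtain k where k: "v c = int k" using nonneg_eq_int by blast
    have "A \<in> ?E m \<longleftrightarrow> m = k" for m
    proof
      assume "A \<in> ?E m"
      then obtain d where "sim A d" "v d = int m" unfolding level_full by blast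
      thus "m = k" using sim_unique[OF c] k by fastforce
    next
      assume "m = k"
      thus "A \<in> ?E m" unfolding level_full using True c k by blast
    qed
    hence "?f m A = (if m = k then t ^ m else 0)" for m by (simp add: indicator_def)
    moreover have "?g A = t ^ k" using True integrand_on_level[OF c k] by (simp add: t_def)
    ultimately show ?thesis using sums_single[of k "\<lambda>m. t ^ m"] by (simp only:)
  qed
  have norm_f: "norm (?f m A) = indicat_real (?E m) A * norm t ^ m" for m A
    by (simp add: norm_power)
  have abs_sum: "summable (\<lambda>m. norm (?f m A))" for A
  proof (rule summable_comparison_test')
    have "1 \<le> radius_bound q n"
    proof -
      have "1 * 1 \<le> (1 + q ^ n) ^ n * q ^ (n * n + tri n)"
        using residues_ge_2 by (intro mult_le_mono) (auto simp: Suc_le_eq)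
      from of_nat_mono[OF this] show ?thesis unfolding radius_bound_def by (simp only: mult_1 of_nat_1)
    qed
    hence "norm t * 1 \<le> norm t * radius_bound q n" by (intro mult_left_mono) auto
    hence "norm t < 1" using t by simp
    thus "summable (\<lambda>m. norm t ^ m)" by (intro summable_geometric) simp
    show "norm (norm (?f m A)) \<le> norm t ^ m" for m
      by (simp add: indicator_def norm_power)
  qed
  have int_norm: "(\<integral>A. norm (?f m A) \<partial>M) = of_nat (level_count q n m 0 n) * norm t ^ m" for m
    unfolding norm_f using sets int_ind meas by simp
  have g: "(\<lambda>A. \<Sum>m. ?f m A) = ?g" using single by (intro ext) (simp add: sums_iff)
  have AE: "AE A in M. summable (\<lambda>m. norm (?f m A))" using abs_sum by simp
  have sum_int: "summable (\<lambda>m. \<integral>A. norm (?f m A) \<partial>M)" unfolding int_norm by (rule gf(1))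
  show "set_integrable M (GSp_plus v n J) (\<lambda>A. complex_of_real (kabs v q (det A)) powr s)"
    using integrable_suminf[OF int AE sum_int] unfolding g set_integrable_def .
  have "(\<lambda>m. \<integral>A. ?f m A \<partial>M) sums (\<integral>A. ?g A \<partial>M)"
    using sums_integral[OF int AE sum_int] unfolding g .
  moreover have "(\<integral>A. ?f m A \<partial>M) = of_nat (level_count q n m 0 n) * t ^ m" for m
    using int_ind sets meas by (simp add: scaleR_conv_of_real)
  ultimately have "(\<lambda>m. of_nat (level_count q n m 0 n) * t ^ m) sums (\<integral>A. ?g A \<partial>M)" by (simp only:)
  from sums_unique2[OF this gf(2)] show "(LINT A:GSp_plus v n J|M. complex_of_real (kabs v q (det A)) powr s) =
      1 / (1 - t) * HLS n (1 / of_nat q) (\<lambda>C. of_nat q ^ maj C * t)"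
    unfolding set_lebesgue_integral_def .
qed

end

theorem mainTheorem18:
  fixes v :: "'k::field \<Rightarrow> int" and q n :: nat and J :: "'k mat" and M :: "'k mat measure"
  assumes "nonarch_local_field v q"
    and "n \<ge> 1"
    and "alt_unimodular v q n J"
    and "normalized_haar v q n J M"
  shows "\<exists>R::real. \<forall>s::complex. R < Re s \<longrightarrow>
     set_integrable M (GSp_plus v n J) (\<lambda>A. complex_of_real (kabs v q (det A)) powr s) \<and>
     (LINT A:GSp_plus v n J|M. complex_of_real (kabs v q (det A)) powr s) =
       1 / (1 - of_nat q powr (- (of_nat n * s))) *
       HLS n (1 / of_nat q) (\<lambda>C. of_nat q powr (of_nat (maj C) - of_nat n * s))"
proof -
  interpret valued_field v q by unfold_locales (rule assms(1))
  obtain K where K: "K \<in> carrier_mat (2*n) (2*n)" "intmat (2*n) K"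
    "transpose_mat K * std_symp n * K = J" "det K \<noteq> 0" "v (det K) = 0"
    using symplectic_basis_ex[OF assms(3)] by blast
  obtain L where L: "L \<in> carrier_mat (2*n) (2*n)" "intmat (2*n) L" "K * L = 1\<^sub>m (2*n)" "L * K = 1\<^sub>m (2*n)"
    using intmat_inverse_ex[OF K(1,2,4,5)] by blast
  obtain p where p: "p \<noteq> 0" "v p = 1" using uniformizer_ex by blast
  interpret haar_gsp v q n J M K L p
    by unfold_locales (fact assms K L p)+
  have q: "real q > 1" using residues_ge_2 by simp
  \<comment> \<open>Since the norm of \<open>t\<close> is \<open>q powr (- (n * Re s))\<close>, the
    condition \<open>R < Re s\<close> states exactly that it is below
    \<open>1 / radius_bound q n\<close>.\<close>
  define R where "R = log (real q) (radius_bound q n) / real n"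
  show ?thesis
  proof (intro exI[of _ R] allI impI)
    fix s :: complex assume s: "R < Re s"
    define t where "t = (of_nat q :: complex) powr (- (of_nat n * s))"
    have B: "radius_bound q n > 0" using q unfolding radius_bound_def by (intro of_nat_0_less_iff[THEN iffD2]) simp
    have "log (real q) (radius_bound q n) < real n * Re s"
      using s n_pos by (simp add: R_def field_simps)
    hence "radius_bound q n < real q powr (real n * Re s)" using B q by (simp add: log_less_iff)
    moreover have "norm t = real q powr (- (real n * Re s))"
      unfolding t_def using q norm_powr_real_powr[of "of_nat q" "- (of_nat n * s)"] by simp
    ultimately have "norm t * radius_bound q n < real q powr (- (real n * Re s)) * real q powr (real n * Re s)"
      using q by simp
    also have "\<dots> = 1" using q by (simp add: powr_add[symmetric])
    finally have "norm t * radius_bound q n < 1" .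
    note int = integral_GSp_plus[OF this[unfolded t_def], folded t_def]
    have "of_nat q powr (of_nat (maj C) - of_nat n * s) = of_nat q ^ maj C * t" for C
    proof -
      have "of_nat q powr (of_nat (maj C) + - (of_nat n * s)) = of_nat q powr of_nat (maj C) * t"
        unfolding t_def by (rule powr_add)
      also have "of_nat q powr of_nat (maj C) = (of_nat q :: complex) ^ maj C" using q by (simp add: powr_nat')
      finally show ?thesis by simp
    qed
    thus "set_integrable M (GSp_plus v n J) (\<lambda>A. complex_of_real (kabs v q (det A)) powr s) \<and>
     (LINT A:GSp_plus v n J|M. complex_of_real (kabs v q (det A)) powr s) =
       1 / (1 - of_nat q powr (- (of_nat n * s))) *
       HLS n (1 / of_nat q) (\<lambda>C. of_nat q powr (of_nat (maj C) - of_nat n * s))"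
      using int by (simp add: t_def)
  qed
qed

end
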